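(* Let $\mathcal{M}$ be a stack polyomino and let $\sigma$ be a permutation of the rows of $\mathcal{M}$ such that $\sigma\mathcal{M}$ (the polyomino obtained by rearranging the rows of $\mathcal{M}$ according to $\sigma$, keeping them left-justified) is again a stack polyomino. Then for all nonnegative integers $n,u,v$, \[N(\mathcal{M};n;ne=u,se=v)=N(\sigma\mathcal{M};n;ne=u,se=v).\]
   Context: A polyomino is a finite set of unit squares (boxes) of the plane lattice. It is row-convex (column-convex) if each of its rows (columns) is connected, and convex if both. It is intersection-free if for any two columns, the set of row-coordinates of one is contained in that of the other. A moon polyomino is a convex, intersection-free polyomino. A stack polyomino is a moon polyomino whose rows are all left-justified (equivalently, columns are arranged by length weakly decreasing from left to right); it is determined by its sequence of row lengths from bottom to top, which is unimodal. A filling of a polyomino is an assignment of $0$ or $1$ to each box such that each column contains at most one $1$. A chain in a filling is a sequence of $1$-boxes such that the smallest rectangle containing all of them is entirely contained in the polyomino. An ne-chain is a chain in which each box is strictly to the right of and strictly above the preceding one; an se-chain is a chain in which each box is strictly to the right of and strictly below the preceding one. The length of a chain is its number of entries. $N(\mathcal{M};n;ne=u,se=v)$ denotes the number of fillings of $\mathcal{M}$ whose entries sum to $n$, whose longest ne-chain has length $u$, and whose longest se-chain has length $v$. *)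

theory Defs
  imports Main "HOL.Hull" "HOL-Library.FuncSet" "HOL-Combinatorics.Permutations"
begin

text \<open>
  The box \<open>(i, j)\<close> lies in column \<open>i\<close> and row \<open>j\<close>; columns are numbered from left to right
  and rows from bottom to top.
\<close>

type_synonym box = "int \<times> int"

definition column_of :: "box set \<Rightarrow> int \<Rightarrow> int set" where
  "column_of M i = {j. (i, j) \<in> M}"

definition row_of :: "box set \<Rightarrow> int \<Rightarrow> int set" where
  "row_of M j = {i. (i, j) \<in> M}"

definition row_indices :: "box set \<Rightarrow> int set" where
  "row_indices M = {j. row_of M j \<noteq> {}}"

definition connected_line :: "int set \<Rightarrow> bool" where
  "connected_line S \<longleftrightarrow> (\<forall>a\<in>S. \<forall>b\<in>S. {a..b} \<subseteq> S)"

definition polyomino :: "box set \<Rightarrow> bool" where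
  "polyomino M \<longleftrightarrow> finite M"

definition row_convex :: "box set \<Rightarrow> bool" where
  "row_convex M \<longleftrightarrow> (\<forall>j. connected_line (row_of M j))"

definition column_convex :: "box set \<Rightarrow> bool" where
  "column_convex M \<longleftrightarrow> (\<forall>i. connected_line (column_of M i))"

definition convex_polyomino :: "box set \<Rightarrow> bool" where
  "convex_polyomino M \<longleftrightarrow> polyomino M \<and> row_convex M \<and> column_convex M"

definition intersection_free :: "box set \<Rightarrow> bool" where
  "intersection_free M \<longleftrightarrow> (\<forall>i i'. column_of M i \<subseteq> column_of M i' \<or> column_of M i' \<subseteq> column_of M i)"

definition moon_polyomino :: "box set \<Rightarrow> bool" where
  "moon_polyomino M \<longleftrightarrow> convex_polyomino M \<and> intersection_free M"

definition left_justified :: "box set \<Rightarrow> bool" where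
  "left_justified M \<longleftrightarrow> (\<forall>j\<in>row_indices M. \<forall>j'\<in>row_indices M. Min (row_of M j) = Min (row_of M j'))"

definition stack_polyomino :: "box set \<Rightarrow> bool" where
  "stack_polyomino M \<longleftrightarrow> moon_polyomino M \<and> left_justified M"

text \<open>
  Rows are moved vertically only, so left-justified rows stay left-justified.
\<close>

definition permute_rows :: "(int \<Rightarrow> int) \<Rightarrow> box set \<Rightarrow> box set" where
  "permute_rows \<sigma> M = (\<lambda>(i, j). (i, \<sigma> j)) ` M"

definition fillings :: "box set \<Rightarrow> (box \<Rightarrow> nat) set" where
  "fillings M = {F \<in> M \<rightarrow>\<^sub>E {0, 1}. \<forall>i. \<exists>\<^sub>\<le>\<^sub>1 j. j \<in> column_of M i \<and> F (i, j) = 1}"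

definition rectangle :: "box set \<Rightarrow> bool" where
  "rectangle R \<longleftrightarrow> (\<exists>a b c d. R = {a..b} \<times> {c..d})"

text \<open>
  The hull is the smallest rectangle containing the boxes of the chain. It is empty for the
  empty sequence, which therefore is a chain of length \<open>0\<close>.
\<close>

definition chain :: "box set \<Rightarrow> (box \<Rightarrow> nat) \<Rightarrow> box list \<Rightarrow> bool" where
  "chain M F bs \<longleftrightarrow> (\<forall>b\<in>set bs. b \<in> M \<and> F b = 1) \<and> rectangle hull (set bs) \<subseteq> M"

definition ne_chain :: "box set \<Rightarrow> (box \<Rightarrow> nat) \<Rightarrow> box list \<Rightarrow> bool" where
  "ne_chain M F bs \<longleftrightarrow>
     chain M F bs \<and> successively (\<lambda>(i, j) (i', j'). i < i' \<and> j < j') bs"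

definition se_chain :: "box set \<Rightarrow> (box \<Rightarrow> nat) \<Rightarrow> box list \<Rightarrow> bool" where
  "se_chain M F bs \<longleftrightarrow>
     chain M F bs \<and> successively (\<lambda>(i, j) (i', j'). i < i' \<and> j' < j) bs"

definition ne :: "box set \<Rightarrow> (box \<Rightarrow> nat) \<Rightarrow> nat" where
  "ne M F = Max (length ` {bs. ne_chain M F bs})"

definition se :: "box set \<Rightarrow> (box \<Rightarrow> nat) \<Rightarrow> nat" where
  "se M F = Max (length ` {bs. se_chain M F bs})"

definition num_fillings :: "box set \<Rightarrow> nat \<Rightarrow> nat \<Rightarrow> nat \<Rightarrow> nat" where
  "num_fillings M n u v =
     card {F \<in> fillings M. (\<Sum>b\<in>M. F b) = n \<and> ne M F = u \<and> se M F = v}"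

text \<open>
  The sets whose maxima define \<open>ne\<close> and \<open>se\<close> are finite and nonempty, and \<open>rectangle hull\<close> is
  the usual bounding box.
\<close>

lemma finite_distinct_lists:
  assumes "finite M" and "\<And>bs. P bs \<Longrightarrow> set bs \<subseteq> M \<and> distinct bs"
  shows "finite {bs. P bs}"
proof (rule finite_subset)
  show "{bs. P bs} \<subseteq> {bs. set bs \<subseteq> M \<and> distinct bs}"
    using assms(2) by blast
  show "finite {bs. set bs \<subseteq> M \<and> distinct bs}"
    using assms(1) by (rule finite_subset_distinct)
qed

lemma successively_right_distinct:
  fixes bs :: "box list"
  assumes "successively R bs" and "\<And>b b'. R b b' \<Longrightarrow> fst b < fst b'"
  shows "distinct bs"
proof -
  have "successively (\<lambda>b b'. fst b < fst b') bs"
    using assms by (metis (mono_tags, lifting) successively_mono)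
  then have "successively (<) (map fst bs)"
    by (simp add: successively_map)
  then have "sorted_wrt (<) (map fst bs)"
    by (simp add: successively_conv_sorted_wrt)
  then show ?thesis
    using distinct_map strict_sorted_iff by blast
qed

lemma finite_ne_chains: "finite M \<Longrightarrow> finite {bs. ne_chain M F bs}"
  by (rule finite_distinct_lists)
    (auto simp: ne_chain_def chain_def intro: successively_right_distinct)

lemma finite_se_chains: "finite M \<Longrightarrow> finite {bs. se_chain M F bs}"
  by (rule finite_distinct_lists)
    (auto simp: se_chain_def chain_def intro: successively_right_distinct)

lemma rectangle_hull_empty: "rectangle hull {} = {}"
proof -
  have "rectangle {}"
    unfolding rectangle_def by (intro exI[of _ 1] exI[of _ 0]) simp
  then show ?thesis
    by (simp add: hull_same)
qed

lemma ne_chain_Nil: "ne_chain M F []"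
  by (simp add: ne_chain_def chain_def rectangle_hull_empty)

lemma se_chain_Nil: "se_chain M F []"
  by (simp add: se_chain_def chain_def rectangle_hull_empty)

lemma rectangle_hull_eq:
  assumes "finite S" and "S \<noteq> {}"
  shows "rectangle hull S =
    {Min (fst ` S)..Max (fst ` S)} \<times> {Min (snd ` S)..Max (snd ` S)}" (is "_ = ?B")
proof (rule hull_unique)
  show "S \<subseteq> ?B"
    using assms by (force intro: Min_le Max_ge)
  show "rectangle ?B"
    unfolding rectangle_def by blast
  fix T
  assume ST: "S \<subseteq> T" and "rectangle T"
  then obtain a b c d where T: "T = {a..b} \<times> {c..d}"
    unfolding rectangle_def by blast
  have "a \<le> Min (fst ` S)" "Max (fst ` S) \<le> b" "c \<le> Min (snd ` S)" "Max (snd ` S) \<le> d"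
    using assms ST unfolding T by (auto simp: Min_ge_iff Max_le_iff)
  then show "?B \<subseteq> T"
    unfolding T by auto
qed

end

theory Submission
  imports Defs "HOL-Library.Multiset"
begin

text \<open>
  Reading a filling of a stack column by column gives a word over a shrinking interval of rows, and
  a chain is an increasing or decreasing subsequence of a prefix restricted to the current interval.
  Record for such a word its profile: the lengths of the longest increasing and decreasing
  subsequences among the letters of every subinterval. The profile controls what happens when a
  letter is appended or when the top or bottom letter of the alphabet is removed. Thus it suffices
  that the multiset of profiles of the fillings of the first columns reacts in the same way to the
  removal of a top row and of a bottom row.

  This holds for the multiset of profiles of all increasing tableaux of a fixed straight shape with
  letters up to a fixed bound. Removing the largest letter leaves all tableaux on the inner shapes
  that differ from the given one by a rook strip, and so does removing the smallest letter followed
  by the slide of the K-theoretic jeu de taquin of Thomas and Yong, which is a bijection and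
  preserves profiles. Appending a letter to all tableaux of one shape is a sum of such multisets
  again: place the letter to the north-east of the tableau and rectify along a row, where the
  tableau recording the rectification is recognised by its profile alone. The longest sequences of
  the whole tableau depend only on the shape, so bounds on the chain lengths select shapes. Hence
  the profile multisets, restricted to fillings with bounded chains, depend only on the lengths of
  the columns.
\<close>

section \<open>Increasing point sets\<close>

text \<open>A row of a filling may carry several 1-boxes, so the words have repeated letters, while
  ne-chains and se-chains are both strict in the rows. RSK makes one of the two kinds of chains
  weak; increasing tableaux, strict in rows and in columns, treat them alike, and this is why the
  K-theoretic theory enters. There, rectification can depend on the order of the slides, so a word
  has no canonical tableau. Hence only multisets of profiles are compared, and all that is asked of
  slides is a bijection on pairs of tableaux that exchanges the profiles. The lengths are handled
  through the bounds \<open>ne M F \<le> u\<close> and \<open>se M F \<le> v\<close>. A chain has to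
  fit into a rectangle inside the stack, so a bound says that, for each column, the 1-boxes weakly
  to its left and in its rows form short sequences only. Such a condition can be imposed one column
  at a time, unlike the exact value of a maximum over all columns. The exact numbers are differences
  of the bounded ones.\<close>

definition increasing :: "('a::linorder \<times> 'b::linorder) set \<Rightarrow> bool" where
  "increasing X \<longleftrightarrow> (\<forall>p\<in>X. \<forall>q\<in>X. p \<noteq> q \<longrightarrow>
     fst p < fst q \<and> snd p < snd q \<or> fst q < fst p \<and> snd q < snd p)"

text \<open>Only the first coordinates have to be finite in number. This covers the point sets of
  the infinite shapes below, where one letter may occupy infinitely many cells: an increasing set
  has at most one point for each first coordinate.\<close>

definition lis :: "('a::linorder \<times> 'b::linorder) set \<Rightarrow> nat" where
  "lis S = Max (card ` {X. X \<subseteq> S \<and> increasing X})"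

lemma increasingD:
  assumes "increasing X" "(x, y) \<in> X" "(x', y') \<in> X" "(x, y) \<noteq> (x', y')"
  shows "x < x' \<and> y < y' \<or> x' < x \<and> y' < y"
  using assms(1)[unfolded increasing_def, rule_format, OF assms(2,3,4)] by simp

lemma increasing_subset: "increasing X \<Longrightarrow> Y \<subseteq> X \<Longrightarrow> increasing Y"
  unfolding increasing_def by blast

lemma increasing_insert:
  assumes "increasing X"
    and "\<And>p. p \<in> X \<Longrightarrow> fst p < x \<and> snd p < y \<or> x < fst p \<and> y < snd p"
  shows "increasing (insert (x, y) X)"
  using assms unfolding increasing_def by auto

lemma increasing_inj_fst: "increasing X \<Longrightarrow> inj_on fst X"
  unfolding increasing_def inj_on_def by (metis less_irrefl)

lemma increasing_inj_snd: "increasing X \<Longrightarrow> inj_on snd X"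
  unfolding increasing_def inj_on_def by (metis less_irrefl)

lemma increasing_finite:
  assumes "increasing X" "X \<subseteq> S" "finite (fst ` S)"
  shows "finite X"
  using assms increasing_inj_fst finite_imageD
  by (metis finite_subset image_mono)

lemma finite_increasing_cards:
  assumes "finite (fst ` S)"
  shows "finite (card ` {X. X \<subseteq> S \<and> increasing X})"
proof (rule finite_subset)
  show "card ` {X. X \<subseteq> S \<and> increasing X} \<subseteq> {..card (fst ` S)}"
  proof (rule image_subsetI)
    fix X assume "X \<in> {X. X \<subseteq> S \<and> increasing X}"
    then have X: "X \<subseteq> S" "increasing X" by auto
    then have "card X = card (fst ` X)"
      by (simp add: card_image increasing_inj_fst)
    also have "\<dots> \<le> card (fst ` S)"
      using X assms by (intro card_mono image_mono) auto
    finally show "card X \<in> {..card (fst ` S)}" by simp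
  qed
qed simp

lemma lis_ge:
  assumes "finite (fst ` S)" "X \<subseteq> S" "increasing X"
  shows "card X \<le> lis S"
  unfolding lis_def using assms by (intro Max_ge finite_increasing_cards) auto

lemma lis_obtain:
  assumes "finite (fst ` S)"
  obtains X where "X \<subseteq> S" "increasing X" "finite X" "card X = lis S"
proof -
  have "{} \<subseteq> S \<and> increasing {}" by (simp add: increasing_def)
  then have "card ` {X. X \<subseteq> S \<and> increasing X} \<noteq> {}" by blast
  from Max_in[OF finite_increasing_cards[OF assms] this] that show thesis
    unfolding lis_def using increasing_finite[OF _ _ assms] by auto
qed

lemma lis_mono: "finite (fst ` T) \<Longrightarrow> S \<subseteq> T \<Longrightarrow> lis S \<le> lis T"
proof -
  assume T: "finite (fst ` T)" and ST: "S \<subseteq> T"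
  then have "finite (fst ` S)" by (meson finite_subset image_mono)
  from lis_obtain[OF this] obtain X where "X \<subseteq> S" "increasing X" "card X = lis S" by metis
  with ST lis_ge[OF T, of X] show ?thesis by auto
qed

lemma lis_empty [simp]: "lis {} = 0"
  by (simp add: lis_def increasing_def)

lemma lis_image_le:
  assumes "finite (fst ` T)" "\<phi> ` S \<subseteq> T" "finite (fst ` S)" "inj_on \<phi> S"
    and "\<And>X. X \<subseteq> S \<Longrightarrow> increasing X \<Longrightarrow> increasing (\<phi> ` X)"
  shows "lis S \<le> lis T"
proof -
  obtain X where X: "X \<subseteq> S" "increasing X" "finite X" "card X = lis S"
    using lis_obtain[OF assms(3)] .
  have "card (\<phi> ` X) = card X"
    using assms(4) X(1) by (meson card_image inj_on_subset)
  moreover have "card (\<phi> ` X) \<le> lis T"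
    using assms X by (intro lis_ge) auto
  ultimately show ?thesis using X by simp
qed

text \<open>A chain through the new topmost point meets \<open>S\<close> only to the left of that
  point. With its mirror image \<open>lis_insert_first\<close> this computes what an appended letter
  does to a profile, for tableaux and for words.\<close>

lemma lis_insert_last:
  assumes fin: "finite (fst ` S)" and last: "\<And>p. p \<in> S \<Longrightarrow> snd p < y"
  shows "lis (insert (x, y) S) = max (lis S) (Suc (lis {p \<in> S. fst p < x}))"
proof (rule antisym)
  have fin': "finite (fst ` insert (x, y) S)" "finite (fst ` {p \<in> S. fst p < x})"
    using fin by (auto intro: finite_subset[OF _ fin])
  obtain X where X: "X \<subseteq> insert (x, y) S" "increasing X" "finite X" "card X = lis (insert (x, y) S)"
    using lis_obtain[OF fin'(1)] .
  show "lis (insert (x, y) S) \<le> max (lis S) (Suc (lis {p \<in> S. fst p < x}))"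
  proof (cases "(x, y) \<in> X")
    case False
    then have "X \<subseteq> S" using X by auto
    then show ?thesis using lis_ge[OF fin _ X(2)] X(4) by simp
  next
    case True
    have "X - {(x, y)} \<subseteq> {p \<in> S. fst p < x}"
    proof
      fix p assume p: "p \<in> X - {(x, y)}"
      then have "p \<in> S" using X by auto
      then have "snd p < y" by (rule last)
      then show "p \<in> {p \<in> S. fst p < x}"
        using X(2) True p \<open>p \<in> S\<close> unfolding increasing_def by force
    qed
    then have "card (X - {(x, y)}) \<le> lis {p \<in> S. fst p < x}"
      using X(2) by (intro lis_ge fin') (auto intro: increasing_subset)
    then show ?thesis using True X by simp
  qed
next
  have fin': "finite (fst ` insert (x, y) S)" "finite (fst ` {p \<in> S. fst p < x})"
    using fin by (auto intro: finite_subset[OF _ fin])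
  obtain X where X: "X \<subseteq> {p \<in> S. fst p < x}" "increasing X" "finite X"
    "card X = lis {p \<in> S. fst p < x}"
    using lis_obtain[OF fin'(2)] .
  have "increasing (insert (x, y) X)"
    using X last by (intro increasing_insert) auto
  then have "card (insert (x, y) X) \<le> lis (insert (x, y) S)"
    using X by (intro lis_ge fin') auto
  moreover have "(x, y) \<notin> X" using X by auto
  ultimately show "max (lis S) (Suc (lis {p \<in> S. fst p < x})) \<le> lis (insert (x, y) S)"
    using X lis_mono[OF fin'(1), of S] by auto
qed

lemma lis_insert_first:
  assumes fin: "finite (fst ` S)" and first: "\<And>p. p \<in> S \<Longrightarrow> y < snd p"
  shows "lis (insert (x, y) S) = max (lis S) (Suc (lis {p \<in> S. x < fst p}))"
proof (rule antisym)
  have fin': "finite (fst ` insert (x, y) S)" "finite (fst ` {p \<in> S. x < fst p})"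
    using fin by (auto intro: finite_subset[OF _ fin])
  obtain X where X: "X \<subseteq> insert (x, y) S" "increasing X" "finite X" "card X = lis (insert (x, y) S)"
    using lis_obtain[OF fin'(1)] .
  show "lis (insert (x, y) S) \<le> max (lis S) (Suc (lis {p \<in> S. x < fst p}))"
  proof (cases "(x, y) \<in> X")
    case False
    then have "X \<subseteq> S" using X by auto
    then show ?thesis using lis_ge[OF fin _ X(2)] X(4) by simp
  next
    case True
    have "X - {(x, y)} \<subseteq> {p \<in> S. x < fst p}"
    proof
      fix p assume p: "p \<in> X - {(x, y)}"
      then have "p \<in> S" using X by auto
      then have "y < snd p" by (rule first)
      then show "p \<in> {p \<in> S. x < fst p}"
        using X(2) True p \<open>p \<in> S\<close> unfolding increasing_def by force
    qed
    then have "card (X - {(x, y)}) \<le> lis {p \<in> S. x < fst p}"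
      using X(2) by (intro lis_ge fin') (auto intro: increasing_subset)
    then show ?thesis using True X by simp
  qed
next
  have fin': "finite (fst ` insert (x, y) S)" "finite (fst ` {p \<in> S. x < fst p})"
    using fin by (auto intro: finite_subset[OF _ fin])
  obtain X where X: "X \<subseteq> {p \<in> S. x < fst p}" "increasing X" "finite X"
    "card X = lis {p \<in> S. x < fst p}"
    using lis_obtain[OF fin'(2)] .
  have "increasing (insert (x, y) X)"
    using X first by (intro increasing_insert) auto
  then have "card (insert (x, y) X) \<le> lis (insert (x, y) S)"
    using X by (intro lis_ge fin') auto
  moreover have "(x, y) \<notin> X" using X by auto
  ultimately show "max (lis S) (Suc (lis {p \<in> S. x < fst p})) \<le> lis (insert (x, y) S)"
    using X lis_mono[OF fin'(1), of S] by auto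
qed

lemma lis_map:
  fixes \<phi> :: "'a::linorder \<Rightarrow> 'c::linorder" and \<psi> :: "'b::linorder \<Rightarrow> 'd::linorder"
  assumes "strict_mono \<phi>" "strict_mono \<psi>"
  shows "lis (map_prod \<phi> \<psi> ` S) = lis S"
proof -
  let ?m = "map_prod \<phi> \<psi>"
  have inj: "inj ?m" using assms by (intro prod.inj_map strict_mono_imp_inj_on)
  have inc: "increasing (?m ` X) \<longleftrightarrow> increasing X" for X
    unfolding increasing_def
    by (simp add: inj_eq[OF inj] strict_mono_less[OF assms(1)] strict_mono_less[OF assms(2)])
  have "card ` {Y. Y \<subseteq> ?m ` S \<and> increasing Y} = card ` (image ?m ` {X. X \<subseteq> S \<and> increasing X})"
  proof (rule arg_cong[of _ _ "image card"], intro subset_antisym subsetI)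
    fix Y assume "Y \<in> {Y. Y \<subseteq> ?m ` S \<and> increasing Y}"
    then show "Y \<in> image ?m ` {X. X \<subseteq> S \<and> increasing X}"
      using inc by (auto simp: subset_image_iff)
  qed (use inc in auto)
  also have "\<dots> = card ` {X. X \<subseteq> S \<and> increasing X}"
    unfolding image_image using inj by (simp add: card_image inj_on_subset)
  finally show ?thesis unfolding lis_def by simp
qed

section \<open>Growth squares of shapes\<close>

type_synonym cell = "int \<times> int"

text \<open>A cell is a pair of a row, counted downwards, and a column. Shapes are infinite down-sets of the
  plane: a straight shape is enlarged by all cells with a nonpositive coordinate. This makes the
  rotation by 180 degrees a symmetry and spares the boundary cases of slides.\<close>

definition down :: "cell set \<Rightarrow> bool" where
  "down S \<longleftrightarrow> (\<forall>r c. (r, c) \<in> S \<longrightarrow> (r - 1, c) \<in> S \<and> (r, c - 1) \<in> S)"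

definition rook :: "cell set \<Rightarrow> cell set \<Rightarrow> bool" where
  "rook n b \<longleftrightarrow> down n \<and> down b \<and> n \<subseteq> b \<and>
     (\<forall>r c. (r, c) \<in> b - n \<longrightarrow> (r + 1, c) \<notin> b \<and> (r, c + 1) \<notin> b)"

definition linked :: "cell set \<Rightarrow> cell \<Rightarrow> bool" where
  "linked D x \<longleftrightarrow> (case x of (r, c) \<Rightarrow>
     (r + 1, c) \<in> D \<or> (r - 1, c) \<in> D \<or> (r, c + 1) \<in> D \<or> (r, c - 1) \<in> D)"

text \<open>The local rule of the K-theoretic jeu de taquin: \<open>b - n\<close> are the holes and \<open>b' - b\<close> the cells of
  the next letter. Two cells of \<open>b' - n\<close> that touch are a hole and a letter, and they trade places;
  isolated cells stay as they are. In this form the rule is visibly symmetric in \<open>b\<close> and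
  \<open>switch n b b'\<close>.\<close>

definition switch :: "cell set \<Rightarrow> cell set \<Rightarrow> cell set \<Rightarrow> cell set" where
  "switch n b b' = n \<union> {x \<in> b' - n. x \<in> b \<longleftrightarrow> linked (b' - n) x}"

text \<open>One cell of a growth diagram. The path \<open>n\<close>, \<open>b\<close>,
  \<open>b'\<close> adds the holes and then a letter; the path \<open>n\<close>, \<open>n'\<close>,
  \<open>b'\<close> adds the letter after the slide and then the holes that it leaves.\<close>

definition square :: "cell set \<Rightarrow> cell set \<Rightarrow> cell set \<Rightarrow> cell set \<Rightarrow> bool" where
  "square n b n' b' \<longleftrightarrow> rook n b \<and> rook b b' \<and> n' = switch n b b'"

lemma down_le:
  assumes "down S" "(r, c) \<in> S" "r' \<le> r" "c' \<le> c"
  shows "(r', c') \<in> S"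
proof -
  have "(r - int i, c) \<in> S" for i
  proof (induction i)
    case (Suc i)
    then have "(r - int i - 1, c) \<in> S" using assms(1) unfolding down_def by blast
    then show ?case by (simp add: diff_diff_eq add.commute)
  qed (use assms in simp)
  from this[of "nat (r - r')"] have 1: "(r', c) \<in> S" using assms by simp
  have "(r', c - int i) \<in> S" for i
  proof (induction i)
    case (Suc i)
    then have "(r', c - int i - 1) \<in> S" using assms(1) unfolding down_def by blast
    then show ?case by (simp add: diff_diff_eq add.commute)
  qed (use 1 in simp)
  from this[of "nat (c - c')"] show ?thesis using assms by simp
qed

lemma rook_refl: "down n \<Longrightarrow> rook n n"
  by (simp add: rook_def)

lemma rook_down: "rook n b \<Longrightarrow> down n" "rook n b \<Longrightarrow> down b"
  by (simp_all add: rook_def)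

lemma rook_sub: "rook n b \<Longrightarrow> n \<subseteq> b"
  by (simp add: rook_def)

lemma rookD:
  assumes "rook n b" "(r, c) \<in> b" "(r, c) \<notin> n"
  shows "(r + 1, c) \<notin> b" "(r, c + 1) \<notin> b"
  using assms unfolding rook_def by blast+

lemma rookD':
  assumes "rook n b" "(r, c) \<in> b"
  shows "(r - 1, c) \<in> n" "(r, c - 1) \<in> n"
proof -
  have "(r - 1, c) \<in> b" "(r, c - 1) \<in> b" using assms unfolding rook_def down_def by blast+
  then show "(r - 1, c) \<in> n" "(r, c - 1) \<in> n"
    using rookD[OF assms(1), of "r - 1" c] rookD[OF assms(1), of r "c - 1"] assms(2) by auto
qed

lemma rook_not_linked:
  assumes "rook n b" "x \<in> b" "x \<notin> n"
  shows "\<not> linked (b - n) x"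
  using rookD[OF assms(1)] rookD'[OF assms(1)] assms(2,3) unfolding linked_def
  by (auto split: prod.splits)

lemma switch_iff:
  assumes "x \<in> b'" "x \<notin> n"
  shows "x \<in> switch n b b' \<longleftrightarrow> (x \<in> b \<longleftrightarrow> linked (b' - n) x)"
  using assms unfolding switch_def by auto

lemma switch_sub: "n \<subseteq> switch n b b'" "n \<subseteq> b' \<Longrightarrow> switch n b b' \<subseteq> b'"
  unfolding switch_def by auto

text \<open>The step \<open>pair\<close> is the reason: neither strip has touching cells, so of two
  touching cells of \<open>b' - n\<close> the upper or left one is a hole and the other a letter.
  After the exchange the letter comes first.\<close>

lemma switch_rook:
  assumes nb: "rook n b" and bb: "rook b b'"
  shows "rook n (switch n b b')" "rook (switch n b b') b'"
proof -
  let ?n' = "switch n b b'"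
  have sub: "n \<subseteq> ?n'" "?n' \<subseteq> b'"
    using rook_sub[OF nb] rook_sub[OF bb] by (auto intro!: switch_sub)
  have nd: "down n" "down b'" using rook_down nb bb by auto
  have pair: "(y \<in> b \<and> x \<notin> b) \<and> (y \<in> ?n' \<and> x \<notin> ?n')"
    if "y \<in> b'" "y \<notin> n" "x \<in> b'" "x \<notin> n"
      "x = (r + 1, c) \<or> x = (r, c + 1)" "y = (r, c)" for x y r c
  proof -
    have "y \<in> b"
      using that rookD[OF bb, of r c] by auto
    moreover have "x \<notin> b"
      using that rookD[OF nb, of r c] calculation by auto
    moreover have "linked (b' - n) x" "linked (b' - n) y"
      using that unfolding linked_def by auto
    ultimately show ?thesis using that by (simp add: switch_iff)
  qed
  have dn': "down ?n'"
    unfolding down_def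
  proof safe
    fix r c assume x: "(r, c) \<in> ?n'"
    then have b': "(r - 1, c) \<in> b'" "(r, c - 1) \<in> b'"
      using sub(2) nd(2) unfolding down_def by blast+
    show "(r - 1, c) \<in> ?n'"
    proof (cases "(r - 1, c) \<in> n \<or> (r, c) \<in> n")
      case True
      then show ?thesis using nd(1) sub(1) unfolding down_def by blast
    next
      case False
      then show ?thesis using pair[of "(r - 1, c)" "(r, c)" "r - 1" c] x sub b' by auto
    qed
    show "(r, c - 1) \<in> ?n'"
    proof (cases "(r, c - 1) \<in> n \<or> (r, c) \<in> n")
      case True
      then show ?thesis using nd(1) sub(1) unfolding down_def by blast
    next
      case False
      then show ?thesis using pair[of "(r, c - 1)" "(r, c)" r "c - 1"] x sub b' by auto
    qed
  qed
  have n_up: "(r + 1, c) \<notin> n" "(r, c + 1) \<notin> n" if "(r, c) \<notin> n" for r c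
    using that nd(1) unfolding down_def by (metis add_diff_cancel_right')+
  show "rook n ?n'"
    unfolding rook_def using nd dn' sub
  proof safe
    fix r c assume x: "(r, c) \<in> ?n'" "(r, c) \<notin> n"
    show False if "(r + 1, c) \<in> ?n'"
      using pair[of "(r, c)" "(r + 1, c)" r c] x sub n_up that by auto
    show False if "(r, c + 1) \<in> ?n'"
      using pair[of "(r, c)" "(r, c + 1)" r c] x sub n_up that by auto
  qed
  show "rook ?n' b'"
    unfolding rook_def using nd dn' sub
  proof safe
    fix r c assume x: "(r, c) \<in> b'" "(r, c) \<notin> ?n'"
    then have "(r, c) \<notin> n" using sub by auto
    then show False if "(r + 1, c) \<in> b'"
      using pair[of "(r, c)" "(r + 1, c)" r c] x sub n_up that by auto
    show False if "(r, c + 1) \<in> b'"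
      using pair[of "(r, c)" "(r, c + 1)" r c] x sub n_up that \<open>(r, c) \<notin> n\<close> by auto
  qed
qed

text \<open>On \<open>b' - n\<close>, membership in \<open>n'\<close> is the biconditional of
  membership in \<open>b\<close> with \<open>linked\<close>, and \<open>linked\<close> refers to the
  same set in both readings. Such a rule is an involution.\<close>

lemma square_sym: "square n b n' b' \<Longrightarrow> square n n' b b'"
proof -
  assume *: "square n b n' b'"
  then have "n \<subseteq> b" "b \<subseteq> b'" unfolding square_def rook_def by auto
  then have "b = switch n n' b'"
    using * unfolding square_def switch_def by auto
  moreover have "rook n n'" "rook n' b'"
    using * switch_rook[of n b b'] unfolding square_def by auto
  ultimately show ?thesis unfolding square_def by simp
qed

text \<open>Without holes every cell of the letter is isolated and stays. Together with
  \<open>square_sym\<close> this also covers a missing letter, and it lets tableaux and grids become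
  constant.\<close>

lemma square_diag: "rook b b' \<Longrightarrow> square b b b' b'"
  using rook_not_linked[of b b'] unfolding square_def switch_def
  by (auto intro: rook_refl rook_down dest: rook_sub)

text \<open>The half-turn alone makes an up-set of a down-set, so the complement is taken as well.
  Inclusions are thereby reversed, and the letters come in the opposite order.\<close>

definition rot :: "cell set \<Rightarrow> cell set" where
  "rot S = {(r, c). (- r, - c) \<notin> S}"

lemma down_rot: "down S \<Longrightarrow> down (rot S)"
  unfolding down_def rot_def
proof safe
  fix r c assume S: "\<forall>r c. (r, c) \<in> S \<longrightarrow> (r - 1, c) \<in> S \<and> (r, c - 1) \<in> S" and "(- r, - c) \<notin> S"
  then show "(- (r - 1), - c) \<in> S \<Longrightarrow> False" "(- r, - (c - 1)) \<in> S \<Longrightarrow> False"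
    using S[rule_format, of "- (r - 1)" "- c"] S[rule_format, of "- r" "- (c - 1)"] by auto
qed

lemma rook_rot:
  assumes "rook n b" shows "rook (rot b) (rot n)"
  unfolding rook_def
proof safe
  show "down (rot b)" "down (rot n)" using assms by (auto intro: down_rot rook_down)
  show "(r, c) \<in> rot n" if "(r, c) \<in> rot b" for r c
    using that rook_sub[OF assms] unfolding rot_def by auto
  fix r c assume "(r, c) \<in> rot n" "(r, c) \<notin> rot b"
  then have "(- r, - c) \<in> b" unfolding rot_def by auto
  from rookD'[OF assms this] show "(r + 1, c) \<in> rot n \<Longrightarrow> False" "(r, c + 1) \<in> rot n \<Longrightarrow> False"
    unfolding rot_def by auto
qed

text \<open>The biconditional in \<open>switch\<close> survives complementing both \<open>n'\<close>
  and \<open>b\<close>, and touching is invariant under the half-turn.\<close>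

lemma square_rot:
  assumes "square n b n' b'"
  shows "square (rot b') (rot b) (rot n') (rot n)"
proof -
  have sub: "n \<subseteq> b" "b \<subseteq> b'" "n \<subseteq> n'" "n' \<subseteq> b'"
    using assms square_sym[OF assms] unfolding square_def rook_def by auto
  have link: "linked (rot n - rot b') (r, c) \<longleftrightarrow> linked (b' - n) (- r, - c)" for r c
    unfolding linked_def rot_def by (auto simp: algebra_simps)
  have "x \<in> rot n' \<longleftrightarrow> x \<in> switch (rot b') (rot b) (rot n)" for x
  proof (cases x)
    case (Pair r c)
    have "(- r, - c) \<in> n' \<longleftrightarrow> (- r, - c) \<in> b \<longleftrightarrow> linked (b' - n) (- r, - c)"
      if "(- r, - c) \<in> b'" "(- r, - c) \<notin> n"
      using assms that unfolding square_def by (simp add: switch_iff)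
    then show ?thesis
      unfolding Pair switch_def using link[of r c] sub by (auto simp: rot_def)
  qed
  then show ?thesis using assms unfolding square_def by (auto intro: rook_rot)
qed

definition mirror :: "cell set \<Rightarrow> cell set" where
  "mirror S = {(r, c). (c, r) \<in> S}"

lemma mirror_mem [simp]: "(r, c) \<in> mirror S \<longleftrightarrow> (c, r) \<in> S"
  by (simp add: mirror_def)

lemma rook_mirror: "rook n b \<Longrightarrow> rook (mirror n) (mirror b)"
  unfolding rook_def down_def by auto

lemma square_mirror:
  assumes "square n b n' b'"
  shows "square (mirror n) (mirror b) (mirror n') (mirror b')"
proof -
  have "linked (mirror b' - mirror n) (r, c) \<longleftrightarrow> linked (b' - n) (c, r)" for r c
    unfolding linked_def by auto
  then have "mirror (switch n b b') = switch (mirror n) (mirror b) (mirror b')"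
    unfolding switch_def by (auto simp: mirror_def)
  then show ?thesis using assms unfolding square_def by (auto intro: rook_mirror)
qed

section \<open>Slides preserve the longest chains\<close>

text \<open>An increasing tableau is the sequence \<open>f\<close> of shapes of its letters up to \<open>t\<close>, so the letter \<open>t\<close>
  occupies the cells of \<open>f t - f (t - 1)\<close>.\<close>

definition pts :: "(cell \<Rightarrow> int) \<Rightarrow> (nat \<Rightarrow> cell set) \<Rightarrow> nat \<Rightarrow> nat \<Rightarrow> (nat \<times> int) set" where
  "pts \<pi> f a b = {(t, \<pi> x) |t x. a < t \<and> t \<le> b \<and> x \<in> f t - f (t - 1)}"

lemma ptsI:
  "x \<in> f t \<Longrightarrow> x \<notin> f (t - 1) \<Longrightarrow> a < t \<Longrightarrow> t \<le> b \<Longrightarrow> y = \<pi> x \<Longrightarrow> (t, y) \<in> pts \<pi> f a b"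
  unfolding pts_def by blast

lemma ptsE:
  assumes "p \<in> pts \<pi> f a b"
  obtains t x where "p = (t, \<pi> x)" "a < t" "t \<le> b" "x \<in> f t" "x \<notin> f (t - 1)"
  using assms unfolding pts_def by blast

lemma pts_cong:
  assumes "\<And>t. a \<le> t \<Longrightarrow> t \<le> b \<Longrightarrow> f t = g t"
  shows "pts \<pi> f a b = pts \<pi> g a b"
proof -
  have "f t = g t" "f (t - 1) = g (t - 1)" if "a < t" "t \<le> b" for t
    using assms[of t] assms[of "t - 1"] that by auto
  then show ?thesis unfolding pts_def by blast
qed

lemma pts_mono: "b \<le> b' \<Longrightarrow> pts \<pi> f a b \<subseteq> pts \<pi> f a b'"
  unfolding pts_def by (intro Collect_mono) (blast intro: order_trans)

lemma finite_fst_pts: "finite (fst ` pts \<pi> f a b)"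
  by (rule finite_subset[of _ "{a..b}"]) (auto simp: pts_def)

text \<open>The bound on the columns makes an induction over the letters possible: a new letter in
  column \<open>c0\<close> extends exactly the chains that stay in the columns before
  \<open>c0\<close>.\<close>

definition best :: "(nat \<Rightarrow> cell set) \<Rightarrow> nat \<Rightarrow> nat \<Rightarrow> int \<Rightarrow> nat" where
  "best f a t c = lis {p \<in> pts snd f a t. snd p \<le> c}"

lemma finite_best: "finite (fst ` {p \<in> pts snd f a t. snd p \<le> c})"
  by (rule finite_subset[OF _ finite_fst_pts[of snd f a t]]) auto

lemma best_obtain:
  obtains X where "X \<subseteq> pts snd f a t" "\<forall>p\<in>X. snd p \<le> c" "increasing X" "finite X"
    "card X = best f a t c"
proof (rule lis_obtain[OF finite_best[of f a t c]])
  fix X assume "X \<subseteq> {p \<in> pts snd f a t. snd p \<le> c}" "increasing X" "finite X"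
    "card X = lis {p \<in> pts snd f a t. snd p \<le> c}"
  then show thesis by (intro that) (auto simp: best_def)
qed

lemma best_ge:
  assumes "X \<subseteq> pts snd f a t" "\<forall>p\<in>X. snd p \<le> c" "increasing X"
  shows "card X \<le> best f a t c"
  unfolding best_def using assms by (intro lis_ge finite_best) auto

lemma best_start: "best f a a c = 0"
proof -
  have "pts snd f a a = {}" unfolding pts_def by auto
  then show ?thesis unfolding best_def by simp
qed

lemma best_mono: "c \<le> c' \<Longrightarrow> best f a t c \<le> best f a t c'"
  unfolding best_def using finite_best by (intro lis_mono) auto

lemma best_mono_time: "best f a t c \<le> best f a (Suc t) c"
  unfolding best_def using finite_best by (intro lis_mono) (auto simp: pts_def)

text \<open>An increasing set has at most one point in column \<open>c\<close>.\<close>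

lemma best_step_column: "best f a t c \<le> Suc (best f a t (c - 1))"
proof -
  obtain X where X: "X \<subseteq> pts snd f a t" "\<forall>p\<in>X. snd p \<le> c" "increasing X" "finite X"
    "card X = best f a t c" using best_obtain[of f a t c] .
  let ?Y = "{p \<in> X. snd p \<noteq> c}"
  have "card ?Y \<le> best f a t (c - 1)"
    using X by (intro best_ge) (force intro: increasing_subset)+
  moreover have "card {p \<in> X. snd p = c} \<le> 1"
  proof -
    have "{p \<in> X. snd p = c} \<subseteq> {q}" if "q \<in> X" "snd q = c" for q
      using increasing_inj_snd[OF X(3)] that unfolding inj_on_def by auto
    then show ?thesis
      by (metis (mono_tags, lifting) card.empty card_mono empty_Collect_eq finite.emptyI
          finite.insertI is_singletonI is_singleton_altdef le_numeral_extra(4) zero_le_one)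
  qed
  moreover have "card X = card ?Y + card {p \<in> X. snd p = c}"
    using X(4) by (subst card_Un_disjoint[symmetric]) (auto intro: arg_cong[of _ _ card])
  ultimately show ?thesis using X by simp
qed

lemma best_extend:
  assumes "a \<le> t" "(r, c0) \<in> f (Suc t)" "(r, c0) \<notin> f t" "c0 \<le> c"
  shows "Suc (best f a t (c0 - 1)) \<le> best f a (Suc t) c"
proof -
  obtain X where X: "X \<subseteq> pts snd f a t" "\<forall>p\<in>X. snd p \<le> c0 - 1" "increasing X" "finite X"
    "card X = best f a t (c0 - 1)" using best_obtain[of f a t "c0 - 1"] .
  have lt: "fst p < Suc t" if "p \<in> X" for p
    using that X(1) by (auto simp: pts_def)
  have "(Suc t, c0) \<in> pts snd f a (Suc t)"
    using assms by (force simp: pts_def)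
  moreover have "X \<subseteq> pts snd f a (Suc t)"
    using X(1) pts_mono[of t "Suc t" snd f a] by auto
  ultimately have "card (insert (Suc t, c0) X) \<le> best f a (Suc t) c"
    using X(2,3) lt assms(4) by (intro best_ge increasing_insert) force+
  moreover have "(Suc t, c0) \<notin> X" using lt by force
  ultimately show ?thesis using X by simp
qed

text \<open>The converse of \<open>best_extend\<close>: an optimal chain avoids the letter
  \<open>Suc t\<close> or ends with it.\<close>

lemma best_cases:
  assumes "a \<le> t"
  obtains "best f a (Suc t) c \<le> best f a t c"
  | r c0 where "(r, c0) \<in> f (Suc t)" "(r, c0) \<notin> f t" "c0 \<le> c"
    "best f a (Suc t) c \<le> Suc (best f a t (c0 - 1))"
proof -
  obtain X where X: "X \<subseteq> pts snd f a (Suc t)" "\<forall>p\<in>X. snd p \<le> c" "increasing X" "finite X"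
    "card X = best f a (Suc t) c" using best_obtain[of f a "Suc t" c] .
  show thesis
  proof (cases "\<exists>c0. (Suc t, c0) \<in> X")
    case False
    have "X \<subseteq> pts snd f a t"
    proof
      fix p assume "p \<in> X"
      then have "p \<in> pts snd f a (Suc t)" "fst p \<noteq> Suc t" using X False by (auto, metis prod.collapse)
      then show "p \<in> pts snd f a t" by (auto simp: pts_def le_Suc_eq)
    qed
    then have "card X \<le> best f a t c" using X by (intro best_ge)
    then show thesis using X that(1) by simp
  next
    case True
    then obtain c0 where c0: "(Suc t, c0) \<in> X" by blast
    then obtain r where r: "(r, c0) \<in> f (Suc t)" "(r, c0) \<notin> f t"
      using X(1) by (force simp: pts_def)
    have "p \<in> pts snd f a t \<and> snd p \<le> c0 - 1" if "p \<in> X - {(Suc t, c0)}" for p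
    proof -
      have "p \<in> pts snd f a (Suc t)" "p \<noteq> (Suc t, c0)" "p \<in> X" using that X by auto
      moreover then have "fst p \<le> Suc t" by (auto simp: pts_def)
      ultimately have "fst p < Suc t \<and> snd p < c0"
        using X(3) c0 unfolding increasing_def by fastforce
      then show ?thesis using \<open>p \<in> pts snd f a (Suc t)\<close> by (auto simp: pts_def)
    qed
    then have "card (X - {(Suc t, c0)}) \<le> best f a t (c0 - 1)"
      using X(3) by (intro best_ge) (auto intro: increasing_subset)
    then have "best f a (Suc t) c \<le> Suc (best f a t (c0 - 1))"
      using X c0 by simp
    then show thesis using that(2)[OF r] X(2) c0 by force
  qed
qed

text \<open>The second conjunct is what makes the first one inductive. When a hole at \<open>(r, c)\<close> lets the next
  letter move left into column \<open>c\<close>, the new chain may lose a column; this is harmless if the slid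
  tableau already has an equally long chain strictly to the left of the hole, or a chain that is
  longer by one for each further column of the row above.\<close>

lemma slide_invariant:
  fixes nu la :: "nat \<Rightarrow> cell set"
  assumes sq: "\<And>t. a \<le> t \<Longrightarrow> t < T \<Longrightarrow> square (nu t) (la t) (nu (Suc t)) (la (Suc t))"
    and "a \<le> t" "t \<le> T"
  shows "(\<forall>c. best la a t c \<le> best nu a t c) \<and>
    (\<forall>r c. (r, c) \<in> la t - nu t \<longrightarrow> (r - 1, c + 1) \<in> nu t \<longrightarrow>
       best la a t c \<le> best nu a t (c - 1) \<or>
       (\<forall>i::nat. 0 < i \<longrightarrow> (r - 1, c + int i) \<in> nu t \<longrightarrow> best la a t c + i \<le> best nu a t (c + int i)))"
  using \<open>a \<le> t\<close> \<open>t \<le> T\<close>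
proof (induction t rule: dec_induct)
  case base
  then show ?case by (simp add: best_start)
next
  case (step t)
  let ?n = "nu t" and ?b = "la t" and ?n' = "nu (Suc t)" and ?b' = "la (Suc t)"
  let ?D = "?b' - ?n"
  let ?F = "best la a t" and ?G = "best nu a t"
  let ?F' = "best la a (Suc t)" and ?G' = "best nu a (Suc t)"
  have at: "a \<le> t" using step by simp
  from sq[OF at] step have s: "square ?n ?b ?n' ?b'" by simp
  from this square_sym[OF this] have rk: "rook ?n ?b" "rook ?b ?b'" "rook ?n ?n'" "rook ?n' ?b'"
    unfolding square_def by auto
  have sub: "?n \<subseteq> ?b" "?b \<subseteq> ?b'" "?n \<subseteq> ?n'" "?n' \<subseteq> ?b'"
    using rk by (auto dest: rook_sub)
  have dn: "down ?n" "down ?b" "down ?n'" "down ?b'" using rk by (auto dest: rook_down)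
  have n'_iff: "x \<in> ?n' \<longleftrightarrow> (x \<in> ?b \<longleftrightarrow> linked ?D x)" if "x \<in> ?b'" "x \<notin> ?n" for x
    using s that unfolding square_def by (simp add: switch_iff)
  have I1: "?F c \<le> ?G c" for c using step by simp
  have I3: "?F c \<le> ?G (c - 1) \<or>
       (\<forall>i::nat. 0 < i \<longrightarrow> (r - 1, c + int i) \<in> ?n \<longrightarrow> ?F c + i \<le> ?G (c + int i))"
    if "(r, c) \<in> ?b" "(r, c) \<notin> ?n" "(r - 1, c + 1) \<in> ?n" for r c
    using step that by simp
  \<comment> \<open>Where a letter that touches a hole goes: up, which keeps its column, or, if no
    hole lies above it, to the left. Only the second move can shorten a chain.\<close>
  have new: "(r - 1, c) \<in> ?b \<and> (r - 1, c) \<notin> ?n \<and> (r - 1, c) \<in> ?n' \<or>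
      (r - 1, c) \<in> ?n \<and> (r, c - 1) \<in> ?b \<and> (r, c - 1) \<notin> ?n \<and> (r, c - 1) \<in> ?n'"
    if "(r, c) \<in> ?b'" "(r, c) \<notin> ?b" "linked ?D (r, c)" for r c
  proof -
    have up: "(r - 1, c) \<in> ?b" "(r, c - 1) \<in> ?b" using rookD'[OF rk(2) that(1)] .
    have "(r + 1, c) \<notin> ?b'" "(r, c + 1) \<notin> ?b'" using rookD[OF rk(2) that(1,2)] .
    then have or: "(r - 1, c) \<notin> ?n \<or> (r, c - 1) \<notin> ?n"
      using that(3) unfolding linked_def by auto
    have "(r, c) \<in> ?D" using that sub by auto
    then have "linked ?D (r - 1, c)" "linked ?D (r, c - 1)" unfolding linked_def by auto
    then show ?thesis using or up n'_iff[of "(r - 1, c)"] n'_iff[of "(r, c - 1)"] sub by auto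
  qed
  have I1': "?F' c \<le> ?G' c" for c
  proof (rule best_cases[OF at, of la c])
    assume "?F' c \<le> ?F c"
    then show ?thesis using I1[of c] best_mono_time[of nu a t c] by linarith
  next
    fix r c0 assume x: "(r, c0) \<in> ?b'" "(r, c0) \<notin> ?b" "c0 \<le> c" "?F' c \<le> Suc (?F (c0 - 1))"
    have *: ?thesis if "(r', c0) \<in> ?n'" "(r', c0) \<notin> ?n" for r'
      using best_extend[where f = nu, OF at that x(3)] I1[of "c0 - 1"] x(4) by linarith
    show ?thesis
    proof (cases "linked ?D (r, c0)")
      case False
      then show ?thesis using * n'_iff[of "(r, c0)"] x sub by auto
    next
      case True
      from new[OF x(1,2) True] show ?thesis
      proof
        assume "(r - 1, c0) \<in> ?b \<and> (r - 1, c0) \<notin> ?n \<and> (r - 1, c0) \<in> ?n'"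
        then show ?thesis using * by blast
      next
        assume y: "(r - 1, c0) \<in> ?n \<and> (r, c0 - 1) \<in> ?b \<and> (r, c0 - 1) \<notin> ?n \<and> (r, c0 - 1) \<in> ?n'"
        \<comment> \<open>The letter moved from column \<open>c0\<close> to \<open>c0 - 1\<close>.
          Either the chain before it can be found in the columns up to \<open>c0 - 2\<close> and the
          moved letter still extends it, or the case \<open>i = 1\<close> of the invariant makes up
          for the lost step.\<close>
        then have "?F (c0 - 1) \<le> ?G (c0 - 1 - 1) \<or> Suc (?F (c0 - 1)) \<le> ?G c0"
          using I3[of r "c0 - 1"] by (auto dest: spec[of _ 1])
        moreover have "Suc (?G (c0 - 1 - 1)) \<le> ?G' c"
          using best_extend[where f = nu and r = r and ?c0.0 = "c0 - 1" and c = c, OF at] y x(3) by simp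
        moreover have "?G c0 \<le> ?G' c"
          using best_mono[OF x(3), of nu a t] best_mono_time[of nu a t c] by linarith
        ultimately show ?thesis using x(4) by linarith
      qed
    qed
  qed
  have I3': "?F' c \<le> ?G' (c - 1) \<or>
       (\<forall>i::nat. 0 < i \<longrightarrow> (r - 1, c + int i) \<in> ?n' \<longrightarrow> ?F' c + i \<le> ?G' (c + int i))"
    if h: "(r, c) \<in> ?b'" "(r, c) \<notin> ?n'" "(r - 1, c + 1) \<in> ?n'" for r c
  proof (cases "(r, c) \<in> ?b")
    case True
    have hn: "(r, c) \<notin> ?n" using h sub by auto
    then have iso: "\<not> linked ?D (r, c)" using n'_iff[OF h(1)] h(2) True by auto
    \<comment> \<open>The old hole remains because it is isolated, so no cell of the new letter lies
      in column \<open>c\<close>.\<close>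
    have free: "(r2, c) \<in> ?b" if "(r2, c) \<in> ?b'" for r2
    proof (cases "r2 \<le> r")
      case True
      then show ?thesis using down_le[OF dn(2) \<open>(r, c) \<in> ?b\<close>] by simp
    next
      case False
      then have "(r + 1, c) \<in> ?b'" using down_le[OF dn(4) that, of "r + 1" c] by simp
      moreover have "(r + 1, c) \<notin> ?n" using rookD(1)[OF rk(1) True hn] sub by auto
      ultimately show ?thesis using iso unfolding linked_def by auto
    qed
    have "?F' c \<le> ?F c \<or> ?F' c \<le> ?G' (c - 1)"
    proof (rule best_cases[OF at, of la c])
      fix r2 c0 assume x: "(r2, c0) \<in> ?b'" "(r2, c0) \<notin> ?b" "c0 \<le> c" "?F' c \<le> Suc (?F (c0 - 1))"
      then have "c0 \<le> c - 1" using free[of r2] by (cases "c0 = c") auto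
      then have "Suc (?F (c0 - 1)) \<le> ?F' (c - 1)" using best_extend[where f = la, OF at x(1,2)] by simp
      then show ?thesis using I1'[of "c - 1"] x(4) by linarith
    qed simp
    moreover have "?F c \<le> ?G (c - 1) \<or>
       (\<forall>i::nat. 0 < i \<longrightarrow> (r - 1, c + int i) \<in> ?n' \<longrightarrow> ?F c + i \<le> ?G' (c + int i))"
    proof (rule disjCI)
      assume neg: "\<not> (\<forall>i::nat. 0 < i \<longrightarrow> (r - 1, c + int i) \<in> ?n' \<longrightarrow> ?F c + i \<le> ?G' (c + int i))"
      show "?F c \<le> ?G (c - 1)"
      proof (rule ccontr)
        assume ng: "\<not> ?F c \<le> ?G (c - 1)"
        have all: "?F c + j \<le> ?G (c + int j)" if "(r - 1, c + int j) \<in> ?n" for j :: nat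
        proof (cases "j = 0")
          case True then show ?thesis using I1[of c] by simp
        next
          case False
          then have "(r - 1, c + 1) \<in> ?n" using down_le[OF dn(1) that, of "r - 1" "c + 1"] by simp
          then show ?thesis using I3[OF True hn] ng that False by auto
        qed
        have "?F c + j \<le> ?G' (c + int j)" if j: "0 < j" "(r - 1, c + int j) \<in> ?n'" for j :: nat
        proof (cases "(r - 1, c + int j) \<in> ?n")
          case True
          then show ?thesis using all[OF True] best_mono_time[of nu a t "c + int j"] by linarith
        next
          case False
          obtain k where k: "j = Suc k" using j(1) by (cases j) auto
          \<comment> \<open>A cell gained by row \<open>r - 1\<close> holds the letter
            \<open>Suc t\<close>, which extends the chain found one column further to the
            left.\<close>
          have "(r - 1, c + int k) \<in> ?n" using rookD'(2)[OF rk(3) j(2)] k by simp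
          then have "?F c + k \<le> ?G (c + int k)" by (rule all)
          moreover have "Suc (?G (c + int j - 1)) \<le> ?G' (c + int j)"
            using best_extend[where f = nu, OF at j(2) False] by simp
          ultimately show ?thesis using k by simp
        qed
        then show False using neg by blast
      qed
    qed
    ultimately show ?thesis
      using best_mono_time[of nu a t "c - 1"] by (meson add_le_mono1 le_trans)
  next
    case False
    then have lk: "linked ?D (r, c)" using n'_iff[OF h(1)] h(2) sub by auto
    from new[OF h(1) False lk] show ?thesis
    proof
      \<comment> \<open>Excluded: the cells of the moved letter form a rook strip, so if
        \<open>(r - 1, c)\<close> is one of them, then \<open>(r - 1, c + 1)\<close> is not in
        \<open>nu (Suc t)\<close>.\<close>
      assume y: "(r - 1, c) \<in> ?b \<and> (r - 1, c) \<notin> ?n \<and> (r - 1, c) \<in> ?n'"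
      then have "(r - 1, c + 1) \<notin> ?n"
        using rookD(2)[OF rk(1), of "r - 1" c] sub by auto
      then have "(r - 1, c) \<in> ?n" using rookD'(2)[OF rk(3) h(3)] by simp
      then show ?thesis using y by simp
    next
      assume y: "(r - 1, c) \<in> ?n \<and> (r, c - 1) \<in> ?b \<and> (r, c - 1) \<notin> ?n \<and> (r, c - 1) \<in> ?n'"
      have F': "?F' c \<le> Suc (?F (c - 1))"
      proof (rule best_cases[OF at, of la c])
        fix r2 c0 assume x: "c0 \<le> c" "?F' c \<le> Suc (?F (c0 - 1))"
        then show ?thesis using best_mono[of "c0 - 1" "c - 1" la a t] by simp
      qed (use best_step_column[of la a t c] in simp)
      have "?F (c - 1) \<le> ?G (c - 1 - 1) \<or>
       (\<forall>i::nat. 0 < i \<longrightarrow> (r - 1, c - 1 + int i) \<in> ?n \<longrightarrow> ?F (c - 1) + i \<le> ?G (c - 1 + int i))"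
        using I3[of r "c - 1"] y by simp
      then show ?thesis
      proof
        assume "?F (c - 1) \<le> ?G (c - 1 - 1)"
        moreover have "Suc (?G (c - 1 - 1)) \<le> ?G' (c - 1)"
          using best_extend[where f = nu and r = r and ?c0.0 = "c - 1" and c = "c - 1", OF at] y by simp
        ultimately show ?thesis using F' by simp
      next
        assume all: "\<forall>i::nat. 0 < i \<longrightarrow> (r - 1, c - 1 + int i) \<in> ?n \<longrightarrow> ?F (c - 1) + i \<le> ?G (c - 1 + int i)"
        have "?F' c + i \<le> ?G' (c + int i)" if i: "0 < i" "(r - 1, c + int i) \<in> ?n'" for i :: nat
        proof (cases "(r - 1, c + int i) \<in> ?n")
          case True
          \<comment> \<open>The old hole was one column further to the left. The index
            \<open>Suc i\<close> that this yields pays for the new letter counted in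
            \<open>F'\<close>.\<close>
          then have "?F (c - 1) + Suc i \<le> ?G (c + int i)"
            using all[rule_format, of "Suc i"] by simp
          then show ?thesis using F' best_mono_time[of nu a t "c + int i"] by linarith
        next
          case False
          have "(r - 1, c - 1 + int i) \<in> ?n" using rookD'(2)[OF rk(3) i(2)] by (simp add: algebra_simps)
          then have "?F (c - 1) + i \<le> ?G (c - 1 + int i)" using all i by blast
          moreover have "Suc (?G (c + int i - 1)) \<le> ?G' (c + int i)"
            using best_extend[where f = nu, OF at i(2) False] by simp
          moreover have "c + int i - 1 = c - 1 + int i" by simp
          ultimately show ?thesis using F' by simp
        qed
        then show ?thesis by blast
      qed
    qed
  qed
  show ?case using I1' I3' by blast
qed

lemma slide_lis_le:
  assumes "\<And>t. a \<le> t \<Longrightarrow> t < b \<Longrightarrow> square (nu t) (la t) (nu (Suc t)) (la (Suc t))" and "a \<le> b"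
  shows "lis (pts snd la a b) \<le> lis (pts snd nu a b)"
proof -
  obtain X where X: "X \<subseteq> pts snd la a b" "increasing X" "finite X" "card X = lis (pts snd la a b)"
    using lis_obtain[OF finite_fst_pts] .
  obtain c where c: "\<forall>p\<in>X. snd p \<le> c"
    using bdd_above_finite[of "snd ` X"] X(3) unfolding bdd_above_def by auto
  have "card X \<le> best la a b c" using X c by (intro best_ge)
  also have "\<dots> \<le> best nu a b c" 
    using slide_invariant[of a b nu la b] assms by simp
  also have "\<dots> \<le> lis (pts snd nu a b)"
    unfolding best_def by (intro lis_mono finite_fst_pts) auto
  finally show ?thesis using X by simp
qed

text \<open>The rotation by 180 degrees turns a slide into a reverse slide and so supplies the converse of the
  preceding inequality.\<close>

lemma lis_pts_rot:
  assumes "a \<le> b"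
  shows "lis (pts snd f a b) \<le> lis (pts snd (\<lambda>t. rot (f (a + b - t))) a b)"
proof (rule lis_image_le[where \<phi> = "\<lambda>(t, c). (a + b + 1 - t, - c)"])
  show "(\<lambda>(t, c). (a + b + 1 - t, - c)) ` pts snd f a b \<subseteq> pts snd (\<lambda>t. rot (f (a + b - t))) a b"
  proof
    fix p assume "p \<in> (\<lambda>(t, c). (a + b + 1 - t, - c)) ` pts snd f a b"
    then obtain t r c where t: "p = (a + b + 1 - t, - c)" "a < t" "t \<le> b" "(r, c) \<in> f t" "(r, c) \<notin> f (t - 1)"
      unfolding pts_def by auto
    \<comment> \<open>A letter is a step between two shapes. Reversing the shapes by
      \<open>a + b - t\<close> therefore reverses the letters by
      \<open>a + b + 1 - t\<close>.\<close>
    have "a + b - (a + b + 1 - t) = t - 1" "a + b - (a + b + 1 - t - 1) = t" using t by auto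
    then have "(- r, - c) \<in> rot (f (a + b - (a + b + 1 - t))) - rot (f (a + b - (a + b + 1 - t - 1)))"
      using t by (simp add: rot_def)
    moreover have "a < a + b + 1 - t" "a + b + 1 - t \<le> b" using t by auto
    ultimately show "p \<in> pts snd (\<lambda>t. rot (f (a + b - t))) a b"
      unfolding pts_def t(1) by force
  qed
  show "inj_on (\<lambda>(t, c). (a + b + 1 - t, - c)) (pts snd f a b)"
    unfolding inj_on_def pts_def by auto
  fix X assume X: "X \<subseteq> pts snd f a b" "increasing X"
  show "increasing ((\<lambda>(t, c). (a + b + 1 - t, - c)) ` X)"
    unfolding increasing_def
  proof (intro ballI impI)
    fix p q assume pq: "p \<in> (\<lambda>(t, c). (a + b + 1 - t, - c)) ` X" "q \<in> (\<lambda>(t, c). (a + b + 1 - t, - c)) ` X" "p \<noteq> q"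
    then obtain t c t' c' where *: "(t, c) \<in> X" "(t', c') \<in> X" "p = (a + b + 1 - t, - c)"
      "q = (a + b + 1 - t', - c')" by auto
    then have "t \<le> b" "t' \<le> b" using X(1) by (auto simp: pts_def)
    moreover have "t < t' \<and> c < c' \<or> t' < t \<and> c' < c"
      using pq(3) unfolding *(3,4) by (intro increasingD[OF X(2) *(1,2)]) auto
    ultimately show "fst p < fst q \<and> snd p < snd q \<or> fst q < fst p \<and> snd q < snd p"
      unfolding * by auto
  qed
qed (rule finite_fst_pts)+

lemma slide_lis:
  assumes sq: "\<And>t. a \<le> t \<Longrightarrow> t < b \<Longrightarrow> square (nu t) (la t) (nu (Suc t)) (la (Suc t))" and ab: "a \<le> b"
  shows "lis (pts snd la a b) = lis (pts snd nu a b)"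
proof (rule antisym)
  show "lis (pts snd la a b) \<le> lis (pts snd nu a b)" using assms by (rule slide_lis_le)
  let ?r = "\<lambda>f t. rot (f (a + b - t)) :: cell set"
  \<comment> \<open>After the half-turn \<open>nu\<close> is the tableau before the slide and
    \<open>la\<close> the one after it.\<close>
  have *: "square (?r la t) (?r nu t) (?r la (Suc t)) (?r nu (Suc t))" if "a \<le> t" "t < b" for t
  proof -
    have "a + b - t = Suc (a + b - Suc t)" using that by simp
    then show ?thesis
      using square_sym[OF square_rot[OF sq[of "a + b - Suc t"]]] that by simp
  qed
  have rot2: "pts snd (?r (?r la)) a b = pts snd la a b"
  proof -
    have "rot (rot S) = S" for S unfolding rot_def by auto
    then show ?thesis by (intro pts_cong) simp
  qed
  have "lis (pts snd nu a b) \<le> lis (pts snd (?r nu) a b)" by (rule lis_pts_rot[OF ab])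
  also have "\<dots> \<le> lis (pts snd (?r la) a b)" using * ab by (rule slide_lis_le)
  also have "\<dots> \<le> lis (pts snd (?r (?r la)) a b)" by (rule lis_pts_rot[OF ab])
  also have "\<dots> = lis (pts snd la a b)"
    by (simp only: rot2)
  finally show "lis (pts snd nu a b) \<le> lis (pts snd la a b)" .
qed

section \<open>Infusion\<close>

type_synonym profile = "nat \<Rightarrow> nat \<Rightarrow> nat \<times> nat"

text \<open>The first component measures the increasing subsequences of the word read by columns
  from the left, each column upwards; the second measures the decreasing subsequences of the word
  read by rows from the bottom, each row to the right.\<close>

definition prof :: "(nat \<Rightarrow> cell set) \<Rightarrow> profile" where
  "prof f a b = (lis (pts snd f a b), lis (pts fst f a b))"

lemma pts_fst_mirror: "pts fst f a b = pts snd (\<lambda>t. mirror (f t)) a b"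
proof -
  have "(\<exists>x. p = (t, fst x) \<and> x \<in> f t - f (t - 1)) \<longleftrightarrow>
      (\<exists>x. p = (t, snd x) \<and> x \<in> mirror (f t) - mirror (f (t - 1)))" for p t
  proof
    assume "\<exists>x. p = (t, fst x) \<and> x \<in> f t - f (t - 1)"
    then obtain r c where "p = (t, r)" "(r, c) \<in> f t - f (t - 1)" by auto
    then show "\<exists>x. p = (t, snd x) \<and> x \<in> mirror (f t) - mirror (f (t - 1))"
      by (intro exI[of _ "(c, r)"]) simp
  next
    assume "\<exists>x. p = (t, snd x) \<and> x \<in> mirror (f t) - mirror (f (t - 1))"
    then obtain r c where "p = (t, r)" "(c, r) \<in> mirror (f t) - mirror (f (t - 1))" by auto
    then show "\<exists>x. p = (t, fst x) \<and> x \<in> f t - f (t - 1)"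
      by (intro exI[of _ "(r, c)"]) simp
  qed
  then show ?thesis unfolding pts_def by blast
qed

lemma pts_empty: "b \<le> a \<Longrightarrow> pts \<pi> f a b = {}"
  unfolding pts_def by auto

lemma prof_slide:
  assumes sq: "\<And>t. square (nu t) (la t) (nu (Suc t)) (la (Suc t))"
  shows "prof la = prof nu"
proof (intro ext)
  fix a b
  show "prof la a b = prof nu a b"
  proof (cases "a \<le> b")
    case True
    have "lis (pts snd la a b) = lis (pts snd nu a b)"
      using sq True by (intro slide_lis) auto
    moreover have "lis (pts fst la a b) = lis (pts fst nu a b)"
      unfolding pts_fst_mirror using sq True by (intro slide_lis square_mirror) auto
    ultimately show ?thesis unfolding prof_def by simp
  qed (simp add: prof_def pts_empty)
qed

text \<open>The inner shape \<open>f 0\<close> is arbitrary, which allows skew tableaux. Being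
  constant from \<open>m\<close> on makes equality of tableaux equality of functions and keeps
  larger letters out of all profiles.\<close>

definition tab :: "nat \<Rightarrow> (nat \<Rightarrow> cell set) \<Rightarrow> bool" where
  "tab m f \<longleftrightarrow> (\<forall>t. rook (f t) (f (Suc t))) \<and> (\<forall>t\<ge>m. f t = f m)"

lemma tab_rook: "tab m f \<Longrightarrow> rook (f t) (f (Suc t))"
  unfolding tab_def by blast

lemma tab_stable: "tab m f \<Longrightarrow> m \<le> t \<Longrightarrow> f t = f m"
  unfolding tab_def by blast

lemma tab_mono: "tab m f \<Longrightarrow> s \<le> t \<Longrightarrow> f s \<subseteq> f t"
  by (rule lift_Suc_mono_le[of f]) (auto dest: tab_rook rook_sub)

lemma tab_le: "tab m f \<Longrightarrow> f t \<subseteq> f m"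
  using tab_mono[of m f t m] tab_stable[of m f t] by (cases "t \<le> m") auto

lemma tab_min: "tab m f \<Longrightarrow> f (min t m) = f t"
  using tab_stable[of m f t] by (auto simp: min_def)

lemma finite_tabs:
  assumes "finite (la - al)"
  shows "finite {f. tab m f \<and> al \<subseteq> f 0 \<and> f m = la}"
proof (rule inj_on_finite)
  let ?\<phi> = "\<lambda>f. restrict (\<lambda>t. f t - al) {..m}"
  show "finite ({..m} \<rightarrow>\<^sub>E Pow (la - al))" using assms by (intro finite_PiE) auto
  show "?\<phi> ` {f. tab m f \<and> al \<subseteq> f 0 \<and> f m = la} \<subseteq> {..m} \<rightarrow>\<^sub>E Pow (la - al)"
    using tab_le by fastforce
  show "inj_on ?\<phi> {f. tab m f \<and> al \<subseteq> f 0 \<and> f m = la}"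
  proof (rule inj_onI, rule ext)
    fix f g t
    assume f: "f \<in> {f. tab m f \<and> al \<subseteq> f 0 \<and> f m = la}" and g: "g \<in> {f. tab m f \<and> al \<subseteq> f 0 \<and> f m = la}"
      and eq: "?\<phi> f = ?\<phi> g"
    have sub: "al \<subseteq> f t" "al \<subseteq> g t" using f g tab_mono[of m _ 0 t] by blast+
    show "f t = g t"
    proof (cases "t \<le> m")
      case True
      then have "f t - al = g t - al" using fun_cong[OF eq, of t] by simp
      then show ?thesis using sub by blast
    next
      case False
      then have "f t = f m" "g t = g m" using f g tab_stable[of m f t] tab_stable[of m g t] by auto
      then show ?thesis using f g by auto
    qed
  qed
qed

text \<open>A growth diagram: row \<open>Suc s\<close> slides into the holes between
  \<open>h s 0\<close> and \<open>h (Suc s) 0\<close> and becomes row \<open>s\<close>. Exchanging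
  \<open>s\<close> and \<open>t\<close> gives a growth diagram again by
  \<open>square_sym\<close>.\<close>

definition grid :: "nat \<Rightarrow> nat \<Rightarrow> (nat \<Rightarrow> nat \<Rightarrow> cell set) \<Rightarrow> bool" where
  "grid k m h \<longleftrightarrow>
     (\<forall>s t. square (h s t) (h (Suc s) t) (h s (Suc t)) (h (Suc s) (Suc t))) \<and>
     (\<forall>s\<ge>k. h s = h k) \<and> (\<forall>s. \<forall>t\<ge>m. h s t = h s m)"

lemma grid_square: "grid k m h \<Longrightarrow> square (h s t) (h (Suc s) t) (h s (Suc t)) (h (Suc s) (Suc t))"
  unfolding grid_def by blast

lemma grid_stable:
  "grid k m h \<Longrightarrow> k \<le> s \<Longrightarrow> h s = h k"
  "grid k m h \<Longrightarrow> m \<le> t \<Longrightarrow> h s t = h s m"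
  unfolding grid_def by blast+

lemma grid_mirror:
  assumes "grid k m h" shows "grid m k (\<lambda>t s. h s t)"
  unfolding grid_def
proof (intro conjI allI impI)
  show "square (h t s) (h t (Suc s)) (h (Suc t) s) (h (Suc t) (Suc s))" for s t
    by (rule square_sym[OF grid_square[OF assms]])
  show "(\<lambda>s'. h s' s) = (\<lambda>s'. h s' m)" if "m \<le> s" for s
    using grid_stable(2)[OF assms that] by (rule ext)
  show "h t s = h k s" if "k \<le> t" for s t
    using grid_stable(1)[OF assms that] by (rule fun_cong)
qed

lemma grid_row:
  assumes "grid k m h" shows "tab m (h s)"
  unfolding tab_def
proof (intro conjI allI impI)
  show "rook (h s t) (h s (Suc t))" for t
    using square_sym[OF grid_square[OF assms]] unfolding square_def by blast
qed (rule grid_stable(2)[OF assms])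

lemma grid_col: "grid k m h \<Longrightarrow> tab k (\<lambda>s. h s t)"
  using grid_row[OF grid_mirror] .

lemma grid_prof: "grid k m h \<Longrightarrow> prof (h s) = prof (h 0)"
proof (induction s)
  case (Suc s)
  then have "prof (h (Suc s)) = prof (h s)"
    by (intro prof_slide grid_square)
  then show ?case using Suc by simp
qed simp

section \<open>Existence and uniqueness of growth diagrams with given boundary\<close>

definition slide :: "cell set \<Rightarrow> (nat \<Rightarrow> cell set) \<Rightarrow> nat \<Rightarrow> cell set" where
  "slide n b = rec_nat n (\<lambda>t y. switch y (b t) (b (Suc t)))"

lemma slide_simps [simp]:
  "slide n b 0 = n" "slide n b (Suc t) = switch (slide n b t) (b t) (b (Suc t))"
  by (simp_all add: slide_def)

lemma slide_square:
  assumes "rook n (b 0)" "tab m b"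
  shows "square (slide n b t) (b t) (slide n b (Suc t)) (b (Suc t))"
proof -
  have "rook (slide n b t) (b t)"
  proof (induction t)
    case (Suc t)
    then show ?case using switch_rook(2) tab_rook[OF assms(2)] by simp
  qed (use assms in simp)
  then show ?thesis using tab_rook[OF assms(2)] by (simp add: square_def)
qed

lemma slide_tab:
  assumes "rook n (b 0)" "tab m b"
  shows "tab m (slide n b)"
  unfolding tab_def
proof (intro conjI allI impI)
  show "rook (slide n b t) (slide n b (Suc t))" for t
    using square_sym[OF slide_square[OF assms]] unfolding square_def by blast
  show "slide n b t = slide n b m" if "m \<le> t" for t
    using that
  proof (induction t rule: dec_induct)
    case (step t)
    then have "b (Suc t) = b t" using tab_stable[OF assms(2)] by (metis le_SucI)
    moreover have "rook (slide n b t) (b t)" using slide_square[OF assms] unfolding square_def by blast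
    then have "switch (slide n b t) (b t) (b t) = slide n b t"
      using square_sym[OF square_diag] unfolding square_def by metis
    ultimately show ?case using step by simp
  qed simp
qed

text \<open>The rows are built backwards from row \<open>k\<close>, each by sliding its successor
  into the last strip of \<open>f\<close> that is still left.\<close>

lemma grid_exists:
  assumes f: "tab k f" and g: "tab m g" and fg: "f k = g 0"
  obtains h where "grid k m h" "\<And>s. h s 0 = f s" "h k = g"
proof -
  define H where "H = rec_nat g (\<lambda>i b. slide (f (k - Suc i)) b)"
  have H0: "H 0 = g" and HS: "H (Suc i) = slide (f (k - Suc i)) (H i)" for i
    unfolding H_def by simp_all
  have r: "rook (f (k - Suc i)) (f (k - i))" if "i < k" for i
    using tab_rook[OF f, of "k - Suc i"] that by (simp add: Suc_diff_Suc)
  have Ht: "i \<le> k \<Longrightarrow> tab m (H i) \<and> H i 0 = f (k - i)" for i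
  proof (induction i)
    case (Suc i)
    then show ?case using slide_tab[of "f (k - Suc i)" "H i" m] r[of i] by (simp add: HS)
  qed (simp add: H0 fg g)
  \<comment> \<open>Truncated subtraction makes all rows from \<open>k\<close> on equal to
    \<open>g\<close>.\<close>
  define h where "h s = H (k - s)" for s
  have "square (h s t) (h (Suc s) t) (h s (Suc t)) (h (Suc s) (Suc t))" for s t
  proof (cases "s < k")
    case True
    then have e: "k - s = Suc (k - Suc s)" by simp
    have "rook (f (k - Suc (k - Suc s))) (H (k - Suc s) 0)"
      using r[of "k - Suc s"] Ht[of "k - Suc s"] True by simp
    then show ?thesis
      using slide_square[of _ "H (k - Suc s)" m t] Ht[of "k - Suc s"] unfolding h_def e HS by simp
  next
    case False
    then show ?thesis unfolding h_def using tab_rook[OF g] by (simp add: H0 square_diag)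
  qed
  moreover have "h s = h k" if "s \<ge> k" for s using that by (simp add: h_def)
  moreover have "h s t = h s m" if "t \<ge> m" for s t
    using tab_stable[of m "H (k - s)" t] Ht[of "k - s"] that by (simp add: h_def)
  ultimately have "grid k m h" unfolding grid_def by blast
  moreover have "h s 0 = f s" for s
    using Ht[of "k - s"] tab_stable[OF f, of s] by (cases "s \<le> k") (simp_all add: h_def)
  moreover have "h k = g" by (simp add: h_def H0)
  ultimately show thesis using that by blast
qed

lemma grid_unique:
  assumes h: "grid k m h" and h': "grid k m h'" and "\<And>s. h s 0 = h' s 0" and "h k = h' k"
  shows "h = h'"
proof
  fix s
  have "h (k - i) = h' (k - i)" for i
  proof (induction i)
    case (Suc i)
    show ?case
    proof (cases "i < k")
      case True
      then have e: "Suc (k - Suc i) = k - i" by simp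
      show ?thesis
      proof
        fix t show "h (k - Suc i) t = h' (k - Suc i) t"
        proof (induction t)
          case 0 show ?case by (rule assms(3))
        next
          case (Suc t)
          have "g (k - Suc i) (Suc t) = switch (g (k - Suc i) t) (g (k - i) t) (g (k - i) (Suc t))"
            if "grid k m g" for g
            using grid_square[OF that, of "k - Suc i" t] e unfolding square_def by simp
          from this[OF h] this[OF h'] show ?case using Suc \<open>h (k - i) = h' (k - i)\<close> by simp
        qed
      qed
    next
      case False
      then show ?thesis using Suc by simp
    qed
  qed (use assms in simp)
  then have le: "h s = h' s" if "s \<le> k" using that by (metis diff_diff_cancel)
  show "h s = h' s"
  proof (cases "s \<le> k")
    case False
    then have "k \<le> s" by simp
    from grid_stable(1)[OF h this] grid_stable(1)[OF h' this] assms(4) show ?thesis by (simp only:)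
  qed (rule le)
qed

definition pairs :: "nat \<Rightarrow> nat \<Rightarrow> cell set \<Rightarrow> cell set \<Rightarrow> ((nat \<Rightarrow> cell set) \<times> (nat \<Rightarrow> cell set)) set" where
  "pairs k m al la = {(f, g). tab k f \<and> tab m g \<and> f 0 = al \<and> f k = g 0 \<and> g m = la}"

lemma bij_grid_pairs:
  "bij_betw (\<lambda>h. (\<lambda>s. h s 0, h k)) {h. grid k m h \<and> h 0 0 = al \<and> h k m = la} (pairs k m al la)"
  unfolding bij_betw_def
proof
  show "inj_on (\<lambda>h. (\<lambda>s. h s 0, h k)) {h. grid k m h \<and> h 0 0 = al \<and> h k m = la}"
  proof (rule inj_onI)
    fix h h' assume "h \<in> {h. grid k m h \<and> h 0 0 = al \<and> h k m = la}"
      "h' \<in> {h. grid k m h \<and> h 0 0 = al \<and> h k m = la}"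
      "((\<lambda>s. h s 0), h k) = ((\<lambda>s. h' s 0), h' k)"
    then show "h = h'"
      by (intro grid_unique[of k m h h']) (simp_all add: fun_eq_iff)
  qed
  show "(\<lambda>h. (\<lambda>s. h s 0, h k)) ` {h. grid k m h \<and> h 0 0 = al \<and> h k m = la} = pairs k m al la"
  proof (intro subset_antisym subsetI)
    fix p assume "p \<in> (\<lambda>h. (\<lambda>s. h s 0, h k)) ` {h. grid k m h \<and> h 0 0 = al \<and> h k m = la}"
    then show "p \<in> pairs k m al la"
      using grid_row grid_col unfolding pairs_def by auto
  next
    fix p assume "p \<in> pairs k m al la"
    then obtain f g where p: "p = (f, g)" "tab k f" "tab m g" "f 0 = al" "f k = g 0" "g m = la"
      unfolding pairs_def by auto
    from grid_exists[OF p(2,3,5)] obtain h where h: "grid k m h" "\<And>s. h s 0 = f s" "h k = g" by metis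
    then show "p \<in> (\<lambda>h. (\<lambda>s. h s 0, h k)) ` {h. grid k m h \<and> h 0 0 = al \<and> h k m = la}"
      using p by (intro image_eqI[of _ _ h]) auto
  qed
qed

text \<open>The bijection reads a grid once along its left and top side and once along its other two sides;
  all rows have the same profile, and so do all columns.\<close>

lemma infusion:
  obtains \<phi> where "bij_betw \<phi> (pairs k m al la) (pairs m k al la)"
    and "\<And>p. p \<in> pairs k m al la \<Longrightarrow> prof (fst (\<phi> p)) = prof (snd p) \<and> prof (snd (\<phi> p)) = prof (fst p)"
proof -
  let ?G = "{h. grid k m h \<and> h 0 0 = al \<and> h k m = la}"
  let ?G' = "{h. grid m k h \<and> h 0 0 = al \<and> h m k = la}"
  let ?A = "\<lambda>h. (\<lambda>s. h s 0, h k)" and ?B = "\<lambda>h. (\<lambda>s. h s 0, h m)"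
  let ?T = "\<lambda>h t s. h s t"
  have T: "bij_betw ?T ?G ?G'"
    by (rule bij_betw_byWitness[where f' = ?T]) (auto intro: grid_mirror)
  note A = bij_grid_pairs[of k m al la] and B = bij_grid_pairs[of m k al la]
  let ?\<phi> = "?B \<circ> (?T \<circ> inv_into ?G ?A)"
  have "bij_betw ?\<phi> (pairs k m al la) (pairs m k al la)"
    by (rule bij_betw_trans[OF bij_betw_trans[OF bij_betw_inv_into[OF A] T] B])
  moreover have "prof (fst (?\<phi> p)) = prof (snd p) \<and> prof (snd (?\<phi> p)) = prof (fst p)"
    if p: "p \<in> pairs k m al la" for p
  proof -
    have "p \<in> ?A ` ?G" using p A unfolding bij_betw_def by simp
    then obtain h where h: "h \<in> ?G" "p = ?A h" by blast
    have "inv_into ?G ?A p = h"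
      unfolding h(2) by (rule inv_into_f_f[OF bij_betw_imp_inj_on[OF A] h(1)])
    then show ?thesis
      using grid_prof[of k m h k] grid_prof[of m k "\<lambda>t s. h s t" m] grid_mirror[of k m h] h by simp
  qed
  ultimately show thesis using that by blast
qed

section \<open>Tableaux of straight shape\<close>

definition base :: "cell set" where
  "base = {(r, c). r \<le> 0 \<or> c \<le> 0}"

definition shape :: "cell set \<Rightarrow> bool" where
  "shape la \<longleftrightarrow> base \<subseteq> la \<and> down la \<and> finite (la - base)"

definition tableaux :: "nat \<Rightarrow> cell set \<Rightarrow> (nat \<Rightarrow> cell set) set" where
  "tableaux m la = {f. tab m f \<and> f 0 = base \<and> f m = la}"

definition profiles :: "nat \<Rightarrow> cell set \<Rightarrow> profile multiset" where
  "profiles m la = (\<Sum>f\<in>tableaux m la. {#prof f#})"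

text \<open>Keeps the letters \<open>d + 1, \<dots>, d + m\<close> and renumbers them as \<open>1, \<dots>, m\<close>.\<close>

definition restr :: "nat \<Rightarrow> nat \<Rightarrow> profile \<Rightarrow> profile" where
  "restr d m p a b = p (a + d) (min b m + d)"

definition inner :: "cell set \<Rightarrow> cell set set" where
  "inner la = {mu. base \<subseteq> mu \<and> rook mu la}"

lemma finite_tableaux: "shape la \<Longrightarrow> finite (tableaux m la)"
  by (rule finite_subset[OF _ finite_tabs[of la base m]]) (auto simp: tableaux_def shape_def)

lemma inner_shape: "shape la \<Longrightarrow> mu \<in> inner la \<Longrightarrow> shape mu"
  unfolding inner_def shape_def
  by (auto dest: rook_down) (meson Diff_mono finite_subset order_refl rook_sub)

lemma finite_inner:
  assumes "shape la" shows "finite (inner la)"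
proof (rule finite_subset)
  show "inner la \<subseteq> (\<lambda>S. S \<union> base) ` Pow (la - base)"
  proof
    fix mu assume "mu \<in> inner la"
    then have "mu = (mu - base) \<union> base" "mu - base \<subseteq> la - base"
      unfolding inner_def using rook_sub by blast+
    then show "mu \<in> (\<lambda>S. S \<union> base) ` Pow (la - base)" by blast
  qed
  show "finite ((\<lambda>S. S \<union> base) ` Pow (la - base))" using assms by (simp add: shape_def)
qed

section \<open>Removing the largest or the smallest letter\<close>

lemma pts_shift: "lis (pts \<pi> (\<lambda>t. f (Suc t)) a b) = lis (pts \<pi> f (Suc a) (Suc b))"
proof -
  have "pts \<pi> f (Suc a) (Suc b) = map_prod Suc id ` pts \<pi> (\<lambda>t. f (Suc t)) a b"
  proof (intro subset_antisym subsetI)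
    fix p assume "p \<in> pts \<pi> f (Suc a) (Suc b)"
    then obtain t x where p: "p = (t, \<pi> x)" "Suc a < t" "t \<le> Suc b" "x \<in> f t - f (t - 1)"
      unfolding pts_def by blast
    then obtain u where u: "t = Suc u" "a < u" "u \<le> b" by (cases t) auto
    then have "u - 1 + 1 = u" by simp
    then have "(u, \<pi> x) \<in> pts \<pi> (\<lambda>t. f (Suc t)) a b" using p u by (intro ptsI) auto
    then show "p \<in> map_prod Suc id ` pts \<pi> (\<lambda>t. f (Suc t)) a b"
      using p u by (intro image_eqI[of _ _ "(u, \<pi> x)"]) auto
  next
    fix p assume "p \<in> map_prod Suc id ` pts \<pi> (\<lambda>t. f (Suc t)) a b"
    then obtain u x where p: "p = (Suc u, \<pi> x)" "a < u" "u \<le> b" "x \<in> f (Suc u) - f (Suc (u - 1))"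
      unfolding pts_def by auto
    then show "p \<in> pts \<pi> f (Suc a) (Suc b)" by (auto intro!: ptsI)
  qed
  then show ?thesis by (simp add: lis_map strict_mono_def)
qed

lemma prof_shift: "prof (\<lambda>t. f (Suc t)) a b = prof f (Suc a) (Suc b)"
  unfolding prof_def by (simp add: pts_shift)

lemma prof_min:
  assumes "tab m f" shows "prof f a b = prof f a (min b m)"
proof -
  have "pts \<pi> f a b \<subseteq> pts \<pi> f a (min b m)" for \<pi> :: "cell \<Rightarrow> int"
  proof
    fix p assume "p \<in> pts \<pi> f a b"
    then obtain t x where p: "p = (t, \<pi> x)" "a < t" "t \<le> b" "x \<in> f t" "x \<notin> f (t - 1)" by (rule ptsE)
    have "t \<le> m"
      using tab_stable[OF assms, of t] tab_stable[OF assms, of "t - 1"] p(4,5) by (cases "t \<le> m") auto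
    then show "p \<in> pts \<pi> f a (min b m)" using p by (auto intro: ptsI)
  qed
  then have "pts \<pi> f a b = pts \<pi> f a (min b m)" for \<pi> :: "cell \<Rightarrow> int"
    using pts_mono[of "min b m" b \<pi> f a] by (simp add: subset_antisym)
  then show ?thesis unfolding prof_def by metis
qed

lemma prof_cong: "(\<And>t. t \<le> b \<Longrightarrow> f t = g t) \<Longrightarrow> prof f a b = prof g a b"
  unfolding prof_def by (metis pts_cong)

lemma image_mset_sum: "image_mset g (\<Sum>x\<in>A. F x) = (\<Sum>x\<in>A. image_mset g (F x))"
  by (induction A rule: infinite_finite_induct) auto

lemma tab_truncate:
  assumes "tab k f" shows "tab m (\<lambda>t. f (min t m))"
proof -
  have "rook (f (min t m)) (f (min (Suc t) m))" for t
  proof (cases "Suc t \<le> m")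
    case True
    then show ?thesis using tab_rook[OF assms, of t] by simp
  next
    case False
    then show ?thesis using rook_refl[OF rook_down(1)[OF tab_rook[OF assms, of m]]] by simp
  qed
  then show ?thesis unfolding tab_def by simp
qed

text \<open>The cells of the letter \<open>Suc m\<close> can be any rook strip at the rim of
  \<open>la\<close>, and the rest can be any tableau on the shape that remains.\<close>

lemma restr_top:
  assumes "shape la"
  shows "image_mset (restr 0 m) (profiles (Suc m) la) = (\<Sum>mu\<in>inner la. profiles m mu)"
proof -
  let ?\<phi> = "\<lambda>f. (f m, \<lambda>t. f (min t m))" and ?\<psi> = "\<lambda>(mu, g) t. if t \<le> m then g t else la"
  have "bij_betw ?\<phi> (tableaux (Suc m) la) (SIGMA mu:inner la. tableaux m mu)"
  proof (rule bij_betw_byWitness[where f' = ?\<psi>])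
    show "\<forall>f\<in>tableaux (Suc m) la. ?\<psi> (?\<phi> f) = f"
    proof (intro ballI ext)
      fix f t assume "f \<in> tableaux (Suc m) la"
      then show "?\<psi> (?\<phi> f) t = f t"
        using tab_stable[of "Suc m" f t] by (auto simp: tableaux_def)
    qed
    show "\<forall>p\<in>SIGMA mu:inner la. tableaux m mu. ?\<phi> (?\<psi> p) = p"
      by (auto simp: tableaux_def tab_min)
    show "?\<phi> ` tableaux (Suc m) la \<subseteq> (SIGMA mu:inner la. tableaux m mu)"
    proof (rule image_subsetI)
      fix f assume f: "f \<in> tableaux (Suc m) la"
      then have t: "tab (Suc m) f" "f 0 = base" "f (Suc m) = la" by (auto simp: tableaux_def)
      have "tab m (\<lambda>t. f (min t m))" by (rule tab_truncate[OF t(1)])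
      moreover have "f m \<in> inner la"
        using tab_rook[OF t(1), of m] tab_mono[OF t(1), of 0 m] t by (simp add: inner_def)
      ultimately show "?\<phi> f \<in> (SIGMA mu:inner la. tableaux m mu)"
        using t by (simp add: tableaux_def)
    qed
    show "?\<psi> ` (SIGMA mu:inner la. tableaux m mu) \<subseteq> tableaux (Suc m) la"
    proof (rule image_subsetI)
      fix p assume "p \<in> (SIGMA mu:inner la. tableaux m mu)"
      then obtain mu g where p: "p = (mu, g)" "rook mu la" "tab m g" "g 0 = base" "g m = mu"
        by (auto simp: inner_def tableaux_def)
      have "rook (?\<psi> p t) (?\<psi> p (Suc t))" for t
      proof (cases "t < m")
        case True
        then show ?thesis using p tab_rook[OF p(3), of t] by simp
      next
        case False
        then show ?thesis using p(1,2,5) rook_refl[OF rook_down(2)[OF p(2)]] by (cases "t = m") simp_all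
      qed
      moreover have "?\<psi> p t = la" if "Suc m \<le> t" for t using p(1) that by simp
      moreover have "?\<psi> p 0 = base" using p(1,4) by simp
      ultimately show "?\<psi> p \<in> tableaux (Suc m) la"
        unfolding tableaux_def tab_def by simp
    qed
  qed
  then have "(\<Sum>p\<in>(SIGMA mu:inner la. tableaux m mu). {#prof (snd p)#}) =
      (\<Sum>f\<in>tableaux (Suc m) la. {#prof (\<lambda>t. f (min t m))#})"
    by (subst sum.reindex_bij_betw[symmetric]) auto
  also have "\<dots> = (\<Sum>f\<in>tableaux (Suc m) la. {#restr 0 m (prof f)#})"
  proof (intro sum.cong refl arg_cong[of _ _ "\<lambda>x. {#x#}"] ext)
    fix f a b assume "f \<in> tableaux (Suc m) la"
    then have "tab (Suc m) f" by (simp add: tableaux_def)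
    have "prof (\<lambda>t. f (min t m)) a b = prof (\<lambda>t. f (min t m)) a (min b m)"
      by (rule prof_min[OF tab_truncate[OF \<open>tab (Suc m) f\<close>]])
    also have "\<dots> = prof f a (min b m)" by (rule prof_cong) simp
    finally show "prof (\<lambda>t. f (min t m)) a b = restr 0 m (prof f) a b" by (simp add: restr_def)
  qed
  also have "\<dots> = image_mset (restr 0 m) (profiles (Suc m) la)"
    unfolding profiles_def by (simp add: image_mset_sum)
  finally show ?thesis
    unfolding profiles_def
    using finite_inner[OF assms] finite_tableaux[OF inner_shape[OF assms]]
    by (subst sum.Sigma) (auto simp: case_prod_unfold)
qed

text \<open>Without its smallest letter the tableau is skew. Infusion with the one-letter tableau of
  the removed cells yields a straight tableau of the same profile, followed by a rook strip that
  completes it to \<open>la\<close>. These pairs are counted by the right-hand side of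
  \<open>restr_top\<close>.\<close>

lemma restr_bot:
  assumes "shape la"
  shows "image_mset (restr 1 m) (profiles (Suc m) la) = (\<Sum>mu\<in>inner la. profiles m mu)"
proof -
  let ?\<phi> = "\<lambda>f. (\<lambda>t. f (min t 1), \<lambda>t. f (Suc t))" and ?\<psi> = "\<lambda>(g, h) t. case t of 0 \<Rightarrow> base | Suc t \<Rightarrow> h t"
  have 1: "bij_betw ?\<phi> (tableaux (Suc m) la) (pairs 1 m base la)"
  proof (rule bij_betw_byWitness[where f' = ?\<psi>])
    show "\<forall>f\<in>tableaux (Suc m) la. ?\<psi> (?\<phi> f) = f"
      by (auto simp: tableaux_def fun_eq_iff split: nat.split)
    show "\<forall>p\<in>pairs 1 m base la. ?\<phi> (?\<psi> p) = p"
    proof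
      fix p assume "p \<in> pairs 1 m base la"
      then obtain g h where p: "p = (g, h)" "tab 1 g" "g 0 = base" "g 1 = h 0" by (auto simp: pairs_def)
      have "(case min t 1 of 0 \<Rightarrow> base | Suc t \<Rightarrow> h t) = g t" for t
        using p(3,4) tab_stable[OF p(2), of t] by (cases t) simp_all
      then show "?\<phi> (?\<psi> p) = p" using p by simp
    qed
    show "?\<phi> ` tableaux (Suc m) la \<subseteq> pairs 1 m base la"
    proof (rule image_subsetI)
      fix f assume "f \<in> tableaux (Suc m) la"
      then have t: "tab (Suc m) f" "f 0 = base" "f (Suc m) = la" by (auto simp: tableaux_def)
      have "rook (f (min t 1)) (f (min (Suc t) 1))" for t
        using tab_rook[OF t(1), of 0] by (cases t) (auto intro!: rook_refl dest: rook_down)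
      then have "tab 1 (\<lambda>t. f (min t 1))" unfolding tab_def by simp
      moreover have "tab m (\<lambda>t. f (Suc t))"
        unfolding tab_def using tab_rook[OF t(1)] tab_stable[OF t(1)] Suc_le_mono by blast
      ultimately show "?\<phi> f \<in> pairs 1 m base la" using t by (simp add: pairs_def)
    qed
    show "?\<psi> ` pairs 1 m base la \<subseteq> tableaux (Suc m) la"
    proof (rule image_subsetI)
      fix p assume "p \<in> pairs 1 m base la"
      then obtain g h where p: "p = (g, h)" "tab 1 g" "tab m h" "g 0 = base" "g 1 = h 0" "h m = la"
        by (auto simp: pairs_def)
      have "rook (?\<psi> p t) (?\<psi> p (Suc t))" for t
        using p(1,4,5) tab_rook[OF p(2), of 0] tab_rook[OF p(3)] by (cases t) simp_all
      moreover have "?\<psi> p t = la" if "Suc m \<le> t" for t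
        using that p(1,6) tab_stable[OF p(3), of "t - 1"] by (cases t) simp_all
      moreover have "?\<psi> p 0 = base" using p(1) by simp
      ultimately show "?\<psi> p \<in> tableaux (Suc m) la"
        unfolding tableaux_def tab_def by simp
    qed
  qed
  have 2: "bij_betw (\<lambda>p. (fst p m, fst p)) (pairs m 1 base la) (SIGMA mu:inner la. tableaux m mu)"
  proof (rule bij_betw_byWitness[where f' = "\<lambda>(mu, g). (g, \<lambda>t. if t = 0 then mu else la)"])
    show "\<forall>p\<in>pairs m 1 base la. (\<lambda>(mu, g). (g, \<lambda>t. if t = 0 then mu else la)) (fst p m, fst p) = p"
    proof
      fix p assume "p \<in> pairs m 1 base la"
      then obtain g h where p: "p = (g, h)" "tab 1 h" "g m = h 0" "h 1 = la" by (auto simp: pairs_def)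
      have "(if t = 0 then g m else la) = h t" for t
        using p(3,4) tab_stable[OF p(2), of t] by (cases t) simp_all
      then have "(\<lambda>t. if t = 0 then g m else la) = h" by (rule ext)
      then show "(\<lambda>(mu, g). (g, \<lambda>t. if t = 0 then mu else la)) (fst p m, fst p) = p"
        unfolding p(1) by simp
    qed
    show "\<forall>p\<in>SIGMA mu:inner la. tableaux m mu.
        (\<lambda>p. (fst p m, fst p)) ((\<lambda>(mu, g). (g, \<lambda>t. if t = 0 then mu else la)) p) = p"
      by (auto simp: tableaux_def)
    show "(\<lambda>p. (fst p m, fst p)) ` pairs m 1 base la \<subseteq> (SIGMA mu:inner la. tableaux m mu)"
    proof (rule image_subsetI)
      fix p assume "p \<in> pairs m 1 base la"
      then obtain g h where p: "p = (g, h)" "tab m g" "tab 1 h" "g 0 = base" "g m = h 0" "h 1 = la"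
        by (auto simp: pairs_def)
      then have "rook (g m) la" "base \<subseteq> g m"
        using tab_rook[OF p(3), of 0] tab_mono[OF p(2), of 0 m] by auto
      then show "(fst p m, fst p) \<in> (SIGMA mu:inner la. tableaux m mu)"
        using p by (simp add: inner_def tableaux_def)
    qed
    show "(\<lambda>(mu, g). (g, \<lambda>t. if t = 0 then mu else la)) ` (SIGMA mu:inner la. tableaux m mu) \<subseteq> pairs m 1 base la"
    proof (rule image_subsetI)
      fix p assume "p \<in> (SIGMA mu:inner la. tableaux m mu)"
      then obtain mu g where p: "p = (mu, g)" "rook mu la" "tab m g" "g 0 = base" "g m = mu"
        by (auto simp: inner_def tableaux_def)
      have "tab 1 (\<lambda>t. if t = 0 then mu else la)"
        using p(2) rook_refl[OF rook_down(2)[OF p(2)]] unfolding tab_def by simp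
      then show "(\<lambda>(mu, g). (g, \<lambda>t. if t = 0 then mu else la)) p \<in> pairs m 1 base la"
        using p by (simp add: pairs_def)
    qed
  qed
  obtain \<phi> where \<phi>: "bij_betw \<phi> (pairs 1 m base la) (pairs m 1 base la)"
    "\<And>p. p \<in> pairs 1 m base la \<Longrightarrow> prof (fst (\<phi> p)) = prof (snd p) \<and> prof (snd (\<phi> p)) = prof (fst p)"
    using infusion by blast
  have "(\<Sum>p\<in>(SIGMA mu:inner la. tableaux m mu). {#prof (snd p)#}) = (\<Sum>p\<in>pairs m 1 base la. {#prof (fst p)#})"
    by (subst sum.reindex_bij_betw[OF 2, symmetric]) simp
  also have "\<dots> = (\<Sum>p\<in>pairs 1 m base la. {#prof (snd p)#})"
    using \<phi>(2) by (subst sum.reindex_bij_betw[OF \<phi>(1), symmetric]) (auto intro: sum.cong)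
  also have "\<dots> = (\<Sum>f\<in>tableaux (Suc m) la. {#prof (\<lambda>t. f (Suc t))#})"
    by (subst sum.reindex_bij_betw[OF 1, symmetric]) simp
  also have "\<dots> = (\<Sum>f\<in>tableaux (Suc m) la. {#restr 1 m (prof f)#})"
  proof (intro sum.cong refl arg_cong[of _ _ "\<lambda>x. {#x#}"] ext)
    fix f a b assume "f \<in> tableaux (Suc m) la"
    then have "tab (Suc m) f" by (simp add: tableaux_def)
    then show "prof (\<lambda>t. f (Suc t)) a b = restr 1 m (prof f) a b"
      unfolding prof_shift restr_def using prof_min[of "Suc m" f "Suc a" "Suc b"] by simp
  qed
  also have "\<dots> = image_mset (restr 1 m) (profiles (Suc m) la)"
    unfolding profiles_def by (simp add: image_mset_sum)
  finally show ?thesis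
    unfolding profiles_def
    using finite_inner[OF assms] finite_tableaux[OF inner_shape[OF assms]]
    by (subst sum.Sigma) (auto simp: case_prod_unfold)
qed

section \<open>Appending a letter\<close>

text \<open>A chain has at most one point in each column, and the first row attains this bound
  because its letters increase to the right.\<close>

lemma total_columns:
  assumes f: "f \<in> tableaux m la" and la: "shape la"
  shows "lis (pts snd f 0 m) = card (snd ` (la - base))"
proof (rule antisym)
  have t: "tab m f" "f 0 = base" "f m = la" using f by (auto simp: tableaux_def)
  have fin: "finite (snd ` (la - base))" using la by (simp add: shape_def)
  obtain X where X: "X \<subseteq> pts snd f 0 m" "increasing X" "finite X" "card X = lis (pts snd f 0 m)"
    using lis_obtain[OF finite_fst_pts] .
  have "snd ` X \<subseteq> snd ` (la - base)"
  proof (rule image_subsetI)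
    fix p assume "p \<in> X"
    then have "p \<in> pts snd f 0 m" using X(1) by blast
    then obtain s x where "p = (s, snd x)" "x \<in> f s" "x \<notin> f (s - 1)" by (rule ptsE)
    moreover have "base \<subseteq> f (s - 1)" "f s \<subseteq> la"
      using tab_mono[OF t(1), of 0 "s - 1"] tab_le[OF t(1), of s] t by auto
    ultimately show "snd p \<in> snd ` (la - base)" by auto
  qed
  from card_mono[OF fin this] show "lis (pts snd f 0 m) \<le> card (snd ` (la - base))"
    using X by (simp add: card_image[OF increasing_inj_snd])
  let ?X = "{(s, c). 0 < s \<and> s \<le> m \<and> (1, c) \<in> f s \<and> (1, c) \<notin> f (s - 1)}"
  have lt: "s < s'" if "(s, c) \<in> ?X" "(s', c') \<in> ?X" "c < c'" for s c s' c'
  proof (rule ccontr)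
    assume "\<not> s < s'"
    then have sub: "f (s' - 1) \<subseteq> f (s - 1)" using tab_mono[OF t(1)] by simp
    have r: "rook (f (s' - 1)) (f s')" using tab_rook[OF t(1), of "s' - 1"] that by simp
    have "(1, c' - 1) \<in> f (s' - 1)" using rookD'(2)[OF r] that by auto
    then have "(1, c) \<in> f (s' - 1)" using down_le[OF rook_down(1)[OF r]] that by simp
    then show False using sub that by auto
  qed
  have inj: "s = s'" if "(s, c) \<in> ?X" "(s', c) \<in> ?X" for s s' c
  proof (rule ccontr)
    assume "s \<noteq> s'"
    then have "f s \<subseteq> f (s' - 1) \<or> f s' \<subseteq> f (s - 1)"
      using tab_mono[OF t(1), of s "s' - 1"] tab_mono[OF t(1), of s' "s - 1"] by linarith
    then show False using that by auto
  qed
  have inc: "increasing ?X"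
    unfolding increasing_def
  proof (intro ballI impI)
    fix p q assume pq: "p \<in> ?X" "q \<in> ?X" "p \<noteq> q"
    obtain s c s' c' where e: "p = (s, c)" "q = (s', c')" by fastforce
    have "c \<noteq> c'" using inj[of s c s'] pq unfolding e by auto
    then have "c < c' \<or> c' < c" by auto
    then show "fst p < fst q \<and> snd p < snd q \<or> fst q < fst p \<and> snd q < snd p"
      using lt pq unfolding e by auto
  qed
  have "snd ` (la - base) \<subseteq> snd ` ?X"
  proof (rule image_subsetI)
    fix x assume x: "x \<in> la - base"
    obtain r c where rc: "x = (r, c)" by fastforce
    have pos: "1 \<le> r" "1 \<le> c" using x unfolding rc base_def by auto
    then have c1: "(1, c) \<in> f m" using x la down_le[of la r c 1 c] t unfolding rc shape_def by auto
    \<comment> \<open>\<open>s\<close> is the letter in the cell \<open>(1, c)\<close>.\<close>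
    define s where "s = (LEAST s. (1, c) \<in> f s)"
    have s: "(1, c) \<in> f s" "s \<le> m" unfolding s_def using c1 by (auto intro: LeastI Least_le)
    have "(1, c) \<notin> f 0" using t pos by (simp add: base_def)
    then have "0 < s" using s by (cases s) auto
    moreover then have "(1, c) \<notin> f (s - 1)"
      using not_less_Least[of "s - 1" "\<lambda>s. (1, c) \<in> f s"] unfolding s_def by simp
    ultimately have "(s, c) \<in> ?X" using s by simp
    then show "snd x \<in> snd ` ?X" unfolding rc by force
  qed
  moreover have "?X \<subseteq> pts snd f 0 m" by (auto intro: ptsI)
  ultimately have X: "snd ` (la - base) \<subseteq> snd ` ?X" "?X \<subseteq> pts snd f 0 m" by blast+
  have "card (snd ` (la - base)) \<le> card (snd ` ?X)"
    by (rule card_mono[OF finite_imageI[OF increasing_finite[OF inc X(2) finite_fst_pts]] X(1)])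
  also have "\<dots> = card ?X" by (rule card_image[OF increasing_inj_snd[OF inc]])
  also have "\<dots> \<le> lis (pts snd f 0 m)" by (rule lis_ge[OF finite_fst_pts X(2) inc])
  finally show "card (snd ` (la - base)) \<le> lis (pts snd f 0 m)" .
qed

lemma mirror_base: "mirror base = base"
  unfolding mirror_def base_def by auto

lemma mirror_diff: "mirror A - mirror B = prod.swap ` (A - B)"
  unfolding mirror_def by auto

lemma shape_mirror: "shape la \<Longrightarrow> shape (mirror la)"
  unfolding shape_def using mirror_diff[of la base] mirror_base
  by (auto simp: down_def base_def)

lemma tableaux_mirror: "f \<in> tableaux m la \<Longrightarrow> (\<lambda>t. mirror (f t)) \<in> tableaux m (mirror la)"
  unfolding tableaux_def tab_def by (auto simp: mirror_base rook_mirror)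

lemma total_rows:
  assumes "f \<in> tableaux m la" "shape la"
  shows "lis (pts fst f 0 m) = card (fst ` (la - base))"
proof -
  have "snd ` (mirror la - base) = fst ` (la - base)"
    using mirror_diff[of la base] unfolding mirror_base by (simp add: image_image)
  then show ?thesis
    unfolding pts_fst_mirror
    using total_columns[OF tableaux_mirror[OF assms(1)] shape_mirror[OF assms(2)]] by simp
qed

section \<open>One-row tableaux and the skew shape that receives a new letter\<close>

definition row :: "nat \<Rightarrow> nat \<Rightarrow> cell set" where
  "row k s = {(r, c). r \<le> 0 \<or> c \<le> 0 \<or> r = 1 \<and> c \<le> int (min s k)}"

lemma row_tableau: "row k \<in> tableaux k (row k k)"
proof -
  have "rook (row k s) (row k (Suc s))" for s
    unfolding rook_def down_def row_def by (auto simp: min_def)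
  then show ?thesis unfolding tableaux_def tab_def by (auto simp: row_def base_def)
qed

lemma row_minus_base: "row k k - base = {1} \<times> {1..int k}"
  unfolding row_def base_def by auto

lemma row_shape: "shape (row k k)"
proof -
  have "down (row k k)" unfolding down_def row_def by auto
  then show ?thesis unfolding shape_def row_minus_base by (auto simp: row_def base_def)
qed

text \<open>Phrased in terms of the profile alone, so that infusion carries the condition from one
  tableau of a pair to the other.\<close>

definition row_like :: "nat \<Rightarrow> profile \<Rightarrow> bool" where
  "row_like k p \<longleftrightarrow> fst (p 0 k) = k \<and> snd (p 0 k) \<le> 1"

lemma row_row_like: "row_like k (prof (row k))"
proof -
  have "card (fst ` ({1::int} \<times> {1..int k})) \<le> card {1::int}" by (intro card_mono) auto
  moreover have "card (snd ` ({1::int} \<times> {1..int k})) = k" by simp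
  ultimately show ?thesis
    using total_columns[OF row_tableau row_shape] total_rows[OF row_tableau row_shape]
    unfolding row_like_def prof_def row_minus_base by simp
qed

text \<open>By \<open>total_columns\<close> and \<open>total_rows\<close> the shape is a single row
  of \<open>k\<close> cells. Its letters increase strictly and are taken from \<open>1\<close> to
  \<open>k\<close>, which leaves no choice.\<close>

lemma row_like_unique:
  assumes f: "f \<in> tableaux k ka" and ka: "shape ka" and like: "row_like k (prof f)"
  shows "f = row k"
proof -
  have t: "tab k f" "f 0 = base" "f k = ka" using f by (auto simp: tableaux_def)
  have cols: "card (snd ` (ka - base)) = k" and rows: "card (fst ` (ka - base)) \<le> 1"
    using like total_columns[OF f ka] total_rows[OF f ka] unfolding row_like_def prof_def by auto
  have fin: "finite (ka - base)" using ka by (simp add: shape_def)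
  have one: "r = 1" if "(r, c) \<in> ka" "(r, c) \<notin> base" for r c
  proof -
    have "(1, c) \<in> ka - base"
      using down_le[of ka r c 1 c] that ka unfolding shape_def base_def by auto
    then have "1 \<in> fst ` (ka - base)" "r \<in> fst ` (ka - base)" using that by force+
    then show ?thesis using rows fin by (metis One_nat_def card_le_Suc0_iff_eq finite_imageI)
  qed
  have le: "(1, c) \<in> f s \<Longrightarrow> c \<le> int s" for s c
  proof (induction s arbitrary: c)
    case 0
    then show ?case using t(2) by (simp add: base_def)
  next
    case (Suc s)
    then have "(1, c - 1) \<in> f s" using rookD'(2)[OF tab_rook[OF t(1)]] by blast
    then show ?case using Suc.IH by force
  qed
  have sub: "snd ` (ka - base) \<subseteq> {1..int k}"
  proof (rule image_subsetI)
    fix x assume x: "x \<in> ka - base"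
    obtain r c where rc: "x = (r, c)" by fastforce
    then have "r = 1" using one x by blast
    then show "snd x \<in> {1..int k}" using le[of c k] x t unfolding rc base_def by auto
  qed
  have "snd ` (ka - base) = {1..int k}"
    by (rule card_subset_eq[OF _ sub]) (use cols in auto)
  then have "(1, int k) \<in> f k" if "0 < k"
  proof -
    have "int k \<in> snd ` (ka - base)" using \<open>snd ` (ka - base) = {1..int k}\<close> that by simp
    then obtain r where "(r, int k) \<in> ka - base" by force
    then show ?thesis using one t by blast
  qed
  then have top: "(1, int k) \<in> f k" using t by (cases "k = 0") (auto simp: base_def)
  \<comment> \<open>Each letter lengthens the row by at most one cell, so reaching column
    \<open>k\<close> with \<open>k\<close> letters leaves no slack. Hence the descent from the last
    cell.\<close>
  have diag: "(1, int (k - i)) \<in> f (k - i)" for i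
  proof (induction i)
    case (Suc i)
    show ?case
    proof (cases "i < k")
      case True
      then have e: "k - i = Suc (k - Suc i)" by simp
      have "(1, int (k - i) - 1) \<in> f (k - Suc i)"
        using rookD'(2)[OF tab_rook[OF t(1), of "k - Suc i"]] Suc unfolding e by blast
      then show ?thesis unfolding e by simp
    next
      case False
      then show ?thesis using Suc by simp
    qed
  qed (use top in simp)
  have "f s = row k s" if "s \<le> k" for s
  proof (intro set_eqI)
    fix x :: cell
    obtain r c where rc: "x = (r, c)" by fastforce
    have "(1, int s) \<in> f s" using diag[of "k - s"] that by simp
    moreover have "down (f s)" using tab_rook[OF t(1), of s] rook_down by blast
    ultimately have "(1, c) \<in> f s" if "c \<le> int s" for c using down_le[of "f s"] that by blast
    moreover have "base \<subseteq> f s" "f s \<subseteq> ka" using tab_mono[OF t(1), of 0 s] tab_le[OF t(1), of s] t by auto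
    ultimately show "x \<in> f s \<longleftrightarrow> x \<in> row k s"
      using one[of r c] le[of c s] that unfolding rc row_def base_def by auto
  qed
  then have "f (min s k) = row k (min s k)" for s by simp
  moreover have "row k (min s k) = row k s" for s by (simp add: row_def)
  ultimately show ?thesis using tab_min[OF t(1)] by (metis ext)
qed

text \<open>The tableau \<open>f\<close> is moved down by one row, and the letter \<open>x\<close> is placed in the first row to the
  right of \<open>k\<close> empty cells that cover all columns of \<open>f\<close>.\<close>

definition star :: "nat \<Rightarrow> nat \<Rightarrow> (nat \<Rightarrow> cell set) \<Rightarrow> nat \<Rightarrow> cell set" where
  "star k x f t = {(r, c). r \<le> 0 \<or> r = 1 \<and> c \<le> int k + (if x \<le> t then 1 else 0) \<or> 2 \<le> r \<and> (r - 1, c) \<in> f t}"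

definition star_shape :: "nat \<Rightarrow> cell set \<Rightarrow> cell set" where
  "star_shape k la = {(r, c). r \<le> 0 \<or> r = 1 \<and> c \<le> int k + 1 \<or> 2 \<le> r \<and> (r - 1, c) \<in> la}"

text \<open>An increasing sequence ending in \<open>x\<close> continues one with letters below
  \<open>x\<close>, a decreasing one continues one with letters above \<open>x\<close>. The interval
  from \<open>a + 1\<close> to \<open>b\<close> has to contain \<open>x\<close>.\<close>

definition append_letter :: "nat \<Rightarrow> profile \<Rightarrow> profile" where
  "append_letter x p a b =
     (if a < x \<and> x \<le> b
      then (max (fst (p a b)) (Suc (fst (p a (x - 1)))), max (snd (p a b)) (Suc (snd (p x b))))
      else p a b)"

text \<open>The new cell lies to the right of all columns of \<open>f\<close> and above all its
  rows, so its point is last among the columns and first among the rows. Shifting the rows of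
  \<open>f\<close> by one does not affect \<open>lis\<close>.\<close>

lemma prof_star:
  assumes f: "tab m f" "f 0 = base" "f m = la" and wide: "\<And>r c. (r, c) \<in> la \<Longrightarrow> 1 \<le> r \<Longrightarrow> c \<le> int k"
    and x: "1 \<le> x"
  shows "prof (star k x f) = append_letter x (prof f)"
proof (intro ext)
  fix a b
  have base: "base \<subseteq> f t" and sub: "f t \<subseteq> la" for t
    using tab_mono[OF f(1), of 0 t] tab_le[OF f(1), of t] f by auto
  have diff: "(r, c) \<in> star k x f t - star k x f (t - 1) \<longleftrightarrow>
      t = x \<and> (r, c) = (1, int k + 1) \<or> (r - 1, c) \<in> f t - f (t - 1)" if "0 < t" for r c t
  proof -
    have "2 \<le> r" if "(r - 1, c) \<in> f t - f (t - 1)"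
    proof -
      have "(r - 1, c) \<notin> base" using that base[of "t - 1"] by blast
      then show ?thesis by (simp add: base_def)
    qed
    moreover have "x \<le> t \<and> \<not> x \<le> t - 1 \<longleftrightarrow> t = x" using that x by auto
    ultimately show ?thesis using that unfolding star_def by auto
  qed
  have snd_pts: "pts snd (star k x f) a b =
      (if a < x \<and> x \<le> b then insert (x, int k + 1) (pts snd f a b) else pts snd f a b)" for a b
  proof (intro set_eqI)
    fix p :: "nat \<times> int"
    obtain t c where p: "p = (t, c)" by fastforce
    have "p \<in> pts snd (star k x f) a b \<longleftrightarrow>
        a < t \<and> t \<le> b \<and> (\<exists>r. (r, c) \<in> star k x f t - star k x f (t - 1))"
      unfolding p pts_def by force
    also have "\<dots> \<longleftrightarrow> a < t \<and> t \<le> b \<and> (t = x \<and> c = int k + 1 \<or> (\<exists>r. (r, c) \<in> f t - f (t - 1)))"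
    proof (cases "a < t")
      case True
      have "(\<exists>r. (r, c) \<in> star k x f t - star k x f (t - 1)) \<longleftrightarrow>
          (\<exists>r. t = x \<and> (r, c) = (1, int k + 1) \<or> (r - 1, c) \<in> f t - f (t - 1))"
        by (intro ex_cong1 diff) (use True in simp)
      also have "\<dots> \<longleftrightarrow> t = x \<and> c = int k + 1 \<or> (\<exists>r. (r - 1, c) \<in> f t - f (t - 1))" by blast
      also have "(\<exists>r. (r - 1, c) \<in> f t - f (t - 1)) \<longleftrightarrow> (\<exists>r. (r, c) \<in> f t - f (t - 1))"
        by (metis add_diff_cancel_right')
      finally show ?thesis by (simp only:)
    qed simp
    also have "\<dots> \<longleftrightarrow> p \<in> (if a < x \<and> x \<le> b then insert (x, int k + 1) (pts snd f a b) else pts snd f a b)"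
      unfolding p pts_def by force
    finally show "p \<in> pts snd (star k x f) a b \<longleftrightarrow> p \<in> (if a < x \<and> x \<le> b then insert (x, int k + 1) (pts snd f a b) else pts snd f a b)" .
  qed
  let ?S = "\<lambda>a b. map_prod id (\<lambda>r. r + 1) ` pts fst f a b"
  have fst_pts: "pts fst (star k x f) a b =
      (if a < x \<and> x \<le> b then insert (x, 1) (?S a b) else ?S a b)" for a b
  proof (intro set_eqI)
    fix p :: "nat \<times> int"
    obtain t r where p: "p = (t, r)" by fastforce
    have "p \<in> pts fst (star k x f) a b \<longleftrightarrow>
        a < t \<and> t \<le> b \<and> (\<exists>c. (r, c) \<in> star k x f t - star k x f (t - 1))"
      unfolding p pts_def by force
    also have "\<dots> \<longleftrightarrow> a < t \<and> t \<le> b \<and> (t = x \<and> r = 1 \<or> (\<exists>c. (r - 1, c) \<in> f t - f (t - 1)))"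
    proof (cases "a < t")
      case True
      have "(\<exists>c. (r, c) \<in> star k x f t - star k x f (t - 1)) \<longleftrightarrow>
          (\<exists>c. t = x \<and> (r, c) = (1, int k + 1) \<or> (r - 1, c) \<in> f t - f (t - 1))"
        by (intro ex_cong1 diff) (use True in simp)
      also have "\<dots> \<longleftrightarrow> t = x \<and> r = 1 \<or> (\<exists>c. (r - 1, c) \<in> f t - f (t - 1))" by blast
      finally show ?thesis by (simp only:)
    qed simp
    also have "\<dots> \<longleftrightarrow> p \<in> (if a < x \<and> x \<le> b then insert (x, 1) (?S a b) else ?S a b)"
    proof -
      have "p \<in> ?S a b \<longleftrightarrow> (t, r - 1) \<in> pts fst f a b" unfolding p by force
      moreover have "(t, r - 1) \<in> pts fst f a b \<longleftrightarrow> a < t \<and> t \<le> b \<and> (\<exists>c. (r - 1, c) \<in> f t - f (t - 1))"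
        unfolding pts_def by force
      ultimately show ?thesis unfolding p by auto
    qed
    finally show "p \<in> pts fst (star k x f) a b \<longleftrightarrow> p \<in> (if a < x \<and> x \<le> b then insert (x, 1) (?S a b) else ?S a b)" .
  qed
  have S: "lis (?S a b) = lis (pts fst f a b)" for a b
    by (intro lis_map) (auto simp: strict_mono_def)
  show "prof (star k x f) a b = append_letter x (prof f) a b"
  proof (cases "a < x \<and> x \<le> b")
    case False
    then show ?thesis
      unfolding append_letter_def prof_def by (simp only: snd_pts fst_pts S if_False)
  next
    case True
    have pos: "1 \<le> r \<and> c \<le> int k" if "(r, c) \<in> f t" "(r, c) \<notin> f (t - 1)" for r c t
    proof -
      have "(r, c) \<in> la" "(r, c) \<notin> base" using that base[of "t - 1"] sub[of t] by auto
      then show ?thesis using wide[of r c] by (simp add: base_def)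
    qed
    have "lis (insert (x, int k + 1) (pts snd f a b)) =
        max (lis (pts snd f a b)) (Suc (lis {p \<in> pts snd f a b. fst p < x}))"
    proof (rule lis_insert_last[OF finite_fst_pts])
      fix p assume "p \<in> pts snd f a b"
      then show "snd p < int k + 1" using pos by (auto elim!: ptsE)
    qed
    moreover have "{p \<in> pts snd f a b. fst p < x} = pts snd f a (x - 1)"
      using True unfolding pts_def by auto
    moreover have "lis (insert (x, 1) (?S a b)) = max (lis (?S a b)) (Suc (lis {p \<in> ?S a b. x < fst p}))"
    proof (rule lis_insert_first)
      show "finite (fst ` ?S a b)"
        using finite_fst_pts[of fst f a b] by (simp add: image_image)
      fix p assume "p \<in> ?S a b"
      then obtain t r c where "p = (t, r + 1)" "(r, c) \<in> f t" "(r, c) \<notin> f (t - 1)" by (auto elim!: ptsE)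
      then show "1 < snd p" using pos by force
    qed
    moreover have "{p \<in> ?S a b. x < fst p} = ?S x b"
      using True unfolding pts_def by auto
    ultimately have "lis (pts snd (star k x f) a b) = max (lis (pts snd f a b)) (Suc (lis (pts snd f a (x - 1))))"
      "lis (pts fst (star k x f) a b) = max (lis (pts fst f a b)) (Suc (lis (pts fst f x b)))"
      using True by (simp_all only: snd_pts fst_pts S if_True simp_thms)
    then show ?thesis
      using True unfolding append_letter_def prof_def by (simp only: if_True simp_thms fst_conv snd_conv)
  qed
qed

lemma star_shape:
  assumes la: "shape la" and wide: "\<And>r c. (r, c) \<in> la \<Longrightarrow> 1 \<le> r \<Longrightarrow> c \<le> int k"
  shows "shape (star_shape k la)"
  unfolding shape_def
proof (intro conjI)
  have base: "base \<subseteq> la" "down la" "finite (la - base)" using la by (auto simp: shape_def)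
  show "base \<subseteq> star_shape k la"
    using base(1) unfolding base_def star_shape_def by fastforce
  show "down (star_shape k la)"
    unfolding down_def
  proof (intro allI impI)
    fix r c assume "(r, c) \<in> star_shape k la"
    then show "(r - 1, c) \<in> star_shape k la \<and> (r, c - 1) \<in> star_shape k la"
      using down_le[OF base(2), of "r - 1" c "r - 2" c] down_le[OF base(2), of "r - 1" c "r - 1" "c - 1"]
        wide[of "r - 1" c] unfolding star_shape_def by (cases "r = 2") auto
  qed
  have "star_shape k la - base \<subseteq> {1} \<times> {1..int k + 1} \<union> (\<lambda>(r, c). (r + 1, c)) ` (la - base)"
  proof
    fix x assume x: "x \<in> star_shape k la - base"
    obtain r c where rc: "x = (r, c)" by fastforce
    show "x \<in> {1} \<times> {1..int k + 1} \<union> (\<lambda>(r, c). (r + 1, c)) ` (la - base)"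
    proof (cases "r = 1")
      case False
      then have "(r - 1, c) \<in> la - base" using x unfolding rc star_shape_def base_def by auto
      then have "x \<in> (\<lambda>(r, c). (r + 1, c)) ` (la - base)"
        unfolding rc by (intro image_eqI[of _ _ "(r - 1, c)"]) auto
      then show ?thesis by blast
    qed (use x in \<open>auto simp: rc star_shape_def base_def\<close>)
  qed
  then show "finite (star_shape k la - base)"
    by (rule finite_subset) (use base(3) in simp)
qed

text \<open>The letter \<open>x\<close> is recovered as the moment at which the corner
  \<open>(1, k + 1)\<close> enters the shape.\<close>

lemma bij_star:
  assumes la: "shape la" and wide: "\<And>r c. (r, c) \<in> la \<Longrightarrow> 1 \<le> r \<Longrightarrow> c \<le> int k"
  shows "bij_betw (\<lambda>(x, f). star k x f) ({1..m} \<times> tableaux m la)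
    {g. tab m g \<and> g 0 = row k k \<and> g m = star_shape k la}"
proof (rule bij_betw_byWitness[where f' = "\<lambda>g. (LEAST t. (1, int k + 1) \<in> g t,
      \<lambda>t. {(r, c). r \<le> 0 \<or> (r + 1, c) \<in> g t})"])
  let ?\<psi> = "\<lambda>g. (LEAST t. (1, int k + 1) \<in> g t, \<lambda>t. {(r, c). r \<le> 0 \<or> (r + 1, c) \<in> g t})"
  let ?G = "{g. tab m g \<and> g 0 = row k k \<and> g m = star_shape k la}"
  show "\<forall>p\<in>{1..m} \<times> tableaux m la. ?\<psi> (case p of (x, f) \<Rightarrow> star k x f) = p"
  proof
    fix p assume "p \<in> {1..m} \<times> tableaux m la"
    then obtain x f where p: "p = (x, f)" "tab m f" "f 0 = base" "f m = la" by (auto simp: tableaux_def)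
    have "(1, int k + 1) \<in> star k x f t \<longleftrightarrow> x \<le> t" for t by (simp add: star_def)
    then have "(LEAST t. (1, int k + 1) \<in> star k x f t) = x" by (auto intro: Least_equality)
    moreover have "{(r, c). r \<le> 0 \<or> (r + 1, c) \<in> star k x f t} = f t" for t
    proof -
      have "base \<subseteq> f t" using tab_mono[OF p(2), of 0 t] p by simp
      then show ?thesis unfolding star_def base_def by auto
    qed
    ultimately show "?\<psi> (case p of (x, f) \<Rightarrow> star k x f) = p" using p(1) by simp
  qed
  have G: "star k x f = g \<and> (x, f) \<in> {1..m} \<times> tableaux m la" if g: "g \<in> ?G" and xf: "(x, f) = ?\<psi> g" for g x f
  proof -
    have t: "tab m g" "g 0 = row k k" "g m = star_shape k la" using g by auto
    have x: "x = (LEAST t. (1, int k + 1) \<in> g t)" and f: "f = (\<lambda>t. {(r, c). r \<le> 0 \<or> (r + 1, c) \<in> g t})"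
      using xf by auto
    have bounds: "row k k \<subseteq> g t" "g t \<subseteq> star_shape k la" for t
      using tab_mono[OF t(1), of 0 t] tab_le[OF t(1), of t] t by auto
    have "(1, int k + 1) \<in> g m" using t by (simp add: star_shape_def)
    then have xm: "(1, int k + 1) \<in> g x" "x \<le> m" unfolding x by (auto intro: LeastI Least_le)
    have "(1, int k + 1) \<notin> g 0" using t by (simp add: row_def)
    then have "x \<noteq> 0" using xm by metis
    have corner: "(1, int k + 1) \<in> g t \<longleftrightarrow> x \<le> t" for t
      using tab_mono[OF t(1), of x t] xm(1) Least_le[of "\<lambda>t. (1, int k + 1) \<in> g t" t] unfolding x by blast
    have "star k x f = g"
    proof (intro ext set_eqI)
      fix t and y :: cell
      obtain r c where y: "y = (r, c)" by fastforce
      consider "r \<le> 0" | "r = 1" | "2 \<le> r" by linarith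
      then show "y \<in> star k x f t \<longleftrightarrow> y \<in> g t"
      proof cases
        case 1
        then show ?thesis using bounds(1)[of t] unfolding y star_def row_def by auto
      next
        case 2
        have "(1, c) \<in> g t \<longleftrightarrow> c \<le> int k + (if x \<le> t then 1 else 0)"
        proof (cases "c \<le> int k")
          case True
          then have "(1, c) \<in> row k k" by (simp add: row_def)
          then show ?thesis using True bounds(1)[of t] by auto
        next
          case False
          then show ?thesis
            using corner[of t] bounds(2)[of t] unfolding star_shape_def by (cases "c = int k + 1") auto
        qed
        then show ?thesis using 2 unfolding y star_def by simp
      next
        case 3
        then show ?thesis unfolding y star_def f by auto
      qed
    qed
    moreover have "f \<in> tableaux m la"
    proof -
      have "rook (f t) (f (Suc t))" for t
      proof -
        have r: "rook (g t) (g (Suc t))" by (rule tab_rook[OF t(1)])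
        have "down (f t)" for t
        proof -
          have "down (g t)" using tab_rook[OF t(1)] rook_down by blast
          then have "(r + 1, c) \<in> g t \<Longrightarrow> (r, c) \<in> g t \<and> (r + 1, c - 1) \<in> g t" for r c
            by (auto elim!: down_le)
          then show ?thesis unfolding down_def f by auto
        qed
        moreover have "f t \<subseteq> f (Suc t)" using rook_sub[OF r] unfolding f by auto
        moreover have "(r + 1, c) \<notin> f (Suc t) \<and> (r, c + 1) \<notin> f (Suc t)"
          if "(r, c) \<in> f (Suc t) - f t" for r c
          using rookD[OF r, of "r + 1" c] that unfolding f by auto
        ultimately show ?thesis unfolding rook_def by blast
      qed
      moreover have "f t = f m" if "m \<le> t" for t using tab_stable[OF t(1) that] unfolding f by simp
      moreover have "f 0 = base" unfolding f t(2) row_def base_def by auto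
      moreover have "f m = la"
        using la unfolding f t(3) star_shape_def shape_def base_def by auto
      ultimately show ?thesis unfolding tableaux_def tab_def by blast
    qed
    ultimately show ?thesis using xm \<open>x \<noteq> 0\<close> by simp
  qed
  show "\<forall>g\<in>?G. (case ?\<psi> g of (x, f) \<Rightarrow> star k x f) = g" using G by auto
  show "?\<psi> ` ?G \<subseteq> {1..m} \<times> tableaux m la"
  proof (rule image_subsetI)
    fix g assume "g \<in> ?G"
    from G[OF this refl] show "?\<psi> g \<in> {1..m} \<times> tableaux m la" by blast
  qed
  show "(\<lambda>(x, f). star k x f) ` ({1..m} \<times> tableaux m la) \<subseteq> ?G"
  proof (rule image_subsetI)
    fix p assume "p \<in> {1..m} \<times> tableaux m la"
    then obtain x f where p: "p = (x, f)" "1 \<le> x" "x \<le> m" "tab m f" "f 0 = base" "f m = la"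
      by (auto simp: tableaux_def)
    have bounds: "base \<subseteq> f t" "f t \<subseteq> la" for t
      using tab_mono[OF p(4), of 0 t] tab_le[OF p(4), of t] p by auto
    have nw: "(1, c) \<notin> f t" if "int k < c" for t c using wide[of 1 c] bounds(2)[of t] that by auto
    have "rook (star k x f t) (star k x f (Suc t))" for t
    proof -
      have r: "rook (f t) (f (Suc t))" by (rule tab_rook[OF p(4)])
      have "down (star k x f t)" for t
      proof -
        have d: "down (f t)" using tab_rook[OF p(4)] rook_down by blast
        show ?thesis
          unfolding down_def
        proof (intro allI impI)
          fix r c assume *: "(r, c) \<in> star k x f t"
          consider "r \<le> 1" | "r = 2" | "3 \<le> r" by linarith
          then show "(r - 1, c) \<in> star k x f t \<and> (r, c - 1) \<in> star k x f t"
          proof cases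
            case 2
            then have "(1, c) \<in> f t" using * by (simp add: star_def)
            then have "c \<le> int k" "(1, c - 1) \<in> f t" using nw[of c t] d unfolding down_def by (meson not_le)+
            then show ?thesis using 2 by (simp add: star_def)
          next
            case 3
            then show ?thesis
              using * down_le[OF d, of "r - 1" c "r - 2" c] down_le[OF d, of "r - 1" c "r - 1" "c - 1"]
              unfolding star_def by auto
          qed (use * in \<open>auto simp: star_def\<close>)
        qed
      qed
      moreover have "star k x f t \<subseteq> star k x f (Suc t)"
        using rook_sub[OF r] unfolding star_def by auto
      moreover have "(r + 1, c) \<notin> star k x f (Suc t) \<and> (r, c + 1) \<notin> star k x f (Suc t)"
        if y: "(r, c) \<in> star k x f (Suc t) - star k x f t" for r c
      proof (cases "2 \<le> r")
        case True
        then have "(r - 1, c) \<in> f (Suc t)" "(r - 1, c) \<notin> f t" using y unfolding star_def by auto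
        from rookD[OF r this] show ?thesis using True unfolding star_def by auto
      next
        case False
        then have "r = 1" "c = int k + 1" using y unfolding star_def by (auto split: if_splits)
        then show ?thesis using nw[of c "Suc t"] unfolding star_def by auto
      qed
      ultimately show ?thesis unfolding rook_def by blast
    qed
    moreover have "star k x f t = star k x f m" if "m \<le> t" for t
      using tab_stable[OF p(4) that] p(3) that unfolding star_def by simp
    moreover have "star k x f 0 = row k k"
      using p(2,5) unfolding star_def row_def base_def by auto
    moreover have "star k x f m = star_shape k la"
      using p(3,6) unfolding star_def star_shape_def by auto
    ultimately show "(case p of (x, f) \<Rightarrow> star k x f) \<in> ?G"
      using p(1) unfolding tab_def by simp
  qed
qed

lemma bij_betw_filter:
  assumes "bij_betw \<phi> A B" "\<And>x. x \<in> A \<Longrightarrow> Q (\<phi> x) \<longleftrightarrow> P x"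
  shows "bij_betw \<phi> {x \<in> A. P x} {y \<in> B. Q y}"
  using assms unfolding bij_betw_def by (auto intro: inj_on_subset)

text \<open>Infusion turns \<open>row k\<close> and a star tableau into a straight tableau and a
  recording tableau \<open>q\<close>. That the first partner was \<open>row k\<close> becomes
  \<open>row_like k (prof q)\<close>, a condition on \<open>q\<close> alone. Hence each admissible
  \<open>q\<close> occurs with all tableaux of shape \<open>q 0\<close>, which is a complete family
  \<open>profiles m (q 0)\<close>.\<close>

lemma profiles_append:
  assumes la: "shape la"
  obtains Q :: "(nat \<Rightarrow> cell set) set" where "finite Q" "\<And>q. q \<in> Q \<Longrightarrow> shape (q 0)"
    "(\<Sum>x\<in>{1..m}. image_mset (append_letter x) (profiles m la)) = (\<Sum>q\<in>Q. profiles m (q 0))"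
proof -
  have "finite (snd ` (la - base))" using la by (simp add: shape_def)
  then obtain N where N: "\<And>c. c \<in> snd ` (la - base) \<Longrightarrow> c \<le> N"
    using bdd_above_finite[of "snd ` (la - base)"] unfolding bdd_above_def by auto
  define k where "k = nat N"
  have wide: "c \<le> int k" if "(r, c) \<in> la" "1 \<le> r" for r c
  proof (cases "c \<le> 0")
    case False
    then have "(r, c) \<in> la - base" using that by (simp add: base_def)
    then have "c \<le> N" using N[of c] by force
    then show ?thesis by (simp add: k_def)
  qed (simp add: k_def)
  let ?ls = "star_shape k la"
  have ls: "shape ?ls" by (rule star_shape[OF la wide])
  define Q where "Q = {f. tab k f \<and> base \<subseteq> f 0 \<and> f k = ?ls \<and> row_like k (prof f)}"
  have fin: "finite Q"
    by (rule finite_subset[OF _ finite_tabs[of ?ls base k]]) (use ls in \<open>auto simp: Q_def shape_def\<close>)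
  have sh: "shape (q 0)" if "q \<in> Q" for q
  proof -
    have t: "tab k q" "base \<subseteq> q 0" "q k = ?ls" using that by (auto simp: Q_def)
    have "q 0 - base \<subseteq> ?ls - base" using tab_le[OF t(1), of 0] t by auto
    then have "finite (q 0 - base)" by (rule finite_subset) (use ls in \<open>simp add: shape_def\<close>)
    then show ?thesis using t tab_rook[OF t(1), of 0] unfolding shape_def by (auto dest: rook_down)
  qed
  let ?G = "{g. tab m g \<and> g 0 = row k k \<and> g m = ?ls}"
  let ?P = "{p \<in> pairs k m base ?ls. row_like k (prof (fst p))}"
  let ?P' = "{p \<in> pairs m k base ?ls. row_like k (prof (snd p))}"
  obtain \<phi> where \<phi>: "bij_betw \<phi> (pairs k m base ?ls) (pairs m k base ?ls)"
    "\<And>p. p \<in> pairs k m base ?ls \<Longrightarrow> prof (fst (\<phi> p)) = prof (snd p) \<and> prof (snd (\<phi> p)) = prof (fst p)"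
    using infusion by blast
  have row: "tab k (row k)" "row k 0 = base"
    using row_tableau[of k] by (auto simp: tableaux_def)
  have P_row: "fst p = row k" if "p \<in> ?P" for p
  proof -
    obtain f g where p: "p = (f, g)" "tab k f" "tab m g" "f 0 = base" "f k = g 0" "g m = ?ls"
      using \<open>p \<in> ?P\<close> by (auto simp: pairs_def)
    have "f k - base \<subseteq> ?ls - base" using tab_le[OF p(3), of 0] p by auto
    then have "finite (f k - base)" by (rule finite_subset) (use ls in \<open>simp add: shape_def\<close>)
    then have "shape (f k)"
      using p tab_rook[OF p(2), of k] tab_le[OF p(2), of 0] unfolding shape_def by (auto dest: rook_down)
    moreover have "f \<in> tableaux k (f k)" using p by (simp add: tableaux_def)
    ultimately show ?thesis using row_like_unique that p(1) by auto
  qed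
  have 1: "bij_betw snd ?P ?G"
  proof (rule bij_betw_byWitness[where f' = "\<lambda>g. (row k, g)"])
    show "\<forall>p\<in>?P. (row k, snd p) = p"
    proof
      fix p assume "p \<in> ?P"
      from P_row[OF this] show "(row k, snd p) = p" by (simp add: prod_eq_iff)
    qed
    show "snd ` ?P \<subseteq> ?G"
    proof (rule image_subsetI)
      fix p assume p: "p \<in> ?P"
      obtain f g where e: "p = (f, g)" by fastforce
      have "f = row k" using P_row[OF p] e by simp
      then show "snd p \<in> ?G" using p e by (simp add: pairs_def)
    qed
    show "(\<lambda>g. (row k, g)) ` ?G \<subseteq> ?P" using row row_row_like[of k] by (auto simp: pairs_def)
  qed simp
  have 2: "bij_betw \<phi> ?P ?P'"
    using \<phi> by (intro bij_betw_filter) auto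
  have 3: "bij_betw (\<lambda>p. (snd p, fst p)) ?P' (SIGMA q:Q. tableaux m (q 0))"
  proof (rule bij_betw_byWitness[where f' = "\<lambda>p. (snd p, fst p)"])
    show "(\<lambda>p. (snd p, fst p)) ` ?P' \<subseteq> (SIGMA q:Q. tableaux m (q 0))"
    proof (rule image_subsetI)
      fix p assume "p \<in> ?P'"
      then obtain f g where p: "p = (f, g)" "tab m f" "tab k g" "f 0 = base" "f m = g 0" "g k = ?ls"
        "row_like k (prof g)" by (auto simp: pairs_def)
      then show "(snd p, fst p) \<in> (SIGMA q:Q. tableaux m (q 0))"
        using tab_le[OF p(2), of 0] by (auto simp: Q_def tableaux_def)
    qed
  qed (auto simp: Q_def tableaux_def pairs_def)
  have "(\<Sum>x\<in>{1..m}. image_mset (append_letter x) (profiles m la)) =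
      (\<Sum>x\<in>{1..m}. \<Sum>f\<in>tableaux m la. {#append_letter x (prof f)#})"
    unfolding profiles_def by (simp add: image_mset_sum)
  also have "\<dots> = (\<Sum>(x, f)\<in>{1..m} \<times> tableaux m la. {#append_letter x (prof f)#})"
    by (rule sum.cartesian_product)
  also have "\<dots> = (\<Sum>p\<in>{1..m} \<times> tableaux m la. {#prof (case p of (x, f) \<Rightarrow> star k x f)#})"
    using prof_star[OF _ _ _ wide] by (intro sum.cong refl) (auto simp: tableaux_def)
  also have "\<dots> = (\<Sum>g\<in>?G. {#prof g#})"
    by (rule sum.reindex_bij_betw[OF bij_star[OF la wide]])
  also have "\<dots> = (\<Sum>p\<in>?P. {#prof (snd p)#})"
    by (rule sum.reindex_bij_betw[OF 1, symmetric])
  also have "\<dots> = (\<Sum>p\<in>?P. {#prof (fst (\<phi> p))#})"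
    using \<phi>(2) by (intro sum.cong) auto
  also have "\<dots> = (\<Sum>p\<in>?P'. {#prof (fst p)#})"
    by (rule sum.reindex_bij_betw[OF 2])
  also have "\<dots> = (\<Sum>p\<in>(SIGMA q:Q. tableaux m (q 0)). {#prof (snd p)#})"
    by (subst sum.reindex_bij_betw[OF 3, symmetric]) simp
  also have "\<dots> = (\<Sum>q\<in>Q. profiles m (q 0))"
    unfolding profiles_def using fin finite_tableaux[OF sh]
    by (subst sum.Sigma) (auto simp: case_prod_unfold)
  finally show thesis using that[OF fin] sh by blast
qed

section \<open>Profiles of words\<close>

text \<open>The invariant of the column-by-column count: sums of complete families. It is preserved
  by deleting extreme letters, appending a letter in all ways and imposing bounds.\<close>

inductive_set span :: "nat \<Rightarrow> profile multiset set" for m where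
  zero: "{#} \<in> span m"
| add: "W \<in> span m \<Longrightarrow> shape la \<Longrightarrow> W + profiles m la \<in> span m"

lemma span_plus: "V \<in> span m \<Longrightarrow> W \<in> span m \<Longrightarrow> V + W \<in> span m"
proof (induction rule: span.induct)
  case (add V la)
  have "V + profiles m la + W = (V + W) + profiles m la" by (simp add: ac_simps)
  then show ?case using span.add[OF add.IH[OF add.prems] add.hyps(2)] by (simp only:)
qed simp

lemma span_profiles: "shape la \<Longrightarrow> profiles m la \<in> span m"
  using span.add[OF span.zero] by simp

lemma span_sum: "(\<And>x. x \<in> A \<Longrightarrow> F x \<in> span m) \<Longrightarrow> (\<Sum>x\<in>A. F x) \<in> span m"
  by (induction A rule: infinite_finite_induct) (auto intro: span_plus span.zero)

lemma span_restr_Suc: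
  "W \<in> span (Suc m) \<Longrightarrow>
    image_mset (restr 0 m) W \<in> span m \<and> image_mset (restr 1 m) W = image_mset (restr 0 m) W"
proof (induction rule: span.induct)
  case (add W la)
  have "image_mset (restr 0 m) (profiles (Suc m) la) \<in> span m"
    unfolding restr_top[OF add(2)] by (intro span_sum span_profiles inner_shape[OF add(2)])
  moreover have "image_mset (restr 1 m) (profiles (Suc m) la) = image_mset (restr 0 m) (profiles (Suc m) la)"
    unfolding restr_top[OF add(2)] by (rule restr_bot[OF add(2)])
  ultimately show ?case using add.IH by (simp only: image_mset_union span_plus simp_thms)
qed (simp add: span.zero)

lemma span_restr_id: "W \<in> span m \<Longrightarrow> image_mset (restr 0 m) W = W"
proof (induction rule: span.induct)
  case (add W la)
  have "restr 0 m (prof f) = prof f" if "f \<in> tableaux m la" for f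
    using that prof_min[of m f] unfolding restr_def tableaux_def by (intro ext) auto
  then have "image_mset (restr 0 m) (profiles m la) = profiles m la"
    unfolding profiles_def image_mset_sum by (intro sum.cong) auto
  then show ?case using add by simp
qed simp

text \<open>By \<open>span_restr_Suc\<close> each letter deleted at the bottom may be deleted at the
  top instead. Iterated, this makes the result depend only on the size of the remaining
  window.\<close>

lemma span_restr:
  assumes "W \<in> span m" "m' + d \<le> m"
  shows "image_mset (restr 0 m') W \<in> span m' \<and> image_mset (restr d m') W = image_mset (restr 0 m') W"
  using assms
proof (induction m arbitrary: W d)
  case 0
  then show ?case using span_restr_id by auto
next
  case (Suc n)
  show ?case
  proof (cases "m' = Suc n")
    case True
    then show ?thesis using Suc span_restr_id[OF Suc.prems(1)] by simp
  next
    case False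
    note s = span_restr_Suc[OF Suc.prems(1)]
    have 0: "restr 0 m' p = restr 0 m' (restr 0 n p)" for p
      using False Suc.prems(2) unfolding restr_def by (intro ext) (simp add: min_def)
    have im0: "image_mset (restr 0 m') W = image_mset (restr 0 m') (image_mset (restr 0 n) W)"
      by (simp add: multiset.map_comp comp_def flip: 0)
    have 1: "image_mset (restr 0 m') W \<in> span m'"
      unfolding im0 using Suc.IH[of "image_mset (restr 0 n) W" 0] s False Suc.prems(2) by simp
    moreover have "image_mset (restr d m') W = image_mset (restr 0 m') W"
    proof (cases d)
      case (Suc e)
      have "restr d m' = restr e m' \<circ> restr 1 n"
        using Suc.prems(2) Suc by (intro ext) (simp add: restr_def min_def)
      then have "image_mset (restr d m') W = image_mset (restr e m') (image_mset (restr 1 n) W)"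
        by (simp only: multiset.map_comp)
      also have "\<dots> = image_mset (restr e m') (image_mset (restr 0 n) W)" using s by simp
      also have "\<dots> = image_mset (restr 0 m') (image_mset (restr 0 n) W)"
        using Suc.IH[of "image_mset (restr 0 n) W" e] s Suc.prems(2) Suc by simp
      finally show ?thesis by (simp only: im0)
    qed simp
    ultimately show ?thesis by simp
  qed
qed

lemma span_append: "W \<in> span m \<Longrightarrow> (\<Sum>x\<in>{1..m}. image_mset (append_letter x) W) \<in> span m"
proof (induction rule: span.induct)
  case (add W la)
  have "(\<Sum>x\<in>{1..m}. image_mset (append_letter x) (profiles m la)) \<in> span m"
  proof (rule profiles_append[OF add(2), where m = m])
    fix Q assume "\<And>q. q \<in> Q \<Longrightarrow> shape (q 0)"
      "(\<Sum>x\<in>{1..m}. image_mset (append_letter x) (profiles m la)) = (\<Sum>q\<in>Q. profiles m (q 0))"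
    then show ?thesis by (simp add: span_sum span_profiles)
  qed
  then show ?case using add by (simp add: sum.distrib span_plus)
qed (simp add: span.zero)

definition bounded_by :: "nat \<Rightarrow> nat \<Rightarrow> nat \<Rightarrow> profile \<Rightarrow> bool" where
  "bounded_by u v m p \<longleftrightarrow> fst (p 0 m) \<le> u \<and> snd (p 0 m) \<le> v"

lemma filter_mset_sum: "filter_mset P (\<Sum>x\<in>A. F x) = (\<Sum>x\<in>A. filter_mset P (F x))"
  by (induction A rule: infinite_finite_induct) auto

lemma span_filter: "W \<in> span m \<Longrightarrow> filter_mset (bounded_by u v m) W \<in> span m"
proof (induction rule: span.induct)
  case (add W la)
  let ?b = "card (snd ` (la - base)) \<le> u \<and> card (fst ` (la - base)) \<le> v"
  have "bounded_by u v m (prof f) \<longleftrightarrow> ?b" if "f \<in> tableaux m la" for f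
    using total_columns[OF that add(2)] total_rows[OF that add(2)] by (simp add: bounded_by_def prof_def)
  then have "filter_mset (bounded_by u v m) (profiles m la) = (if ?b then profiles m la else {#})"
    unfolding profiles_def filter_mset_sum by (auto intro!: sum.cong sum.neutral)
  then show ?case using add by (simp add: span_plus span_profiles)
qed (simp add: span.zero)

definition zero_profile :: profile where
  "zero_profile a b = (0, 0)"

text \<open>The empty word corresponds to the empty shape, which has exactly one tableau.\<close>

lemma span_zero_profile: "{#zero_profile#} \<in> span m"
proof -
  have "down base" by (auto simp: down_def base_def)
  then have "shape base" by (simp add: shape_def)
  have "tableaux m base = {\<lambda>t. base}"
  proof (intro subset_antisym subsetI)
    fix f assume "f \<in> tableaux m base"
    then have "f t = base" for t
      using tab_le[of m f t] tab_mono[of m f 0 t] unfolding tableaux_def by auto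
    then show "f \<in> {\<lambda>t. base}" by auto
  qed (auto simp: tableaux_def tab_def rook_refl \<open>down base\<close>)
  moreover have "prof (\<lambda>t. base) = zero_profile"
    unfolding prof_def zero_profile_def pts_def by (intro ext) simp
  ultimately have "profiles m base = {#zero_profile#}" unfolding profiles_def by simp
  then show ?thesis using span_profiles[OF \<open>shape base\<close>, of m] by simp
qed

text \<open>The profiles of the words whose \<open>i\<close>-th letter is blank or one of \<open>1, \<dots>, sz i\<close>, with \<open>n\<close> letters that are
  not blank and bounded chains. The rows that disappear are always taken from the top; the fillings
  of a stack agree with this by \<open>span_restr\<close>.\<close>

fun word_profiles :: "nat \<Rightarrow> nat \<Rightarrow> (nat \<Rightarrow> nat) \<Rightarrow> nat \<Rightarrow> nat \<Rightarrow> profile multiset" where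
  "word_profiles u v sz 0 n = (if n = 0 then {#zero_profile#} else {#})"
| "word_profiles u v sz (Suc k) n = filter_mset (bounded_by u v (sz k))
     (image_mset (restr 0 (sz k)) (word_profiles u v sz k n) +
      (case n of 0 \<Rightarrow> {#} | Suc n' \<Rightarrow>
        (\<Sum>x\<in>{1..sz k}. image_mset (append_letter x) (image_mset (restr 0 (sz k)) (word_profiles u v sz k n')))))"

lemma span_step:
  assumes "\<And>n. V n \<in> span m"
  shows "filter_mset (bounded_by u v m) (V n +
    (case n of 0 \<Rightarrow> {#} | Suc n' \<Rightarrow> (\<Sum>x\<in>{1..m}. image_mset (append_letter x) (V n')))) \<in> span m"
  using span_append[OF assms] assms by (auto intro!: span_filter span_plus span.zero split: nat.split)

lemma word_profiles_span:
  assumes "\<And>i. Suc i < Suc k \<Longrightarrow> sz (Suc i) \<le> sz i"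
  shows "image_mset (restr 0 (sz k)) (word_profiles u v sz k n) \<in> span (sz k)
    \<and> word_profiles u v sz (Suc k) n \<in> span (sz k)"
  using assms
proof (induction k arbitrary: n)
  case 0
  have "restr 0 (sz 0) zero_profile = zero_profile" by (intro ext) (simp add: restr_def zero_profile_def)
  then have *: "image_mset (restr 0 (sz 0)) (word_profiles u v sz 0 n) \<in> span (sz 0)" for n
    by (simp add: span_zero_profile span.zero)
  show ?case using * span_step[OF *] by (simp only: word_profiles.simps(2) simp_thms)
next
  case (Suc k)
  have *: "image_mset (restr 0 (sz (Suc k))) (word_profiles u v sz (Suc k) n) \<in> span (sz (Suc k))" for n
    using span_restr[of "word_profiles u v sz (Suc k) n" "sz k" "sz (Suc k)" 0] Suc by simp
  show ?case using * span_step[OF *] by (simp only: word_profiles.simps(2)[of u v sz "Suc k"] simp_thms)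
qed

text \<open>As in \<open>pts\<close>, the letter precedes the position; the negated position turns
  decreasing sequences into increasing point sets. The cap \<open>min b m\<close> imitates tableaux,
  which have no letters beyond \<open>m\<close>.\<close>

definition word_profile :: "int \<Rightarrow> nat \<Rightarrow> (int \<times> int) set \<Rightarrow> profile" where
  "word_profile lo m A a b =
     (lis {(j, i) |i j. (i, j) \<in> A \<and> lo + int a < j \<and> j \<le> lo + int (min b m)},
      lis {(j, - i) |i j. (i, j) \<in> A \<and> lo + int a < j \<and> j \<le> lo + int (min b m)})"

lemma word_profile_restr:
  assumes "lo \<le> lo'" "lo' + int m' \<le> lo + int m"
  shows "word_profile lo' m' A = restr (nat (lo' - lo)) m' (word_profile lo m A)"
proof (intro ext)
  fix a b
  have "lo + int (a + nat (lo' - lo)) = lo' + int a"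
    "lo + int (min (min b m' + nat (lo' - lo)) m) = lo' + int (min b m')"
    using assms by auto
  then show "word_profile lo' m' A a b = restr (nat (lo' - lo)) m' (word_profile lo m A) a b"
    unfolding restr_def word_profile_def by (simp only:)
qed

lemma word_profile_append:
  assumes fin: "finite A" and old: "\<And>i' j. (i', j) \<in> A \<Longrightarrow> i' < i" and x: "1 \<le> x" "x \<le> m"
  shows "word_profile lo m (insert (i, lo + int x) A) = append_letter x (word_profile lo m A)"
proof (intro ext)
  fix a b
  let ?R = "\<lambda>a b j. lo + int a < j \<and> j \<le> lo + int (min b m)"
  let ?L = "\<lambda>A a b. {(j, i) |i j. (i, j) \<in> A \<and> ?R a b j}"
  let ?D = "\<lambda>A a b. {(j, - i) |i j. (i, j) \<in> A \<and> ?R a b j}"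
  let ?B = "insert (i, lo + int x) A"
  show "word_profile lo m ?B a b = append_letter x (word_profile lo m A) a b"
  proof (cases "a < x \<and> x \<le> b")
    case False
    then have "?L ?B a b = ?L A a b" "?D ?B a b = ?D A a b" using x by auto
    then show ?thesis using False unfolding append_letter_def word_profile_def by (simp only: if_False)
  next
    case True
    have fL: "finite (?L A a b)" by (rule finite_subset[of _ "prod.swap ` A"]) (use fin in force)+
    have fD: "finite (?D A a b)"
      by (rule finite_subset[of _ "(\<lambda>(i, j). (j, - i)) ` A"]) (use fin in force)+
    have "?L ?B a b = insert (lo + int x, i) (?L A a b)" "?D ?B a b = insert (lo + int x, - i) (?D A a b)"
      using True x by auto
    moreover have "lis (insert (lo + int x, i) (?L A a b)) =
        max (lis (?L A a b)) (Suc (lis {p \<in> ?L A a b. fst p < lo + int x}))"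
      using fL old by (intro lis_insert_last) auto
    moreover have "lis (insert (lo + int x, - i) (?D A a b)) =
        max (lis (?D A a b)) (Suc (lis {p \<in> ?D A a b. lo + int x < fst p}))"
      using fD old by (intro lis_insert_first) auto
    moreover have "{p \<in> ?L A a b. fst p < lo + int x} = ?L A a (x - 1)"
      using True x by (auto simp: of_nat_diff)
    moreover have "{p \<in> ?D A a b. lo + int x < fst p} = ?D A x b"
      using True x by auto
    ultimately show ?thesis
      using True unfolding append_letter_def word_profile_def by (simp only: if_True simp_thms fst_conv snd_conv)
  qed
qed

section \<open>Fillings of stacks\<close>

text \<open>The windows are open below, so that the letter \<open>x\<close> from \<open>1\<close> to
  \<open>sz i\<close> of column \<open>i\<close> stands for the row \<open>lo i + x\<close>.\<close>

definition region :: "int \<Rightarrow> (nat \<Rightarrow> int) \<Rightarrow> (nat \<Rightarrow> nat) \<Rightarrow> nat \<Rightarrow> (int \<times> int) set" where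
  "region c0 lo sz k = {(c0 + int i, j) |i j. i < k \<and> lo i < j \<and> j \<le> lo i + int (sz i)}"

definition nested :: "(nat \<Rightarrow> int) \<Rightarrow> (nat \<Rightarrow> nat) \<Rightarrow> nat \<Rightarrow> bool" where
  "nested lo sz k \<longleftrightarrow> (\<forall>i. Suc i < k \<longrightarrow> lo i \<le> lo (Suc i) \<and> lo (Suc i) + int (sz (Suc i)) \<le> lo i + int (sz i))"

text \<open>Words are represented by their sets of 1-boxes. Each bound is imposed in the window of
  the column just read, which gives the recursion the form of \<open>word_profiles\<close>.\<close>

fun words :: "nat \<Rightarrow> nat \<Rightarrow> int \<Rightarrow> (nat \<Rightarrow> int) \<Rightarrow> (nat \<Rightarrow> nat) \<Rightarrow> nat \<Rightarrow> nat \<Rightarrow> (int \<times> int) set set" where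
  "words u v c0 lo sz 0 n = (if n = 0 then {{}} else {})"
| "words u v c0 lo sz (Suc k) n =
    {B \<in> words u v c0 lo sz k n \<union> (case n of 0 \<Rightarrow> {} | Suc n' \<Rightarrow>
        (\<lambda>(x, A). insert (c0 + int k, lo k + int x) A) ` ({1..sz k} \<times> words u v c0 lo sz k n')).
      bounded_by u v (sz k) (word_profile (lo k) (sz k) B)}"

lemma finite_words: "finite (words u v c0 lo sz k n)"
  by (induction k arbitrary: n) (auto split: nat.split)

lemma words_old: "A \<in> words u v c0 lo sz k n \<Longrightarrow> finite A \<and> (\<forall>(i, j)\<in>A. i < c0 + int k)"
  by (induction k arbitrary: n A) (fastforce split: nat.splits if_splits)+

lemma filter_sum_singletons:
  assumes "finite S"
  shows "filter_mset P (\<Sum>x\<in>S. {#g x#}) = (\<Sum>x\<in>{x \<in> S. P (g x)}. {#g x#})"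
  unfolding filter_mset_sum sum.inter_filter[OF assms] by (intro sum.cong) auto

text \<open>\<open>V\<close> is already taken relative to the window of column \<open>k\<close>; how
  this window arose from the previous one is left to the caller.\<close>

lemma words_Suc_sum:
  assumes V: "\<And>n. (\<Sum>A\<in>words u v c0 lo sz k n. {#word_profile (lo k) (sz k) A#}) = V n"
  shows "(\<Sum>B\<in>words u v c0 lo sz (Suc k) n. {#word_profile (lo k) (sz k) B#}) =
    filter_mset (bounded_by u v (sz k)) (V n +
      (case n of 0 \<Rightarrow> {#} | Suc n' \<Rightarrow> (\<Sum>x\<in>{1..sz k}. image_mset (append_letter x) (V n'))))"
proof -
  let ?p = "word_profile (lo k) (sz k)" and ?W = "words u v c0 lo sz k"
  let ?ins = "\<lambda>(x, A). insert (c0 + int k, lo k + int x) A"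
  define N where "N = (case n of 0 \<Rightarrow> {} | Suc n' \<Rightarrow> ?ins ` ({1..sz k} \<times> ?W n'))"
  have fin: "finite (?W n)" "finite N" using finite_words by (auto simp: N_def split: nat.split)
  have disj: "?W n \<inter> N = {}"
  proof -
    have "B \<notin> ?W n" if "B \<in> N" for B
    proof
      assume B: "B \<in> ?W n"
      from that obtain j where "(c0 + int k, j) \<in> B" unfolding N_def by (auto split: nat.splits)
      with words_old[OF B] show False by auto
    qed
    then show ?thesis by blast
  qed
  \<comment> \<open>The words in \<open>?W n'\<close> have no box in column
    \<open>c0 + int k\<close>, so the added letter can be read off.\<close>
  have inj: "inj_on ?ins ({1..sz k} \<times> ?W n')" for n'
  proof (rule inj_onI)
    fix p q assume p: "p \<in> {1..sz k} \<times> ?W n'" and q: "q \<in> {1..sz k} \<times> ?W n'" and eq: "?ins p = ?ins q"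
    obtain x A y B where e: "p = (x, A)" "q = (y, B)" by fastforce
    have A: "\<And>j. (c0 + int k, j) \<notin> A" "\<And>j. (c0 + int k, j) \<notin> B"
      using words_old[of A u v c0 lo sz k n'] words_old[of B u v c0 lo sz k n'] p q e by fastforce+
    have ins: "insert (c0 + int k, lo k + int x) A = insert (c0 + int k, lo k + int y) B"
      using eq e by simp
    then have "(c0 + int k, lo k + int x) \<in> insert (c0 + int k, lo k + int y) B" by blast
    then have "x = y" using A by auto
    moreover from this have "A = B" using ins A by (metis insert_ident)
    ultimately show "p = q" using e by simp
  qed
  have new: "(\<Sum>B\<in>N. {#?p B#}) = (case n of 0 \<Rightarrow> {#} | Suc n' \<Rightarrow> (\<Sum>x\<in>{1..sz k}. image_mset (append_letter x) (V n')))"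
  proof (cases n)
    case (Suc n')
    have "(\<Sum>B\<in>N. {#?p B#}) = (\<Sum>q\<in>{1..sz k} \<times> ?W n'. {#?p (?ins q)#})"
      unfolding N_def Suc nat.case by (rule sum.reindex_cong[OF inj]) auto
    also have "\<dots> = (\<Sum>(x, A)\<in>{1..sz k} \<times> ?W n'. {#append_letter x (?p A)#})"
    proof (intro sum.cong refl)
      fix q assume q: "q \<in> {1..sz k} \<times> ?W n'"
      then obtain x A where e: "q = (x, A)" "1 \<le> x" "x \<le> sz k" "A \<in> ?W n'" by auto
      have "?p (insert (c0 + int k, lo k + int x) A) = append_letter x (?p A)"
        using words_old[OF e(4)] e(2,3) by (intro word_profile_append) auto
      then show "{#?p (?ins q)#} = (case q of (x, A) \<Rightarrow> {#append_letter x (?p A)#})"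
        unfolding e(1) by simp
    qed
    also have "\<dots> = (\<Sum>x\<in>{1..sz k}. \<Sum>A\<in>?W n'. {#append_letter x (?p A)#})"
      by (rule sum.cartesian_product[symmetric])
    also have "\<dots> = (\<Sum>x\<in>{1..sz k}. image_mset (append_letter x) (V n'))"
      unfolding V[symmetric] image_mset_sum by simp
    finally show ?thesis using Suc by simp
  qed (simp add: N_def)
  have "words u v c0 lo sz (Suc k) n = {B \<in> ?W n \<union> N. bounded_by u v (sz k) (?p B)}"
    unfolding N_def by simp
  then have "(\<Sum>B\<in>words u v c0 lo sz (Suc k) n. {#?p B#}) =
      filter_mset (bounded_by u v (sz k)) (\<Sum>B\<in>?W n \<union> N. {#?p B#})"
    using fin by (simp only: filter_sum_singletons finite_Un)
  also have "(\<Sum>B\<in>?W n \<union> N. {#?p B#}) = V n + (\<Sum>B\<in>N. {#?p B#})"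
    unfolding V[symmetric] by (rule sum.union_disjoint[OF fin disj])
  finally show ?thesis unfolding new .
qed

lemma words_profiles:
  assumes "nested lo sz (Suc k)"
  shows "(\<Sum>B\<in>words u v c0 lo sz (Suc k) n. {#word_profile (lo k) (sz k) B#}) = word_profiles u v sz (Suc k) n"
  using assms
proof (induction k arbitrary: n)
  case 0
  have 1: "word_profile (lo 0) (sz 0) {} = zero_profile"
    by (intro ext) (simp add: word_profile_def zero_profile_def)
  have 2: "restr 0 (sz 0) zero_profile = zero_profile"
    by (intro ext) (simp add: restr_def zero_profile_def)
  have "(\<Sum>A\<in>words u v c0 lo sz 0 n. {#word_profile (lo 0) (sz 0) A#}) =
    image_mset (restr 0 (sz 0)) (word_profiles u v sz 0 n)" for n
    by (simp add: 1 2)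
  from words_Suc_sum[where k = 0, OF this] show ?case by (simp only: word_profiles.simps(2))
next
  case (Suc k)
  have n: "nested lo sz (Suc k)" "lo k \<le> lo (Suc k)" "lo (Suc k) + int (sz (Suc k)) \<le> lo k + int (sz k)"
    using Suc.prems unfolding nested_def by auto
  have dec: "sz (Suc i) \<le> sz i" if "Suc i < Suc k" for i
    using n(1) that unfolding nested_def by force
  let ?d = "nat (lo (Suc k) - lo k)"
  have "(\<Sum>A\<in>words u v c0 lo sz (Suc k) n. {#word_profile (lo (Suc k)) (sz (Suc k)) A#}) =
    image_mset (restr 0 (sz (Suc k))) (word_profiles u v sz (Suc k) n)" for n
  proof -
    have "(\<Sum>A\<in>words u v c0 lo sz (Suc k) n. {#word_profile (lo (Suc k)) (sz (Suc k)) A#}) =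
        image_mset (restr ?d (sz (Suc k))) (\<Sum>A\<in>words u v c0 lo sz (Suc k) n. {#word_profile (lo k) (sz k) A#})"
      unfolding word_profile_restr[OF n(2,3)] image_mset_sum by simp
    also have "\<dots> = image_mset (restr ?d (sz (Suc k))) (word_profiles u v sz (Suc k) n)"
      unfolding Suc.IH[OF n(1)] ..
    \<comment> \<open>Here the rows lost at the bottom are traded for rows at the top, and with them
      the last dependence on \<open>lo\<close> disappears.\<close>
    also have "\<dots> = image_mset (restr 0 (sz (Suc k))) (word_profiles u v sz (Suc k) n)"
      using span_restr[of "word_profiles u v sz (Suc k) n" "sz k" "sz (Suc k)" ?d]
        word_profiles_span[of k sz u v n] dec n(2,3) by simp
    finally show ?thesis .
  qed
  from words_Suc_sum[where k = "Suc k", OF this] show ?case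
    by (simp only: word_profiles.simps(2)[of u v sz "Suc k"])
qed

lemma card_words:
  assumes "nested lo sz k"
  shows "card (words u v c0 lo sz k n) = size (word_profiles u v sz k n)"
proof (cases k)
  case (Suc k')
  have "card (words u v c0 lo sz k n) = size (\<Sum>B\<in>words u v c0 lo sz k n. {#word_profile (lo k') (sz k') B#})"
    by (simp add: size_multiset_sum)
  then show ?thesis unfolding Suc words_profiles[OF assms[unfolded Suc]] .
qed simp

lemma region_Suc: "region c0 lo sz (Suc k) = region c0 lo sz k \<union> (\<lambda>x. (c0 + int k, lo k + int x)) ` {1..sz k}"
proof (intro subset_antisym subsetI)
  fix p assume "p \<in> region c0 lo sz (Suc k)"
  then obtain i j where p: "p = (c0 + int i, j)" "i < Suc k" "lo i < j" "j \<le> lo i + int (sz i)"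
    unfolding region_def by auto
  show "p \<in> region c0 lo sz k \<union> (\<lambda>x. (c0 + int k, lo k + int x)) ` {1..sz k}"
  proof (cases "i = k")
    case True
    then have "p = (c0 + int k, lo k + int (nat (j - lo k)))" "nat (j - lo k) \<in> {1..sz k}" using p by auto
    then show ?thesis by blast
  qed (use p in \<open>auto simp: region_def\<close>)
qed (auto simp: region_def)

lemma finite_region: "finite (region c0 lo sz k)"
proof (induction k)
  case 0
  have "region c0 lo sz 0 = {}" by (auto simp: region_def)
  then show ?case by simp
qed (simp add: region_Suc)

text \<open>Later columns do not change the prefix up to column \<open>i\<close>, so the nested
  bounds of the recursion become one condition for each prefix.\<close>

lemma in_words:
  "A \<in> words u v c0 lo sz k n \<longleftrightarrow>
    A \<subseteq> region c0 lo sz k \<and> card A = n \<and> (\<forall>i j j'. (i, j) \<in> A \<longrightarrow> (i, j') \<in> A \<longrightarrow> j = j') \<and>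
    (\<forall>i<k. bounded_by u v (sz i) (word_profile (lo i) (sz i) {p \<in> A. fst p \<le> c0 + int i}))"
proof (induction k arbitrary: n A)
  case 0
  have "region c0 lo sz 0 = {}" by (simp add: region_def)
  then show ?case by auto
next
  case (Suc k)
  let ?b = "\<lambda>i A. bounded_by u v (sz i) (word_profile (lo i) (sz i) {p \<in> A. fst p \<le> c0 + int i})"
  note reg = region_Suc[of c0 lo sz k]
  have all: "{p \<in> A. fst p \<le> c0 + int k} = A" if "A \<subseteq> region c0 lo sz (Suc k)" for A
    using that unfolding region_def by fastforce
  note fin = finite_region[of c0 lo sz k] finite_region[of c0 lo sz "Suc k"]
  have old: "i < c0 + int k" if "(i, j) \<in> region c0 lo sz k" for i j using that by (auto simp: region_def)
  show ?case
  proof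
    assume A: "A \<in> words u v c0 lo sz (Suc k) n"
    then have bd: "bounded_by u v (sz k) (word_profile (lo k) (sz k) A)" by simp
    from A consider "A \<in> words u v c0 lo sz k n"
      | n' x A' where "n = Suc n'" "1 \<le> x" "x \<le> sz k" "A' \<in> words u v c0 lo sz k n'"
        "A = insert (c0 + int k, lo k + int x) A'"
      by (auto split: nat.splits)
    then show "A \<subseteq> region c0 lo sz (Suc k) \<and> card A = n \<and> (\<forall>i j j'. (i, j) \<in> A \<longrightarrow> (i, j') \<in> A \<longrightarrow> j = j') \<and>
      (\<forall>i<Suc k. ?b i A)"
    proof cases
      case 1
      then have "A \<subseteq> region c0 lo sz (Suc k)" unfolding Suc.IH reg by auto
      then show ?thesis using 1 bd all unfolding Suc.IH by (auto simp: less_Suc_eq)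
    next
      case 2
      note A' = 2(4)[unfolded Suc.IH]
      have sub: "A \<subseteq> region c0 lo sz (Suc k)" using A' 2 unfolding reg by auto
      have nin: "(c0 + int k, j) \<notin> A'" for j
        using old[of "c0 + int k" j] conjunct1[OF A'] by blast
      have "finite A'" using conjunct1[OF A'] fin(1) by (rule finite_subset)
      then have "card A = n" using A' 2 nin by simp
      moreover have "?b i A" if "i < Suc k" for i
      proof (cases "i = k")
        case True
        then show ?thesis using bd all[OF sub] by simp
      next
        case False
        then have "{p \<in> A. fst p \<le> c0 + int i} = {p \<in> A'. fst p \<le> c0 + int i}"
          using that unfolding 2(5) by auto
        then show ?thesis using A' that False by simp
      qed
      moreover have "\<forall>i j j'. (i, j) \<in> A \<longrightarrow> (i, j') \<in> A \<longrightarrow> j = j'"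
        using A' nin unfolding 2(5) by auto
      ultimately show ?thesis using sub by blast
    qed
  next
    assume A: "A \<subseteq> region c0 lo sz (Suc k) \<and> card A = n \<and> (\<forall>i j j'. (i, j) \<in> A \<longrightarrow> (i, j') \<in> A \<longrightarrow> j = j') \<and>
      (\<forall>i<Suc k. ?b i A)"
    then have bd: "bounded_by u v (sz k) (word_profile (lo k) (sz k) A)" using all[of A] by auto
    have finA: "finite A" using A fin finite_subset by blast
    show "A \<in> words u v c0 lo sz (Suc k) n"
    proof (cases "A \<subseteq> region c0 lo sz k")
      case True
      then have "A \<in> words u v c0 lo sz k n" using A unfolding Suc.IH by simp
      then show ?thesis using bd by simp
    next
      case False
      then obtain x where x: "1 \<le> x" "x \<le> sz k" "(c0 + int k, lo k + int x) \<in> A"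
      proof -
        obtain p where "p \<in> A" "p \<notin> region c0 lo sz k" using False by blast
        moreover from this have "p \<in> (\<lambda>x. (c0 + int k, lo k + int x)) ` {1..sz k}"
          using conjunct1[OF A] unfolding reg by blast
        ultimately show thesis using that by auto
      qed
      let ?A' = "A - {(c0 + int k, lo k + int x)}"
      have "?A' \<subseteq> region c0 lo sz k" using A x unfolding reg by auto
      moreover obtain n' where n': "n = Suc n'" using A x finA by (metis card_eq_0_iff empty_iff not0_implies_Suc)
      then have "card ?A' = n'" using A x by simp
      moreover have "?b i ?A'" if "i < k" for i
      proof -
        have "{p \<in> ?A'. fst p \<le> c0 + int i} = {p \<in> A. fst p \<le> c0 + int i}" using that by auto
        then show ?thesis using A that by simp
      qed
      ultimately have "?A' \<in> words u v c0 lo sz k n'" using A unfolding Suc.IH by blast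
      moreover have "A = (case (x, ?A') of (x, A) \<Rightarrow> insert (c0 + int k, lo k + int x) A)" using x by auto
      ultimately have "A \<in> (\<lambda>(x, A). insert (c0 + int k, lo k + int x) A) ` ({1..sz k} \<times> words u v c0 lo sz k n')"
        using x by (intro image_eqI[of _ _ "(x, ?A')"]) auto
      then show ?thesis using bd n' by simp
    qed
  qed
qed

section \<open>Chains in a stack as sequences in prefixes\<close>

lemma nested_le:
  assumes "nested lo sz K" "i \<le> k" "k < K"
  shows "lo i \<le> lo k \<and> lo k + int (sz k) \<le> lo i + int (sz i)"
  using assms(2,3)
proof (induction k rule: dec_induct)
  case (step k)
  then show ?case using assms(1) unfolding nested_def by force
qed simp

text \<open>Chains are lists whereas \<open>lis\<close> speaks of sets. Sorting by columns passes
  from a set of pairwise comparable boxes to a list.\<close>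

lemma obtain_sorted_list:
  fixes Y :: "(int \<times> int) set"
  assumes "finite Y" and "\<And>p q. p \<in> Y \<Longrightarrow> q \<in> Y \<Longrightarrow> p \<noteq> q \<Longrightarrow> R p q \<or> R q p"
    and "\<And>p q. R p q \<Longrightarrow> fst p < fst q"
  shows "\<exists>bs. set bs = Y \<and> distinct bs \<and> sorted_wrt R bs"
  using assms(1,2)
proof (induction Y rule: finite_ranking_induct[where f = fst])
  case (insert x S)
  then obtain bs where bs: "set bs = S" "distinct bs" "sorted_wrt R bs" by (metis insertI2)
  show ?case
  proof (cases "x \<in> S")
    case True
    then show ?thesis using bs by (intro exI[of _ bs]) auto
  next
    case False
    have "R y x" if "y \<in> S" for y
      using insert.prems[of y x] insert.hyps(2)[OF that] assms(3)[of x y] that False by auto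
    then show ?thesis using bs False by (intro exI[of _ "bs @ [x]"]) (auto simp: sorted_wrt_append)
  qed
qed simp

text \<open>The sign \<open>s\<close> treats ne-chains and se-chains together. A chain lies in the rectangle formed by the
  columns up to its last one and the rows of that column.\<close>

lemma chains_bounded_iff:
  fixes s :: int
  assumes nst: "nested lo sz K" and M: "M = region c0 lo sz K" and s: "s = 1 \<or> s = -1"
    and A: "A = {b \<in> M. F b = 1}"
  shows "(\<forall>bs. chain M F bs \<and> successively (\<lambda>(i, j) (i', j'). i < i' \<and> s * j < s * j') bs \<longrightarrow> length bs \<le> u) \<longleftrightarrow>
    (\<forall>k<K. lis {(j, s * i) |i j. (i, j) \<in> A \<and> i \<le> c0 + int k \<and> lo k < j \<and> j \<le> lo k + int (sz k)} \<le> u)"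
    (is "?L \<longleftrightarrow> ?R")
proof
  let ?R = "\<lambda>(i :: int, j) (i', j'). i < i' \<and> s * j < s * j'"
  let ?S = "\<lambda>k. {(j, s * i) |i j. (i, j) \<in> A \<and> i \<le> c0 + int k \<and> lo k < j \<and> j \<le> lo k + int (sz k)}"
  have finM: "finite M" unfolding M by (rule finite_region)
  have finS: "finite (fst ` ?S k)" for k
    by (rule finite_subset[of _ "snd ` A"]) (use finM A in force)+
  have ss: "s * (s * x) = x" for x using s by auto
  {
    assume L: ?L
    show "\<forall>k<K. lis (?S k) \<le> u"
    proof (intro allI impI)
      fix k assume k: "k < K"
      obtain X where X: "X \<subseteq> ?S k" "increasing X" "finite X" "card X = lis (?S k)"
        using lis_obtain[OF finS] .
      let ?\<phi> = "\<lambda>(j, x). (s * x, j)"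
      let ?Y = "?\<phi> ` X"
      have Y: "(i, j) \<in> A \<and> i \<le> c0 + int k \<and> lo k < j \<and> j \<le> lo k + int (sz k)" if "(i, j) \<in> ?Y" for i j
      proof -
        obtain x where x: "(j, x) \<in> X" "i = s * x" using \<open>(i, j) \<in> ?Y\<close> by auto
        then obtain i' where "x = s * i'" "(i', j) \<in> A \<and> i' \<le> c0 + int k \<and> lo k < j \<and> j \<le> lo k + int (sz k)"
          using X(1) by blast
        then show ?thesis unfolding x(2) by (simp only: ss)
      qed
      have inj: "inj_on ?\<phi> X" using s by (auto simp: inj_on_def)
      have cmp: "?R p q \<or> ?R q p" if pq: "p \<in> ?Y" "q \<in> ?Y" "p \<noteq> q" for p q
      proof -
        obtain j x j' x' where e: "(j, x) \<in> X" "(j', x') \<in> X" "p = (s * x, j)" "q = (s * x', j')"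
          using pq by auto
        then have "(j, x) \<noteq> (j', x')" using pq by auto
        from increasingD[OF X(2) e(1,2) this] show ?thesis using s unfolding e by auto
      qed
      have "\<exists>bs. set bs = ?Y \<and> distinct bs \<and> sorted_wrt ?R bs"
        by (rule obtain_sorted_list) (use X(3) cmp in auto)
      then obtain bs where bs: "set bs = ?Y" "distinct bs" "sorted_wrt ?R bs" by blast
      have "rectangle hull (set bs) \<subseteq> M"
      proof (cases "?Y = {}")
        case False
        let ?lo = "\<lambda>\<pi>. Min (\<pi> ` ?Y)" and ?hi = "\<lambda>\<pi>. Max (\<pi> ` ?Y)"
        have fY: "finite ?Y" using X(3) by simp
        have "c0 \<le> ?lo fst" "?hi fst \<le> c0 + int k" "lo k < ?lo snd" "?hi snd \<le> lo k + int (sz k)"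
        proof -
          have "c0 \<le> i \<and> i \<le> c0 + int k \<and> lo k < j \<and> j \<le> lo k + int (sz k)" if "(i, j) \<in> ?Y" for i j
            using Y[OF that] unfolding A M region_def by auto
          then have "\<forall>p\<in>?Y. c0 \<le> fst p \<and> fst p \<le> c0 + int k \<and> lo k < snd p \<and> snd p \<le> lo k + int (sz k)"
            by fastforce
          then show "c0 \<le> ?lo fst" "?hi fst \<le> c0 + int k" "lo k < ?lo snd" "?hi snd \<le> lo k + int (sz k)"
            using fY False by (simp_all add: Min_ge_iff Max_le_iff Min_gr_iff)
        qed
        note b = this
        show ?thesis
          unfolding bs(1) rectangle_hull_eq[OF fY False]
        proof
          fix p assume "p \<in> {?lo fst..?hi fst} \<times> {?lo snd..?hi snd}"
          then obtain x y where p: "p = (x, y)" "c0 \<le> x" "x \<le> c0 + int k" "lo k < y" "y \<le> lo k + int (sz k)"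
            using b by fastforce
          let ?i = "nat (x - c0)"
          \<comment> \<open>Every box of the bounding rectangle lies in a column up to
            \<open>k\<close> and in a row of column \<open>k\<close>; earlier columns have larger
            windows.\<close>
          have i: "?i \<le> k" "x = c0 + int ?i" using p by auto
          from nested_le[OF nst i(1) k] have "lo ?i < y" "y \<le> lo ?i + int (sz ?i)" using p by auto
          then show "p \<in> M" unfolding M region_def p(1) using i k by (auto intro!: exI[of _ ?i])
        qed
      qed (use bs(1) rectangle_hull_empty in simp)
      moreover have "\<forall>b\<in>set bs. b \<in> M \<and> F b = 1" using Y unfolding bs(1) A by fastforce
      moreover have "successively ?R bs" using bs(3) by (rule successively_if_sorted_wrt)
      ultimately have "length bs \<le> u" using L unfolding chain_def by blast
      then show "lis (?S k) \<le> u"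
        using bs X(4) card_image[OF inj] distinct_card[OF bs(2)] by simp
    qed
  next
    assume R: "\<forall>k<K. lis (?S k) \<le> u"
    show ?L
    proof (intro allI impI, elim conjE)
      fix bs assume ch: "chain M F bs" and suc: "successively ?R bs"
      have "transp ?R" by (auto simp: transp_def)
      then have sorted: "sorted_wrt ?R bs" using suc successively_conv_sorted_wrt by blast
      have dist: "distinct bs" by (rule successively_right_distinct[OF suc]) auto
      show "length bs \<le> u"
      proof (cases "bs = []")
        case False
        let ?Y = "set bs"
        have YA: "?Y \<subseteq> A" using ch unfolding chain_def A by auto
        have fY: "finite ?Y" "?Y \<noteq> {}" using False by auto
        have "Max (fst ` ?Y) \<in> fst ` ?Y" using fY by (intro Max_in) auto
        then obtain j0 where "(Max (fst ` ?Y), j0) \<in> M" using YA A by force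
        then obtain k where k: "k < K" "Max (fst ` ?Y) = c0 + int k" unfolding M region_def by auto
        \<comment> \<open>The bounding rectangle contains the box in row \<open>j\<close> of the
          last column of the chain. As that box belongs to \<open>M\<close>, row \<open>j\<close>
          lies in the window of this column.\<close>
        have in_S: "lo k < j \<and> j \<le> lo k + int (sz k) \<and> i \<le> c0 + int k" if ij: "(i, j) \<in> ?Y" for i j
        proof -
          have "i \<le> Max (fst ` ?Y)" "Min (fst ` ?Y) \<le> Max (fst ` ?Y)" "Min (snd ` ?Y) \<le> j" "j \<le> Max (snd ` ?Y)"
            using ij fY by (force intro: Max_ge Min_le Min_in)+
          then have "(Max (fst ` ?Y), j) \<in> rectangle hull ?Y"
            unfolding rectangle_hull_eq[OF fY] by simp
          then have "(c0 + int k, j) \<in> M" using ch k unfolding chain_def by auto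
          then show ?thesis using \<open>i \<le> Max (fst ` ?Y)\<close> k unfolding M region_def by auto
        qed
        let ?X = "(\<lambda>(i, j). (j, s * i)) ` ?Y"
        have cmp: "?R p q \<or> ?R q p" if "p \<in> ?Y" "q \<in> ?Y" "p \<noteq> q" for p q
        proof -
          obtain x y where xy: "x < length bs" "y < length bs" "p = bs ! x" "q = bs ! y"
            using \<open>p \<in> ?Y\<close> \<open>q \<in> ?Y\<close> by (metis in_set_conv_nth)
          then have "x < y \<or> y < x" using \<open>p \<noteq> q\<close> by (metis linorder_neqE_nat)
          then show ?thesis using sorted_wrt_nth_less[OF sorted] xy by metis
        qed
        have "increasing ?X"
          unfolding increasing_def
        proof (intro ballI impI)
          fix p q assume pq: "p \<in> ?X" "q \<in> ?X" "p \<noteq> q"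
          then obtain i j i' j' where e: "(i, j) \<in> ?Y" "(i', j') \<in> ?Y" "p = (j, s * i)" "q = (j', s * i')" by auto
          then have "(i, j) \<noteq> (i', j')" using pq by auto
          from cmp[OF e(1,2) this] show "fst p < fst q \<and> snd p < snd q \<or> fst q < fst p \<and> snd q < snd p"
            using s unfolding e by auto
        qed
        moreover have "?X \<subseteq> ?S k" using in_S YA by fastforce
        ultimately have "card ?X \<le> lis (?S k)" using finS by (intro lis_ge)
        moreover have "card ?X = length bs"
          using s by (subst card_image) (auto simp: inj_on_def distinct_card[OF dist])
        ultimately show ?thesis using R k by fastforce
      qed simp
    qed
  }
qed

lemma ne_le_iff: "finite M \<Longrightarrow> ne M F \<le> u \<longleftrightarrow> (\<forall>bs. ne_chain M F bs \<longrightarrow> length bs \<le> u)"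
  unfolding ne_def using finite_ne_chains[of M F] ne_chain_Nil[of M F]
  by (subst Max_le_iff) auto

lemma se_le_iff: "finite M \<Longrightarrow> se M F \<le> u \<longleftrightarrow> (\<forall>bs. se_chain M F bs \<longrightarrow> length bs \<le> u)"
  unfolding se_def using finite_se_chains[of M F] se_chain_Nil[of M F]
  by (subst Max_le_iff) auto

lemma bounded_fillings_iff:
  assumes nst: "nested lo sz K" and M: "M = region c0 lo sz K" and A: "A = {b \<in> M. F b = 1}"
  shows "ne M F \<le> u \<and> se M F \<le> v \<longleftrightarrow>
    (\<forall>k<K. bounded_by u v (sz k) (word_profile (lo k) (sz k) {p \<in> A. fst p \<le> c0 + int k}))"
proof -
  have fin: "finite M" unfolding M by (rule finite_region)
  have 1: "{(j, 1 * i) |i j. (i, j) \<in> A \<and> i \<le> c0 + int k \<and> lo k < j \<and> j \<le> lo k + int (sz k)} =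
    {(j, i) |i j. (i, j) \<in> {p \<in> A. fst p \<le> c0 + int k} \<and> lo k + int 0 < j \<and> j \<le> lo k + int (min (sz k) (sz k))}" for k
    by auto
  have 2: "{(j, - 1 * i) |i j. (i, j) \<in> A \<and> i \<le> c0 + int k \<and> lo k < j \<and> j \<le> lo k + int (sz k)} =
    {(j, - i) |i j. (i, j) \<in> {p \<in> A. fst p \<le> c0 + int k} \<and> lo k + int 0 < j \<and> j \<le> lo k + int (min (sz k) (sz k))}" for k
    by auto
  have "ne M F \<le> u \<longleftrightarrow> (\<forall>k<K. fst (word_profile (lo k) (sz k) {p \<in> A. fst p \<le> c0 + int k} 0 (sz k)) \<le> u)"
    using chains_bounded_iff[OF nst M _ A, of 1 u]
    unfolding ne_le_iff[OF fin] ne_chain_def word_profile_def 1 fst_conv by simp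
  moreover have "se M F \<le> v \<longleftrightarrow> (\<forall>k<K. snd (word_profile (lo k) (sz k) {p \<in> A. fst p \<le> c0 + int k} 0 (sz k)) \<le> v)"
    using chains_bounded_iff[OF nst M _ A, of "- 1" v]
    unfolding se_le_iff[OF fin] se_chain_def word_profile_def 2 snd_conv by simp
  ultimately show ?thesis unfolding bounded_by_def by blast
qed

text \<open>The right-hand side knows the number of columns and their lengths but not
  \<open>lo\<close>. This already settles the theorem for bounded in place of exact lengths.\<close>

lemma card_bounded_fillings:
  assumes nst: "nested lo sz K" and M: "M = region c0 lo sz K"
  shows "card {F \<in> fillings M. (\<Sum>b\<in>M. F b) = n \<and> ne M F \<le> u \<and> se M F \<le> v} = size (word_profiles u v sz K n)"
proof -
  have fin: "finite M" unfolding M by (rule finite_region)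
  let ?ones = "\<lambda>F. {b \<in> M. F b = (1::nat)}" and ?ind = "\<lambda>A. restrict (\<lambda>b. if b \<in> A then 1 else 0) M"
  have words: "?ones F \<in> words u v c0 lo sz K n \<longleftrightarrow>
      F \<in> fillings M \<and> (\<Sum>b\<in>M. F b) = n \<and> ne M F \<le> u \<and> se M F \<le> v" if F: "F \<in> M \<rightarrow>\<^sub>E {0, 1}" for F
  proof -
    have "(\<Sum>b\<in>M. F b) = (\<Sum>b\<in>M. if F b = 1 then 1 else 0)"
      using F by (intro sum.cong) (auto simp: PiE_iff)
    also have "\<dots> = card (?ones F)" using fin by (simp flip: sum.inter_filter)
    finally have card: "(\<Sum>b\<in>M. F b) = card (?ones F)" .
    have uniq: "F \<in> fillings M \<longleftrightarrow> (\<forall>i j j'. (i, j) \<in> ?ones F \<longrightarrow> (i, j') \<in> ?ones F \<longrightarrow> j = j')"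
      using F unfolding fillings_def column_of_def Uniq_def by auto
    show ?thesis
      unfolding in_words card uniq bounded_fillings_iff[OF nst M refl] M[symmetric] by auto
  qed
  have "bij_betw ?ones {F \<in> fillings M. (\<Sum>b\<in>M. F b) = n \<and> ne M F \<le> u \<and> se M F \<le> v} (words u v c0 lo sz K n)"
  proof (rule bij_betw_byWitness[where f' = ?ind])
    show "\<forall>F\<in>{F \<in> fillings M. (\<Sum>b\<in>M. F b) = n \<and> ne M F \<le> u \<and> se M F \<le> v}. ?ind (?ones F) = F"
    proof
      fix F assume "F \<in> {F \<in> fillings M. (\<Sum>b\<in>M. F b) = n \<and> ne M F \<le> u \<and> se M F \<le> v}"
      then have F: "F \<in> M \<rightarrow>\<^sub>E {0, 1}" by (auto simp: fillings_def)
      show "?ind (?ones F) = F"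
      proof
        fix b show "?ind (?ones F) b = F b"
          using PiE_mem[OF F, of b] PiE_arb[OF F, of b] by (cases "b \<in> M") auto
      qed
    qed
    have sub: "A \<subseteq> M" if "A \<in> words u v c0 lo sz K n" for A using that unfolding in_words M by blast
    have ones_ind: "?ones (?ind A) = A" if "A \<in> words u v c0 lo sz K n" for A
      using sub[OF that] by auto
    then show "\<forall>A\<in>words u v c0 lo sz K n. ?ones (?ind A) = A" by blast
    show "?ones ` {F \<in> fillings M. (\<Sum>b\<in>M. F b) = n \<and> ne M F \<le> u \<and> se M F \<le> v} \<subseteq> words u v c0 lo sz K n"
    proof (rule image_subsetI)
      fix F assume F: "F \<in> {F \<in> fillings M. (\<Sum>b\<in>M. F b) = n \<and> ne M F \<le> u \<and> se M F \<le> v}"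
      then have "F \<in> M \<rightarrow>\<^sub>E {0, 1}" by (simp add: fillings_def)
      from words[OF this] F show "?ones F \<in> words u v c0 lo sz K n" by simp
    qed
    show "?ind ` words u v c0 lo sz K n \<subseteq> {F \<in> fillings M. (\<Sum>b\<in>M. F b) = n \<and> ne M F \<le> u \<and> se M F \<le> v}"
    proof (rule image_subsetI)
      fix A assume A: "A \<in> words u v c0 lo sz K n"
      have "?ind A \<in> M \<rightarrow>\<^sub>E {0, 1}" by auto
      from words[OF this] A ones_ind[OF A]
      show "?ind A \<in> {F \<in> fillings M. (\<Sum>b\<in>M. F b) = n \<and> ne M F \<le> u \<and> se M F \<le> v}" by simp
    qed
  qed
  from bij_betw_same_card[OF this] show ?thesis using card_words[OF nst] by simp
qed

text \<open>For \<open>u = 0\<close> the truncated \<open>u - 1\<close> would subtract the whole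
  set, hence the case distinction.\<close>

lemma card_eq_by_card_le:
  fixes f :: "'a \<Rightarrow> nat"
  assumes "finite S"
  shows "card {x \<in> S. P x \<and> f x = u} =
    card {x \<in> S. P x \<and> f x \<le> u} - (if u = 0 then 0 else card {x \<in> S. P x \<and> f x \<le> u - 1})"
proof (cases "u = 0")
  case False
  have "{x \<in> S. P x \<and> f x = u} = {x \<in> S. P x \<and> f x \<le> u} - {x \<in> S. P x \<and> f x \<le> u - 1}"
    using False by auto
  moreover have "{x \<in> S. P x \<and> f x \<le> u - 1} \<subseteq> {x \<in> S. P x \<and> f x \<le> u}" by auto
  ultimately show ?thesis using False assms by (simp add: card_Diff_subset)
qed simp

text \<open>Differences are taken twice: first the se-length becomes exact while the ne-length is
  still bounded, then the ne-length.\<close>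

lemma num_fillings_eqI:
  assumes "finite M" "finite M'"
    and le: "\<And>u v. card {F \<in> fillings M. (\<Sum>b\<in>M. F b) = n \<and> ne M F \<le> u \<and> se M F \<le> v} =
      card {F \<in> fillings M'. (\<Sum>b\<in>M'. F b) = n \<and> ne M' F \<le> u \<and> se M' F \<le> v}"
  shows "num_fillings M n u v = num_fillings M' n u v"
proof -
  have fin: "finite (fillings M)" if "finite M" for M
    by (rule finite_subset[of _ "M \<rightarrow>\<^sub>E {0, 1}"]) (auto simp: fillings_def intro: finite_PiE that)
  have 1: "card {F \<in> fillings M. ((\<Sum>b\<in>M. F b) = n \<and> ne M F \<le> u) \<and> se M F = v} =
      card {F \<in> fillings M'. ((\<Sum>b\<in>M'. F b) = n \<and> ne M' F \<le> u) \<and> se M' F = v}" for u v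
    unfolding card_eq_by_card_le[OF fin[OF assms(1)]] card_eq_by_card_le[OF fin[OF assms(2)]]
    using le by (simp add: conj_assoc)
  have 2: "card {F \<in> fillings M. ((\<Sum>b\<in>M. F b) = n \<and> se M F = v) \<and> ne M F \<le> u} =
      card {F \<in> fillings M'. ((\<Sum>b\<in>M'. F b) = n \<and> se M' F = v) \<and> ne M' F \<le> u}" for u v
    using 1[of u v] by (simp add: conj_ac)
  have "card {F \<in> fillings M. ((\<Sum>b\<in>M. F b) = n \<and> se M F = v) \<and> ne M F = u} =
      card {F \<in> fillings M'. ((\<Sum>b\<in>M'. F b) = n \<and> se M' F = v) \<and> ne M' F = u}"
    unfolding card_eq_by_card_le[OF fin[OF assms(1)]] card_eq_by_card_le[OF fin[OF assms(2)]] 2 ..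
  then show ?thesis unfolding num_fillings_def by (simp add: conj_ac)
qed

text \<open>\<open>c0\<close>, \<open>K\<close> and \<open>sz\<close> are fixed beforehand in terms
  of the occupied columns and their lengths, so they agree for \<open>M\<close> and its
  rearrangement. Only \<open>lo\<close> is left to be obtained for each stack.\<close>

lemma stack_region:
  assumes st: "stack_polyomino M" and ne: "M \<noteq> {}"
  defines "c0 \<equiv> Min (fst ` M)" and "K \<equiv> nat (Max (fst ` M) - Min (fst ` M) + 1)"
  defines "sz \<equiv> \<lambda>k. card (column_of M (c0 + int k))"
  obtains lo where "nested lo sz K" "M = region c0 lo sz K"
proof -
  have fin: "finite M" and rc: "\<And>j. connected_line (row_of M j)" and cc: "\<And>i. connected_line (column_of M i)"
    and lj: "left_justified M"
    using st unfolding stack_polyomino_def moon_polyomino_def convex_polyomino_def polyomino_def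
      row_convex_def column_convex_def by auto
  have finc: "finite (column_of M i)" for i
    by (rule finite_subset[of _ "snd ` M"]) (use fin in \<open>force simp: column_of_def\<close>)+
  have finr: "finite (row_of M j)" for j
    by (rule finite_subset[of _ "fst ` M"]) (use fin in \<open>force simp: row_of_def\<close>)+
  have c0: "c0 \<le> i" "i \<le> c0 + int K - 1" if "(i, j) \<in> M" for i j
  proof -
    have "i \<in> fst ` M" using that by force
    then have "c0 \<le> i" "i \<le> Max (fst ` M)" using fin unfolding c0_def by auto
    then show "c0 \<le> i" "i \<le> c0 + int K - 1" unfolding K_def c0_def by auto
  qed
  have "c0 \<in> fst ` M" unfolding c0_def using fin ne by (intro Min_in) auto
  then obtain j0 where j0: "(c0, j0) \<in> M" by force
  have "Min (row_of M j0) = c0"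
    using j0 c0 finr by (intro Min_eqI) (auto simp: row_of_def)
  then have min: "Min (row_of M j) = c0" if "(i, j) \<in> M" for i j
    using lj that j0 unfolding left_justified_def row_indices_def row_of_def by force
  \<comment> \<open>Each nonempty row starts in column \<open>c0\<close> and is connected, so
    columns further to the left contain the rows of those to the right.\<close>
  have left: "(i', j) \<in> M" if "(i, j) \<in> M" "c0 \<le> i'" "i' \<le> i" for i i' j
  proof -
    have "row_of M j \<noteq> {}" using that by (auto simp: row_of_def)
    then have "c0 \<in> row_of M j" using min[OF that(1)] Min_in[OF finr] by metis
    moreover have "i \<in> row_of M j" using that by (simp add: row_of_def)
    ultimately have "{c0..i} \<subseteq> row_of M j" using rc unfolding connected_line_def by blast
    then show ?thesis using that by (auto simp: row_of_def)
  qed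
  have "Max (fst ` M) \<in> fst ` M" using fin ne by (intro Max_in) auto
  then obtain j1 where j1: "(Max (fst ` M), j1) \<in> M" by force
  have full: "column_of M (c0 + int k) \<noteq> {}" if "k < K" for k
  proof -
    have "c0 + int k \<le> Max (fst ` M)" using that unfolding K_def c0_def by linarith
    then show ?thesis using left[OF j1, of "c0 + int k"] by (auto simp: column_of_def)
  qed
  \<comment> \<open>The windows of \<open>region\<close> are open below, hence the
    \<open>- 1\<close>.\<close>
  define lo where "lo k = Min (column_of M (c0 + int k)) - 1" for k
  have interval: "column_of M (c0 + int k) = {lo k<..lo k + int (sz k)}" if "k < K" for k
  proof -
    let ?C = "column_of M (c0 + int k)"
    have "?C = {Min ?C..Max ?C}"
    proof
      show "{Min ?C..Max ?C} \<subseteq> ?C"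
        using cc[of "c0 + int k"] Min_in[OF finc full[OF that]] Max_in[OF finc full[OF that]]
        unfolding connected_line_def by blast
    qed (use finc in auto)
    moreover have "Min ?C \<le> Max ?C" using Min_in[OF finc full[OF that]] finc by simp
    moreover have "sz k = nat (Max ?C - Min ?C + 1)"
      unfolding sz_def by (metis \<open>?C = {Min ?C..Max ?C}\<close> card_atLeastAtMost_int)
    ultimately have "int (sz k) = Max ?C - Min ?C + 1" by simp
    then have "{lo k<..lo k + int (sz k)} = {Min ?C..Max ?C}" unfolding lo_def by auto
    then show ?thesis using \<open>?C = {Min ?C..Max ?C}\<close> by simp
  qed
  have "nested lo sz K"
    unfolding nested_def
  proof (intro allI impI)
    fix k assume k: "Suc k < K"
    have "column_of M (c0 + int (Suc k)) \<subseteq> column_of M (c0 + int k)"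
      using left by (auto simp: column_of_def)
    then have sub: "{lo (Suc k)<..lo (Suc k) + int (sz (Suc k))} \<subseteq> {lo k<..lo k + int (sz k)}"
      using interval[of k] interval[of "Suc k"] k by simp
    have "{lo (Suc k)<..lo (Suc k) + int (sz (Suc k))} \<noteq> {}"
      using full[OF k] interval[OF k] by simp
    then have "lo (Suc k) + 1 \<in> {lo (Suc k)<..lo (Suc k) + int (sz (Suc k))}"
      "lo (Suc k) + int (sz (Suc k)) \<in> {lo (Suc k)<..lo (Suc k) + int (sz (Suc k))}" by auto
    with sub have "lo (Suc k) + 1 \<in> {lo k<..lo k + int (sz k)}"
      "lo (Suc k) + int (sz (Suc k)) \<in> {lo k<..lo k + int (sz k)}" by blast+
    then show "lo k \<le> lo (Suc k) \<and> lo (Suc k) + int (sz (Suc k)) \<le> lo k + int (sz k)" by auto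
  qed
  moreover have "M = region c0 lo sz K"
  proof (intro subset_antisym subsetI)
    fix p assume p: "p \<in> M"
    obtain i j where e: "p = (i, j)" by fastforce
    let ?k = "nat (i - c0)"
    have k: "i = c0 + int ?k" "?k < K" using c0[of i j] p e by auto
    then have "j \<in> column_of M (c0 + int ?k)" using p e by (simp add: column_of_def)
    then have "lo ?k < j" "j \<le> lo ?k + int (sz ?k)" using interval[OF k(2)] by auto
    then show "p \<in> region c0 lo sz K" unfolding region_def e using k by blast
  next
    fix p assume "p \<in> region c0 lo sz K"
    then obtain k j where "p = (c0 + int k, j)" "k < K" "lo k < j" "j \<le> lo k + int (sz k)"
      unfolding region_def by blast
    then show "p \<in> M" using interval[of k] by (auto simp: column_of_def)
  qed
  ultimately show thesis by (rule that)
qed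

theorem theorem1:
  fixes M :: "box set" and \<sigma> :: "int \<Rightarrow> int" and n u v :: nat
  assumes "stack_polyomino M"
    and "\<sigma> permutes row_indices M"
    and "stack_polyomino (permute_rows \<sigma> M)"
  shows "num_fillings M n u v = num_fillings (permute_rows \<sigma> M) n u v"
proof (cases "M = {}")
  case False
  let ?M' = "permute_rows \<sigma> M"
  have fst_eq: "fst ` ?M' = fst ` M" unfolding permute_rows_def by force
  have M': "?M' \<noteq> {}" using False by (simp add: permute_rows_def)
  have inj: "inj \<sigma>" using assms(2) by (rule permutes_inj)
  \<comment> \<open>Rows move as a whole, so every column keeps its length, and by
    \<open>fst_eq\<close> the same columns are occupied.\<close>
  have "column_of ?M' i = \<sigma> ` column_of M i" for i
    unfolding column_of_def permute_rows_def by auto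
  then have card: "card (column_of ?M' i) = card (column_of M i)" for i
    using inj by (simp add: card_image inj_on_subset)
  obtain lo where M: "nested lo (\<lambda>k. card (column_of M (Min (fst ` M) + int k))) (nat (Max (fst ` M) - Min (fst ` M) + 1))"
    "M = region (Min (fst ` M)) lo (\<lambda>k. card (column_of M (Min (fst ` M) + int k))) (nat (Max (fst ` M) - Min (fst ` M) + 1))"
    using stack_region[OF assms(1) False] .
  obtain lo' where M': "nested lo' (\<lambda>k. card (column_of M (Min (fst ` M) + int k))) (nat (Max (fst ` M) - Min (fst ` M) + 1))"
    "?M' = region (Min (fst ` M)) lo' (\<lambda>k. card (column_of M (Min (fst ` M) + int k))) (nat (Max (fst ` M) - Min (fst ` M) + 1))"
    using stack_region[OF assms(3) M'] unfolding fst_eq card .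
  have "finite M" "finite ?M'" by (subst M(2) M'(2), rule finite_region)+
  then show ?thesis
    by (rule num_fillings_eqI) (simp only: card_bounded_fillings[OF M] card_bounded_fillings[OF M'])
qed (simp add: permute_rows_def)

end
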